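(* Let $f\in L_2(D)$. A strong solution of the mixed Cauchy problem $$\mathbb{L}u\equiv u_{tt}(x,t)-\mathcal{L}_x u(x,t)=f(x,t),\quad (x,t)\in D,\qquad u(x,0)=u_t(x,0)=0,\quad x\in\Omega,$$ exists if and only if $f$ satisfies $$\sum_{k=1}^\infty\left|\frac{\tilde f_{k1}}{\lambda_{k1}}\right|^2<\infty,$$ where $\tilde f_{km}=\bigl(f(x,1-t),\,u_{km}(x,t)\bigr)$ (inner product in $L_2(D)$). If this condition holds, then the solution of the problem can be written as $$u(x,t)=\sum_{k=1}^\infty\frac{\tilde f_{k1}}{\lambda_{k1}}u_{k1}(x,t)+\sum_{k=1}^\infty\sum_{m=2}^\infty\frac{\tilde f_{km}}{\lambda_{km}}u_{km}(x,t).$$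
   Context: $\Omega\subset\mathbb{R}^n$ is a bounded domain with smooth boundary and $D=\Omega\times(0,1)$, with points written $(x,t)$, $x\in\Omega$, $t\in(0,1)$. $\mathcal{L}_x$ is a self-adjoint unbounded operator in $L_2(\Omega)$, with domain $\mathcal{D}(\mathcal{L}_x)$, with compact resolvent and satisfying $(\mathcal{L}_x u,u)\ge\|u\|^2$ for $u\in\mathcal{D}(\mathcal{L}_x)$. $\mu_k$, $k\in\mathbb{N}$, are all the eigenvalues of $\mathcal{L}_x$, counted with multiplicity and numbered in nondecreasing order, and $u_k(x)$, $k\in\mathbb{N}$, is a complete orthonormal system in $L_2(\Omega)$ of corresponding eigenfunctions. Strong solution: a function $u\in L_2(D)$ is called a strong solution of the mixed Cauchy problem if there is a sequence of functions $u_n\in C^2(\bar D)$ satisfying $u_n(x,0)=(u_n)_t(x,0)=0$ for $x\in\Omega$ and $u_n(\cdot,t)\in\mathcal{D}(\mathcal{L}_x)$ for every $t\in(0,1)$, such that $u_n\to u$ and $\mathbb{L}u_n\to f$ in the norm of $L_2(D)$. The system $u_{km}(x,t)=u_k(x)v_{km}(t)$, $k,m\in\mathbb{N}$, is the complete orthonormal system in $L_2(D)$ of eigenfunctions of the spectral problem $u_{tt}(x,t)-\mathcal{L}_xu(x,t)=\lambda u(x,1-t)$ in $D$, $u(x,0)=u_t(x,0)=0$, where for each $k$ the functions $v_{km}$, $m\in\mathbb{N}$, form a complete orthonormal system in $L_2(0,1)$ of eigenfunctions, with eigenvalues $\lambda_{km}$, of the problem $v_{km}''(t)-\mu_kv_{km}(t)=\lambda_{km}v_{km}(1-t)$,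 $0<t<1$, $v_{km}(0)=v_{km}'(0)=0$. For each $k$, $\lambda_{k1}$ denotes the eigenvalue of smallest absolute value among $\{\lambda_{km}\}_{m\in\mathbb{N}}$.
   Formalization: The eigenfunctions u_km are assumed to satisfy the spectral problem in the sense of strong solutions (approximable by C^2 functions); for an abstract L_x whose domain contains no nonzero C^2 function the claim fails without this. *)

theory Defs
  imports "HOL-Analysis.Analysis"
begin

section \<open>Square-integrable functions\<close>

text \<open>
  Elements of \<open>L\<^sub>2(M)\<close> are handled through representatives: everything below is invariant under
  changes on null sets, and equality in \<open>L\<^sub>2(M)\<close> is almost-everywhere equality. Scalars are complex.
\<close>

definition L2 :: "'a measure \<Rightarrow> ('a \<Rightarrow> complex) set" where
  "L2 M = {f \<in> borel_measurable M. integrable M (\<lambda>x. (cmod (f x))\<^sup>2)}"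

definition l2_inner :: "'a measure \<Rightarrow> ('a \<Rightarrow> complex) \<Rightarrow> ('a \<Rightarrow> complex) \<Rightarrow> complex" where
  "l2_inner M f g = (LINT x|M. f x * cnj (g x))"

definition l2_norm :: "'a measure \<Rightarrow> ('a \<Rightarrow> complex) \<Rightarrow> real" where
  "l2_norm M f = sqrt (LINT x|M. (cmod (f x))\<^sup>2)"

definition l2_tendsto :: "'a measure \<Rightarrow> (nat \<Rightarrow> 'a \<Rightarrow> complex) \<Rightarrow> ('a \<Rightarrow> complex) \<Rightarrow> bool" where
  "l2_tendsto M F f \<longleftrightarrow>
     (\<forall>n. F n \<in> L2 M) \<and> f \<in> L2 M \<and> (\<lambda>n. l2_norm M (\<lambda>x. F n x - f x)) \<longlonglongrightarrow> 0"

definition l2_sums :: "'a measure \<Rightarrow> (nat \<Rightarrow> 'a \<Rightarrow> complex) \<Rightarrow> ('a \<Rightarrow> complex) \<Rightarrow> bool" where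
  "l2_sums M F s \<longleftrightarrow> l2_tendsto M (\<lambda>N x. \<Sum>k<N. F k x) s"

definition complete_orthonormal :: "'a measure \<Rightarrow> ('i \<Rightarrow> 'a \<Rightarrow> complex) \<Rightarrow> bool" where
  "complete_orthonormal M e \<longleftrightarrow>
     (\<forall>i. e i \<in> L2 M) \<and>
     (\<forall>i j. l2_inner M (e i) (e j) = (if i = j then 1 else 0)) \<and>
     (\<forall>f\<in>L2 M. \<forall>\<epsilon>>0. \<exists>I c. finite I \<and> l2_norm M (\<lambda>x. f x - (\<Sum>i\<in>I. c i * e i x)) < \<epsilon>)"


section \<open>Unbounded operators in \<open>L\<^sub>2\<close>\<close>

text \<open>An operator is given by its domain \<open>Dom\<close> and a map \<open>A\<close>, whose values off \<open>Dom\<close> are irrelevant.\<close>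

definition l2_operator ::
  "'a measure \<Rightarrow> ('a \<Rightarrow> complex) set \<Rightarrow> (('a \<Rightarrow> complex) \<Rightarrow> 'a \<Rightarrow> complex) \<Rightarrow> bool" where
  "l2_operator M Dom A \<longleftrightarrow>
     Dom \<subseteq> L2 M \<and> (\<forall>u\<in>Dom. A u \<in> L2 M) \<and>
     (\<forall>u\<in>Dom. \<forall>v\<in>L2 M. (AE x in M. u x = v x) \<longrightarrow> v \<in> Dom \<and> (AE x in M. A u x = A v x)) \<and>
     (\<lambda>x. 0) \<in> Dom \<and>
     (\<forall>u\<in>Dom. \<forall>v\<in>Dom. (\<lambda>x. u x + v x) \<in> Dom \<and>
        (AE x in M. A (\<lambda>y. u y + v y) x = A u x + A v x)) \<and>
     (\<forall>u\<in>Dom. \<forall>c. (\<lambda>x. c * u x) \<in> Dom \<and> (AE x in M. A (\<lambda>y. c * u y) x = c * A u x))"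

definition densely_defined :: "'a measure \<Rightarrow> ('a \<Rightarrow> complex) set \<Rightarrow> bool" where
  "densely_defined M Dom \<longleftrightarrow> (\<forall>f\<in>L2 M. \<forall>\<epsilon>>0. \<exists>u\<in>Dom. l2_norm M (\<lambda>x. f x - u x) < \<epsilon>)"

definition adjoint_graph ::
  "'a measure \<Rightarrow> ('a \<Rightarrow> complex) set \<Rightarrow> (('a \<Rightarrow> complex) \<Rightarrow> 'a \<Rightarrow> complex) \<Rightarrow>
     (('a \<Rightarrow> complex) \<times> ('a \<Rightarrow> complex)) set" where
  "adjoint_graph M Dom A =
     {(v, w). v \<in> L2 M \<and> w \<in> L2 M \<and> (\<forall>u\<in>Dom. l2_inner M (A u) v = l2_inner M u w)}"

definition self_adjoint ::
  "'a measure \<Rightarrow> ('a \<Rightarrow> complex) set \<Rightarrow> (('a \<Rightarrow> complex) \<Rightarrow> 'a \<Rightarrow> complex) \<Rightarrow> bool" where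
  "self_adjoint M Dom A \<longleftrightarrow>
     densely_defined M Dom \<and>
     adjoint_graph M Dom A = {(v, w). v \<in> Dom \<and> w \<in> L2 M \<and> (AE x in M. w x = A v x)}"

definition resolvent_set ::
  "'a measure \<Rightarrow> ('a \<Rightarrow> complex) set \<Rightarrow> (('a \<Rightarrow> complex) \<Rightarrow> 'a \<Rightarrow> complex) \<Rightarrow> complex set" where
  "resolvent_set M Dom A =
     {z. (\<forall>g\<in>L2 M. \<exists>u\<in>Dom. AE x in M. A u x - z * u x = g x) \<and>
         (\<exists>C. \<forall>u\<in>Dom. l2_norm M u \<le> C * l2_norm M (\<lambda>x. A u x - z * u x))}"

text \<open>
  Compactness of \<open>(A - z)\<^sup>-\<^sup>1\<close> for some \<open>z\<close> in the resolvent set (by the resolvent identity, then for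
  all of them): bounded sequences are mapped to sequences with a convergent subsequence.
\<close>

definition compact_resolvent ::
  "'a measure \<Rightarrow> ('a \<Rightarrow> complex) set \<Rightarrow> (('a \<Rightarrow> complex) \<Rightarrow> 'a \<Rightarrow> complex) \<Rightarrow> bool" where
  "compact_resolvent M Dom A \<longleftrightarrow>
     (\<exists>z\<in>resolvent_set M Dom A. \<forall>g u.
        (\<forall>n. g n \<in> L2 M \<and> u n \<in> Dom \<and> (AE x in M. A (u n) x - z * u n x = g n x)) \<and>
        (\<exists>B. \<forall>n. l2_norm M (g n) \<le> B) \<longrightarrow>
        (\<exists>r w. strict_mono (r :: nat \<Rightarrow> nat) \<and> l2_tendsto M (u \<circ> r) w))"

text \<open>
  Completeness of the eigenfunctions forces \<open>\<mu>\<close> to list every eigenvalue, as often as its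
  multiplicity.
\<close>

definition eigenbasis ::
  "'a measure \<Rightarrow> ('a \<Rightarrow> complex) set \<Rightarrow> (('a \<Rightarrow> complex) \<Rightarrow> 'a \<Rightarrow> complex) \<Rightarrow>
     (nat \<Rightarrow> real) \<Rightarrow> (nat \<Rightarrow> 'a \<Rightarrow> complex) \<Rightarrow> bool" where
  "eigenbasis M Dom A \<mu> \<phi> \<longleftrightarrow>
     complete_orthonormal M \<phi> \<and>
     (\<forall>k. \<phi> k \<in> Dom \<and> (AE x in M. A (\<phi> k) x = of_real (\<mu> k) * \<phi> k x)) \<and>
     incseq \<mu>"


section \<open>Smooth functions and domains\<close>

text \<open>
  \<open>C_ext k U K f\<close>, for an open \<open>U\<close> and \<open>U \<subseteq> K \<subseteq> closure U\<close>: \<open>f\<close> is \<open>k\<close> times continuously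
  differentiable on \<open>U\<close> and \<open>f\<close> and all its partial derivatives up to order \<open>k\<close> extend continuously
  to \<open>K\<close>, where \<open>f\<close> itself takes the extended values. So \<open>K = U\<close> gives \<open>C\<^sup>k(U)\<close> and
  \<open>K = closure U\<close> gives \<open>C\<^sup>k\<close> up to the boundary. \<open>G b\<close> is the partial derivative in direction \<open>b\<close>.
\<close>

primrec C_ext ::
  "nat \<Rightarrow> 'a::euclidean_space set \<Rightarrow> 'a set \<Rightarrow> ('a \<Rightarrow> 'b::real_normed_vector) \<Rightarrow> bool" where
  "C_ext 0 U K f \<longleftrightarrow> continuous_on K f"
| "C_ext (Suc k) U K f \<longleftrightarrow>
     continuous_on K f \<and>
     (\<exists>G. (\<forall>x\<in>U. (f has_derivative (\<lambda>h. \<Sum>b\<in>Basis. (h \<bullet> b) *\<^sub>R G b x)) (at x)) \<and>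
          (\<forall>b\<in>Basis. C_ext k U K (G b)))"

text \<open>
  The boundary is locally the regular zero set of a smooth function that is negative exactly on
  the side of \<open>\<Omega>\<close>.
\<close>

definition smooth_boundary :: "'a::euclidean_space set \<Rightarrow> bool" where
  "smooth_boundary \<Omega> \<longleftrightarrow>
     (\<forall>p\<in>frontier \<Omega>. \<exists>U (\<rho> :: 'a \<Rightarrow> real). open U \<and> p \<in> U \<and> \<rho> p = 0 \<and> (\<forall>k. C_ext k U U \<rho>) \<and>
        (\<forall>x\<in>U. \<not> (\<rho> has_derivative (\<lambda>h. 0)) (at x)) \<and> \<Omega> \<inter> U = {x \<in> U. \<rho> x < 0})"

definition bounded_smooth_domain :: "'a::euclidean_space set \<Rightarrow> bool" where
  "bounded_smooth_domain \<Omega> \<longleftrightarrow>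
     open \<Omega> \<and> connected \<Omega> \<and> \<Omega> \<noteq> {} \<and> bounded \<Omega> \<and> smooth_boundary \<Omega>"


section \<open>The mixed Cauchy problem\<close>

abbreviation cylinder :: "'a set \<Rightarrow> ('a \<times> real) set" where
  "cylinder \<Omega> \<equiv> \<Omega> \<times> {0<..<1}"

text \<open>Derivatives in \<open>t\<close> on \<open>[0,1]\<close> are two-sided inside and one-sided at the end points.\<close>

definition deriv01 :: "(real \<Rightarrow> complex) \<Rightarrow> real \<Rightarrow> complex" where
  "deriv01 v t = vector_derivative v (at t within {0..1})"

definition dt :: "('a \<times> real \<Rightarrow> complex) \<Rightarrow> 'a \<times> real \<Rightarrow> complex" where
  "dt u = (\<lambda>(x, t). deriv01 (\<lambda>s. u (x, s)) t)"

definition admissible ::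
  "'a::euclidean_space set \<Rightarrow> ('a \<Rightarrow> complex) set \<Rightarrow> ('a \<times> real \<Rightarrow> complex) \<Rightarrow> bool" where
  "admissible \<Omega> Dom w \<longleftrightarrow>
     C_ext 2 (cylinder \<Omega>) (closure (cylinder \<Omega>)) w \<and>
     (\<forall>x\<in>\<Omega>. w (x, 0) = 0 \<and> dt w (x, 0) = 0) \<and>
     (\<forall>t\<in>{0<..<1}. (\<lambda>x. w (x, t)) \<in> Dom)"

text \<open>
  \<open>g\<close> represents \<open>w\<^sub>t\<^sub>t - A w\<close> on the cylinder. As \<open>A w(\<cdot>,t)\<close> is, for each \<open>t\<close>, only determined
  almost everywhere in \<open>x\<close>, a function on the cylinder is compared with it slice by slice.
\<close>

definition represents_LL ::
  "'a::euclidean_space set \<Rightarrow> (('a \<Rightarrow> complex) \<Rightarrow> 'a \<Rightarrow> complex) \<Rightarrow>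
     ('a \<times> real \<Rightarrow> complex) \<Rightarrow> ('a \<times> real \<Rightarrow> complex) \<Rightarrow> bool" where
  "represents_LL \<Omega> A w g \<longleftrightarrow>
     (AE t in lebesgue_on {0<..<1}. AE x in lebesgue_on \<Omega>.
        g (x, t) = dt (dt w) (x, t) - A (\<lambda>y. w (y, t)) x)"

definition strong_solution ::
  "'a::euclidean_space set \<Rightarrow> ('a \<Rightarrow> complex) set \<Rightarrow> (('a \<Rightarrow> complex) \<Rightarrow> 'a \<Rightarrow> complex) \<Rightarrow>
     ('a \<times> real \<Rightarrow> complex) \<Rightarrow> ('a \<times> real \<Rightarrow> complex) \<Rightarrow> bool" where
  "strong_solution \<Omega> Dom A f u \<longleftrightarrow>
     (\<exists>w g. (\<forall>n. admissible \<Omega> Dom (w n) \<and> represents_LL \<Omega> A (w n) (g n)) \<and>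
        l2_tendsto (lebesgue_on (cylinder \<Omega>)) w u \<and>
        l2_tendsto (lebesgue_on (cylinder \<Omega>)) g f)"

text \<open>
  Eigenfunctions of \<open>u\<^sub>t\<^sub>t(x,t) - A u(x,t) = lam u(x,1-t)\<close>, \<open>u(x,0) = u\<^sub>t(x,0) = 0\<close>. The equation is
  understood in the sense of strong solutions, since an eigenfunction of an abstract self-adjoint
  operator need not be a \<open>C\<^sup>2\<close> function of \<open>x\<close>.
\<close>

definition cylinder_eigenfunction ::
  "'a::euclidean_space set \<Rightarrow> ('a \<Rightarrow> complex) set \<Rightarrow> (('a \<Rightarrow> complex) \<Rightarrow> 'a \<Rightarrow> complex) \<Rightarrow>
     complex \<Rightarrow> ('a \<times> real \<Rightarrow> complex) \<Rightarrow> bool" where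
  "cylinder_eigenfunction \<Omega> Dom A lam u \<longleftrightarrow>
     strong_solution \<Omega> Dom A (\<lambda>(x, t). lam * u (x, 1 - t)) u \<and>
     l2_norm (lebesgue_on (cylinder \<Omega>)) u \<noteq> 0"

definition interval_eigenfunction :: "real \<Rightarrow> complex \<Rightarrow> (real \<Rightarrow> complex) \<Rightarrow> bool" where
  "interval_eigenfunction \<mu> lam v \<longleftrightarrow>
     C_ext 2 {0<..<1} {0..1} v \<and> v 0 = 0 \<and> deriv01 v 0 = 0 \<and>
     (\<forall>t\<in>{0<..<1}. deriv01 (deriv01 v) t - of_real \<mu> * v t = lam * v (1 - t)) \<and>
     l2_norm (lebesgue_on {0<..<1}) v \<noteq> 0"

definition tensor :: "('a \<Rightarrow> complex) \<Rightarrow> (real \<Rightarrow> complex) \<Rightarrow> 'a \<times> real \<Rightarrow> complex" where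
  "tensor \<phi> v = (\<lambda>(x, t). \<phi> x * v t)"

definition reflected_coeff ::
  "'a::euclidean_space set \<Rightarrow> ('a \<times> real \<Rightarrow> complex) \<Rightarrow> ('a \<times> real \<Rightarrow> complex) \<Rightarrow> complex" where
  "reflected_coeff \<Omega> f e =
     l2_inner (lebesgue_on (cylinder \<Omega>)) (\<lambda>(x, t). f (x, 1 - t)) e"

end

theory Submission
  imports Defs
begin

text \<open>
  Write \<open>R\<close> for the reflection \<open>(R f)(x, t) = f(x, 1 - t)\<close>, \<open>L\<close> for the wave operator
  \<open>u\<^sub>t\<^sub>t - A u\<close>, and \<open>u\<^sub>k\<^sub>m = \<phi>\<^sub>k v\<^sub>k\<^sub>m\<close>. On functions with zero Cauchy data at \<open>t = 0\<close> the operator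
  \<open>R L\<close> is symmetric: integrating by parts twice in \<open>t\<close> against a reflected function, each boundary
  term contains a factor with zero Cauchy data, at \<open>t = 0\<close> or at \<open>t = 1\<close>. Therefore a strong solution
  satisfies \<open>(R f, u\<^sub>k\<^sub>m) = \<lambda>\<^sub>k\<^sub>m (u, u\<^sub>k\<^sub>m)\<close> (\<open>reflected_coeff_strong_solution\<close>), which says that its
  Fourier coefficients are the quotients in the statement. As the products \<open>u\<^sub>k\<^sub>m\<close> form a complete
  orthonormal system (\<open>tensor_orthonormal\<close>, \<open>tensor_total\<close>), Bessel's inequality gives the
  necessity of the condition, and completeness gives the expansion.

  Conversely, strong solutions form a closed linear relation (\<open>strong_solution_sums\<close>), and \<open>u\<^sub>k\<^sub>m\<close>
  solves the problem with right-hand side \<open>\<lambda>\<^sub>k\<^sub>m R u\<^sub>k\<^sub>m\<close>. So the series in the statement is a strong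
  solution as soon as it converges. The coefficients of \<open>R f\<close> are square-summable; only small
  eigenvalues can spoil this after the division. The heart of the matter is that, for each \<open>k\<close>, at
  most one eigenvalue has absolute value less than \<open>1\<close>, a bound that does not depend on \<open>k\<close>
  (\<open>second_eigenvalue_ge_1\<close>).

  For that bound, put \<open>r = sqrt \<mu>\<^sub>k\<close> and factor \<open>w'' - r\<^sup>2 w = h\<close> into \<open>p' - r p = h\<close> and
  \<open>w' + r w = p\<close>. The second equation is stable when it is solved from \<open>t = 0\<close>. The first is unstable in
  this direction, which is why there may be an exponentially small eigenvalue; but if \<open>p(1) = 0\<close>, it
  can be solved from \<open>t = 1\<close> backwards, and this is stable again. The result is the estimate
  \<open>\<parallel>w\<parallel> \<le> \<parallel>h\<parallel>\<close>, whatever \<open>r\<close> (\<open>l2_norm_le_reduced\<close>). The condition \<open>p(1) = 0\<close> is a single linear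
  equation, so some nonzero combination of any two eigenfunctions satisfies it, and the estimate for
  this combination forces the larger of the two eigenvalues to have absolute value at least \<open>1\<close>.
\<close>

section \<open>The Hilbert space of square-integrable functions\<close>

lemma L2_measurable: "f \<in> L2 M \<Longrightarrow> f \<in> borel_measurable M"
  by (simp add: L2_def)

lemma L2_integrable_norm2: "f \<in> L2 M \<Longrightarrow> integrable M (\<lambda>x. (cmod (f x))\<^sup>2)"
  by (simp add: L2_def)

lemma L2_zero: "(\<lambda>x. 0) \<in> L2 M"
  by (simp add: L2_def)

lemma L2_add:
  assumes "f \<in> L2 M" "g \<in> L2 M"
  shows "(\<lambda>x. f x + g x) \<in> L2 M"
proof -
  have [measurable]: "f \<in> borel_measurable M" "g \<in> borel_measurable M"
    using assms by (auto simp: L2_def)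
  have bound: "(cmod (a + b))\<^sup>2 \<le> 2 * (cmod a)\<^sup>2 + 2 * (cmod b)\<^sup>2" for a b
  proof -
    have "(cmod (a + b))\<^sup>2 \<le> (cmod a + cmod b)\<^sup>2"
      by (simp add: norm_triangle_ineq power_mono)
    also have "\<dots> \<le> 2 * (cmod a)\<^sup>2 + 2 * (cmod b)\<^sup>2"
      using zero_le_power2[of "cmod a - cmod b"] by (simp add: power2_eq_square algebra_simps)
    finally show ?thesis .
  qed
  have "integrable M (\<lambda>x. (cmod (f x + g x))\<^sup>2)"
    by (rule Bochner_Integration.integrable_bound[where f="\<lambda>x. 2 * (cmod (f x))\<^sup>2 + 2 * (cmod (g x))\<^sup>2"])
       (use assms bound in \<open>auto simp: L2_def\<close>)
  then show ?thesis by (simp add: L2_def)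
qed

lemma L2_cmult: "f \<in> L2 M \<Longrightarrow> (\<lambda>x. c * f x) \<in> L2 M"
  by (auto simp: L2_def norm_mult power_mult_distrib)

lemma L2_diff: "f \<in> L2 M \<Longrightarrow> g \<in> L2 M \<Longrightarrow> (\<lambda>x. f x - g x) \<in> L2 M"
  using L2_add[OF _ L2_cmult[where c="-1"], of f M g] by simp

lemma L2_sum: "(\<And>i. i \<in> I \<Longrightarrow> f i \<in> L2 M) \<Longrightarrow> (\<lambda>x. \<Sum>i\<in>I. f i x) \<in> L2 M"
  by (induction I rule: infinite_finite_induct) (auto intro: L2_zero L2_add)

lemma L2_integrable_norm_mult:
  assumes "f \<in> L2 M" "g \<in> L2 M"
  shows "integrable M (\<lambda>x. cmod (f x) * cmod (g x))"
proof -
  have [measurable]: "f \<in> borel_measurable M" "g \<in> borel_measurable M"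
    using assms by (auto simp: L2_def)
  have bound: "a * b \<le> a\<^sup>2 + b\<^sup>2" if "a \<ge> 0" "b \<ge> 0" for a b :: real
    using zero_le_power2[of "a - b"] that by (auto simp: power2_diff intro: order_trans[of _ "2 * (a*b)"])
  show ?thesis
    by (rule Bochner_Integration.integrable_bound[where f="\<lambda>x. (cmod (f x))\<^sup>2 + (cmod (g x))\<^sup>2"])
       (use assms bound in \<open>auto simp: L2_def\<close>)
qed

lemma borel_measurable_cnj [measurable]: "cnj \<in> borel_measurable borel"
  by (intro borel_measurable_continuous_onI continuous_intros)

lemma L2_integrable_mult:
  assumes "f \<in> L2 M" "g \<in> L2 M"
  shows "integrable M (\<lambda>x. f x * cnj (g x))"
proof -
  have [measurable]: "f \<in> borel_measurable M" "g \<in> borel_measurable M"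
    using assms by (auto simp: L2_def)
  show ?thesis
    by (rule Bochner_Integration.integrable_bound[OF L2_integrable_norm_mult[OF assms]])
       (auto simp: norm_mult)
qed

lemma l2_norm_nonneg: "l2_norm M f \<ge> 0"
  by (simp add: l2_norm_def)

lemma l2_norm_power2: "(l2_norm M f)\<^sup>2 = (LINT x|M. (cmod (f x))\<^sup>2)"
  by (simp add: l2_norm_def)

lemma l2_inner_self: "l2_inner M f f = of_real ((l2_norm M f)\<^sup>2)"
  unfolding l2_inner_def l2_norm_power2
  by (subst integral_complex_of_real[symmetric])
     (intro Bochner_Integration.integral_cong refl, simp only: complex_norm_square)

lemma l2_inner_commute: "l2_inner M g f = cnj (l2_inner M f g)"
  unfolding l2_inner_def
  by (simp add: mult.commute flip: Bochner_Integration.integral_cnj)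

lemma l2_inner_add_left:
  "f \<in> L2 M \<Longrightarrow> g \<in> L2 M \<Longrightarrow> h \<in> L2 M \<Longrightarrow>
     l2_inner M (\<lambda>x. f x + g x) h = l2_inner M f h + l2_inner M g h"
  unfolding l2_inner_def by (simp add: distrib_right L2_integrable_mult)

lemma l2_inner_diff_left:
  "f \<in> L2 M \<Longrightarrow> g \<in> L2 M \<Longrightarrow> h \<in> L2 M \<Longrightarrow>
     l2_inner M (\<lambda>x. f x - g x) h = l2_inner M f h - l2_inner M g h"
  unfolding l2_inner_def by (simp add: left_diff_distrib L2_integrable_mult)

lemma l2_inner_cmult_left: "l2_inner M (\<lambda>x. c * f x) h = c * l2_inner M f h"
  unfolding l2_inner_def by (simp add: mult.assoc)

lemma l2_inner_cmult_right: "l2_inner M f (\<lambda>x. c * h x) = cnj c * l2_inner M f h"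
  unfolding l2_inner_def by (simp add: mult.left_commute)

lemma l2_inner_sum_left:
  "(\<And>i. i \<in> I \<Longrightarrow> f i \<in> L2 M) \<Longrightarrow> h \<in> L2 M \<Longrightarrow>
     l2_inner M (\<lambda>x. \<Sum>i\<in>I. f i x) h = (\<Sum>i\<in>I. l2_inner M (f i) h)"
  unfolding l2_inner_def by (simp add: sum_distrib_right L2_integrable_mult)

lemma l2_inner_add_right:
  "f \<in> L2 M \<Longrightarrow> g \<in> L2 M \<Longrightarrow> h \<in> L2 M \<Longrightarrow>
     l2_inner M h (\<lambda>x. f x + g x) = l2_inner M h f + l2_inner M h g"
  using l2_inner_add_left[of f M g h] by (simp add: l2_inner_commute[of M h])

lemma l2_inner_cong_AE:
  assumes "AE x in M. f x = f' x" "AE x in M. g x = g' x"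
    and "f \<in> L2 M" "f' \<in> L2 M" "g \<in> L2 M" "g' \<in> L2 M"
  shows "l2_inner M f g = l2_inner M f' g'"
proof -
  have [measurable]: "f \<in> borel_measurable M" "g \<in> borel_measurable M"
     "f' \<in> borel_measurable M" "g' \<in> borel_measurable M"
    using assms by (auto simp: L2_def)
  have [measurable]: "(\<lambda>x. f x * cnj (g x)) \<in> borel_measurable M" "(\<lambda>x. f' x * cnj (g' x)) \<in> borel_measurable M"
    using assms by (auto intro!: borel_measurable_integrable L2_integrable_mult)
  show ?thesis unfolding l2_inner_def
    by (rule integral_cong_AE) (use assms(1,2) in auto)
qed

lemma l2_norm_cong_AE:
  assumes "AE x in M. f x = f' x" and "f \<in> L2 M" "f' \<in> L2 M"
  shows "l2_norm M f = l2_norm M f'"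
proof -
  have [measurable]: "f \<in> borel_measurable M" "f' \<in> borel_measurable M"
    using assms by (auto simp: L2_def)
  have "(LINT x|M. (cmod (f x))\<^sup>2) = (LINT x|M. (cmod (f' x))\<^sup>2)"
    by (rule integral_cong_AE) (use assms(1) in auto)
  then show ?thesis by (simp add: l2_norm_def)
qed

lemma l2_Cauchy_Schwarz_norm:
  assumes "f \<in> L2 M" "g \<in> L2 M"
  shows "(LINT x|M. cmod (f x) * cmod (g x)) \<le> l2_norm M f * l2_norm M g"
proof -
  have [measurable]: "f \<in> borel_measurable M" "g \<in> borel_measurable M"
    using assms by (auto simp: L2_def)
  let ?I = "LINT x|M. cmod (f x) * cmod (g x)"
  have I: "(\<integral>\<^sup>+x. ennreal (cmod (f x)) * ennreal (cmod (g x)) \<partial>M) = ennreal ?I"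
    using nn_integral_eq_integral[OF L2_integrable_norm_mult[OF assms]] by (simp add: ennreal_mult)
  have sq: "(\<integral>\<^sup>+x. (ennreal (cmod (h x)))\<^sup>2 \<partial>M) = ennreal ((l2_norm M h)\<^sup>2)" if "h \<in> L2 M" for h
    using nn_integral_eq_integral[OF L2_integrable_norm2[OF that]]
    by (simp add: ennreal_power l2_norm_power2)
  have "ennreal (?I\<^sup>2) \<le> ennreal ((l2_norm M f)\<^sup>2 * (l2_norm M g)\<^sup>2)"
    using Cauchy_Schwarz_nn_integral[of "\<lambda>x. ennreal (cmod (f x))" M "\<lambda>x. ennreal (cmod (g x))"]
    unfolding I sq[OF assms(1)] sq[OF assms(2)] by (simp add: ennreal_power ennreal_mult)
  then have "?I\<^sup>2 \<le> (l2_norm M f * l2_norm M g)\<^sup>2"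
    by (simp add: power_mult_distrib)
  then show ?thesis
    by (rule power2_le_imp_le) (simp add: l2_norm_nonneg)
qed

lemma l2_Cauchy_Schwarz:
  assumes "f \<in> L2 M" "g \<in> L2 M"
  shows "cmod (l2_inner M f g) \<le> l2_norm M f * l2_norm M g"
proof -
  have "cmod (l2_inner M f g) \<le> (LINT x|M. cmod (f x * cnj (g x)))"
    unfolding l2_inner_def by (rule integral_norm_bound)
  also have "\<dots> = (LINT x|M. cmod (f x) * cmod (g x))"
    by (simp add: norm_mult)
  finally show ?thesis using l2_Cauchy_Schwarz_norm[OF assms] by linarith
qed

lemma l2_norm_add_power2:
  assumes "f \<in> L2 M" "g \<in> L2 M"
  shows "(l2_norm M (\<lambda>x. f x + g x))\<^sup>2
    = (l2_norm M f)\<^sup>2 + (l2_norm M g)\<^sup>2 + 2 * Re (l2_inner M f g)"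
proof -
  have "of_real ((l2_norm M (\<lambda>x. f x + g x))\<^sup>2) =
     l2_inner M f f + l2_inner M f g + (cnj (l2_inner M f g) + l2_inner M g g)"
    unfolding l2_inner_self[symmetric] l2_inner_commute[of M g f, symmetric] using assms
    by (simp add: l2_inner_add_left l2_inner_add_right L2_add)
  then have "Re (of_real ((l2_norm M (\<lambda>x. f x + g x))\<^sup>2)) = 
     Re (l2_inner M f f + l2_inner M f g + (cnj (l2_inner M f g) + l2_inner M g g))"
    by (rule arg_cong)
  then show ?thesis by (simp add: l2_inner_self)
qed

lemma l2_norm_triangle:
  assumes "f \<in> L2 M" "g \<in> L2 M"
  shows "l2_norm M (\<lambda>x. f x + g x) \<le> l2_norm M f + l2_norm M g"
proof (rule power2_le_imp_le)
  have "Re (l2_inner M f g) \<le> l2_norm M f * l2_norm M g"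
    using l2_Cauchy_Schwarz[OF assms] complex_Re_le_cmod order_trans by blast
  then show "(l2_norm M (\<lambda>x. f x + g x))\<^sup>2 \<le> (l2_norm M f + l2_norm M g)\<^sup>2"
    unfolding l2_norm_add_power2[OF assms] by (simp add: power2_sum)
qed (simp add: l2_norm_nonneg)

lemma l2_norm_cmult: "l2_norm M (\<lambda>x. c * f x) = cmod c * l2_norm M f"
  unfolding l2_norm_def by (simp add: norm_mult power_mult_distrib real_sqrt_mult)

lemma l2_norm_diff_commute: "l2_norm M (\<lambda>x. f x - g x) = l2_norm M (\<lambda>x. g x - f x)"
  by (simp add: l2_norm_def norm_minus_commute)

lemma l2_norm_triangle_diff:
  assumes "f \<in> L2 M" "g \<in> L2 M" "h \<in> L2 M"
  shows "l2_norm M (\<lambda>x. f x - h x) \<le> l2_norm M (\<lambda>x. f x - g x) + l2_norm M (\<lambda>x. g x - h x)"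
  using l2_norm_triangle[of "\<lambda>x. f x - g x" M "\<lambda>x. g x - h x"] assms by (simp add: L2_diff)

lemma l2_norm_zero_imp_AE:
  assumes "f \<in> L2 M" "l2_norm M f = 0"
  shows "AE x in M. f x = 0"
proof -
  have "(LINT x|M. (cmod (f x))\<^sup>2) = 0"
    using assms(2) l2_norm_power2[of M f] by simp
  then have "AE x in M. (cmod (f x))\<^sup>2 = 0"
    using integral_nonneg_eq_0_iff_AE[OF L2_integrable_norm2[OF assms(1)]] by simp
  then show ?thesis by simp
qed

section \<open>Convergence in the mean and completeness\<close>

lemma l2_tendstoD:
  assumes "l2_tendsto M F f"
  shows "F n \<in> L2 M" "f \<in> L2 M" "(\<lambda>n. l2_norm M (\<lambda>x. F n x - f x)) \<longlonglongrightarrow> 0"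
  using assms by (auto simp: l2_tendsto_def)

lemma l2_tendstoI_bound:
  assumes "\<And>n. F n \<in> L2 M" "f \<in> L2 M" "\<And>n. l2_norm M (\<lambda>x. F n x - f x) \<le> b n" "b \<longlonglongrightarrow> 0"
  shows "l2_tendsto M F f"
  unfolding l2_tendsto_def using assms
  by (auto intro: tendsto_sandwich[OF _ _ tendsto_const assms(4)] simp: l2_norm_nonneg)

lemma l2_tendsto_add:
  assumes F: "l2_tendsto M F f" and G: "l2_tendsto M G g"
  shows "l2_tendsto M (\<lambda>n x. F n x + G n x) (\<lambda>x. f x + g x)"
proof (rule l2_tendstoI_bound)
  note D = l2_tendstoD[OF F] l2_tendstoD[OF G]
  show "(\<lambda>n. l2_norm M (\<lambda>x. F n x - f x) + l2_norm M (\<lambda>x. G n x - g x)) \<longlonglongrightarrow> 0"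
    using tendsto_add[OF D(3) D(6)] by simp
  show "l2_norm M (\<lambda>x. F n x + G n x - (f x + g x))
      \<le> l2_norm M (\<lambda>x. F n x - f x) + l2_norm M (\<lambda>x. G n x - g x)" for n
    using l2_norm_triangle[OF L2_diff[OF D(1,2)] L2_diff[OF D(4,5)], of n n]
    by (simp add: algebra_simps)
qed (use l2_tendstoD[OF F] l2_tendstoD[OF G] in \<open>auto intro: L2_add\<close>)

lemma l2_tendsto_cmult:
  assumes F: "l2_tendsto M F f"
  shows "l2_tendsto M (\<lambda>n x. c * F n x) (\<lambda>x. c * f x)"
proof (rule l2_tendstoI_bound)
  show "(\<lambda>n. cmod c * l2_norm M (\<lambda>x. F n x - f x)) \<longlonglongrightarrow> 0"
    using tendsto_mult[OF tendsto_const l2_tendstoD(3)[OF F], of "cmod c"] by simp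
  show "l2_norm M (\<lambda>x. c * F n x - c * f x) \<le> cmod c * l2_norm M (\<lambda>x. F n x - f x)" for n
    by (simp add: l2_norm_cmult flip: right_diff_distrib)
qed (use l2_tendstoD[OF F] in \<open>auto intro: L2_cmult\<close>)

lemma l2_tendsto_cong_AE:
  assumes F: "l2_tendsto M F f" and "AE x in M. f x = g x" "g \<in> L2 M"
  shows "l2_tendsto M F g"
proof (rule l2_tendstoI_bound)
  show "l2_norm M (\<lambda>x. F n x - g x) \<le> l2_norm M (\<lambda>x. F n x - f x)" for n
    by (rule eq_refl, rule l2_norm_cong_AE)
       (use assms l2_tendstoD[OF F] in \<open>auto intro: L2_diff\<close>)
qed (use l2_tendstoD[OF F] assms in auto)

lemma l2_tendsto_inner:
  assumes F: "l2_tendsto M F f" and h: "h \<in> L2 M"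
  shows "(\<lambda>n. l2_inner M (F n) h) \<longlonglongrightarrow> l2_inner M f h"
proof -
  note D = l2_tendstoD[OF F]
  have z: "(\<lambda>n. l2_norm M (\<lambda>x. F n x - f x) * l2_norm M h) \<longlonglongrightarrow> 0"
    using tendsto_mult[OF D(3) tendsto_const] by simp
  have "cmod (l2_inner M (F n) h - l2_inner M f h) \<le> l2_norm M (\<lambda>x. F n x - f x) * l2_norm M h" for n
    using l2_Cauchy_Schwarz[OF L2_diff[OF D(1,2)] h, of n] l2_inner_diff_left[OF D(1,2) h, of n] by simp
  then have "(\<lambda>n. l2_inner M (F n) h - l2_inner M f h) \<longlonglongrightarrow> 0"
    by (intro Lim_null_comparison[OF _ z]) auto
  then show ?thesis by (simp add: LIM_zero_iff)
qed

lemma l2_tendsto_norm: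
  assumes F: "l2_tendsto M F f"
  shows "(\<lambda>n. l2_norm M (F n)) \<longlonglongrightarrow> l2_norm M f"
proof -
  note D = l2_tendstoD[OF F]
  have "\<bar>l2_norm M (F n) - l2_norm M f\<bar> \<le> l2_norm M (\<lambda>x. F n x - f x)" for n
    using l2_norm_triangle[OF L2_diff[OF D(1,2)] D(2), of n]
      l2_norm_triangle[OF L2_diff[OF D(2) D(1)] D(1), of n n] l2_norm_diff_commute[of M "F n" f]
    by simp
  then have "(\<lambda>n. l2_norm M (F n) - l2_norm M f) \<longlonglongrightarrow> 0"
    by (intro Lim_null_comparison[OF _ D(3)]) auto
  then show ?thesis by (simp add: LIM_zero_iff)
qed

text \<open>
  The theorem of Riesz and Fischer. Along a sequence of rapidly growing indices the increments \<open>D\<^sub>j\<close> are so small that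
  \<open>\<Sum> 2\<^sup>j \<bar>D\<^sub>j\<bar>\<^sup>2\<close> is integrable. Hence \<open>\<Sum> \<bar>D\<^sub>j\<bar>\<close> is finite almost everywhere, even if the measure is
  infinite, and the subsequence has a pointwise limit. Fatou's lemma makes it a limit in the mean of
  the whole sequence.
\<close>

lemma L2_Cauchy_convergent:
  assumes F: "\<And>n. F n \<in> L2 M"
    and Cauchy: "\<And>e. e > 0 \<Longrightarrow> \<exists>N. \<forall>m\<ge>N. \<forall>n\<ge>N. l2_norm M (\<lambda>x. F m x - F n x) < e"
  shows "\<exists>f. l2_tendsto M F f"
proof -
  have [measurable]: "F n \<in> borel_measurable M" for n
    using F by (rule L2_measurable)
  have "\<exists>N. \<forall>m\<ge>N. \<forall>n\<ge>N. l2_norm M (\<lambda>x. F m x - F n x) < (1/2)^j" for j :: nat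
    by (rule Cauchy) simp
  then obtain N where N: "\<And>j m n. m \<ge> N j \<Longrightarrow> n \<ge> N j \<Longrightarrow> l2_norm M (\<lambda>x. F m x - F n x) < (1/2)^j"
    by metis
  \<comment> \<open>the sum replaces \<open>N\<close> by a monotone bound\<close>
  define r where "r j = (\<Sum>i\<le>j. N i)" for j :: nat
  have r_ge: "N j \<le> r n" if "j \<le> n" for j n
    unfolding r_def by (rule member_le_sum) (use that in auto)
  define D where "D j x = F (r (Suc j)) x - F (r j) x" for j x
  have D_L2: "D j \<in> L2 M" for j
    unfolding D_def[abs_def] by (intro L2_diff F)
  have [measurable]: "D j \<in> borel_measurable M" for j
    using D_L2 by (rule L2_measurable)
  have D_int: "(\<integral>\<^sup>+x. ennreal (2^j * (cmod (D j x))\<^sup>2) \<partial>M) \<le> ennreal ((1/2)^j)" for j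
  proof -
    have "l2_norm M (D j) \<le> (1/2)^j"
      unfolding D_def[abs_def] using N[of j "r (Suc j)" "r j"] r_ge[of j "Suc j"] r_ge[of j j] by simp
    then have "(l2_norm M (D j))\<^sup>2 \<le> ((1/2)^j)\<^sup>2"
      by (intro power_mono l2_norm_nonneg)
    then have "2^j * (l2_norm M (D j))\<^sup>2 \<le> 2^j * (((1/2)^j)\<^sup>2 :: real)"
      by (intro mult_left_mono) auto
    also have "\<dots> = (1/2)^j"
      by (simp add: power2_eq_square field_simps)
    finally have "2^j * (l2_norm M (D j))\<^sup>2 \<le> (1/2)^j" .
    moreover have "(\<integral>\<^sup>+x. ennreal (2^j * (cmod (D j x))\<^sup>2) \<partial>M) = ennreal (2^j * (l2_norm M (D j))\<^sup>2)"
      using L2_integrable_norm2[OF D_L2, of j]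
      by (subst nn_integral_eq_integral) (auto simp: l2_norm_power2)
    ultimately show ?thesis by (simp add: ennreal_leI)
  qed
  have "(\<integral>\<^sup>+x. (\<Sum>j. ennreal (2^j * (cmod (D j x))\<^sup>2)) \<partial>M) = (\<Sum>j. \<integral>\<^sup>+x. ennreal (2^j * (cmod (D j x))\<^sup>2) \<partial>M)"
    by (rule nn_integral_suminf) measurable
  also have "\<dots> \<le> (\<Sum>j. ennreal ((1/2)^j))"
    by (intro suminf_le D_int) auto
  also have "\<dots> < \<infinity>"
    by (subst suminf_ennreal2) (auto simp: summable_geometric)
  finally have "AE x in M. (\<Sum>j. ennreal (2^j * (cmod (D j x))\<^sup>2)) \<noteq> \<infinity>"
    by (intro nn_integral_noteq_infinite) auto
  then have conv: "AE x in M. convergent (\<lambda>n. F (r n) x)"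
  proof eventually_elim
    case (elim x)
    then have "summable (\<lambda>j. 2^j * (cmod (D j x))\<^sup>2)"
      by (intro summable_suminf_not_top) (auto simp: top_unique)
    then have S: "summable (\<lambda>j. 2^j * (cmod (D j x))\<^sup>2 + (1/2)^j)"
      by (intro summable_add summable_geometric) auto
    \<comment> \<open>\<open>a \<le> 2\<^sup>j a\<^sup>2 + 2\<^sup>-\<^sup>j\<close> for \<open>a \<ge> 0\<close>: one of the two terms is already large enough\<close>
    have "norm (D j x) \<le> 2^j * (cmod (D j x))\<^sup>2 + (1/2)^j" for j
    proof (cases "cmod (D j x) \<le> (1/2)^j")
      case False
      then have "1 \<le> 2^j * cmod (D j x)"
        by (simp add: field_simps)
      then have "1 * cmod (D j x) \<le> (2^j * cmod (D j x)) * cmod (D j x)"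
        by (intro mult_right_mono) auto
      then show ?thesis by (simp add: power2_eq_square mult.assoc add_increasing2)
    qed (simp add: add_increasing)
    then have "summable (\<lambda>j. D j x)"
      by (intro summable_comparison_test'[OF S]) auto
    then have "convergent (\<lambda>n. \<Sum>j<n. D j x)"
      by (simp add: summable_iff_convergent)
    then have "convergent (\<lambda>n. F (r 0) x + (\<Sum>j<n. D j x))"
      by (intro convergent_add convergent_const)
    moreover have "F (r 0) x + (\<Sum>j<n. D j x) = F (r n) x" for n
      unfolding D_def by (simp add: sum_lessThan_telescope[of "\<lambda>n. F (r n) x"])
    ultimately show ?case by simp
  qed
  define f where "f x = lim (\<lambda>n. F (r n) x)" for x
  have [measurable]: "f \<in> borel_measurable M"
    unfolding f_def[abs_def] by (intro borel_measurable_lim_metric) measurable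
  have bound: "(\<lambda>x. F m x - f x) \<in> L2 M \<and> l2_norm M (\<lambda>x. F m x - f x) \<le> (1/2)^j" if "m \<ge> N j" for m j
  proof -
    have "(\<integral>\<^sup>+x. ennreal ((cmod (F m x - f x))\<^sup>2) \<partial>M)
        = (\<integral>\<^sup>+x. liminf (\<lambda>n. ennreal ((cmod (F m x - F (r n) x))\<^sup>2)) \<partial>M)"
    proof (rule nn_integral_cong_AE, use conv in eventually_elim)
      case (elim x)
      then have "(\<lambda>n. F (r n) x) \<longlonglongrightarrow> f x"
        by (simp add: f_def convergent_LIMSEQ_iff)
      then have "(\<lambda>n. ennreal ((cmod (F m x - F (r n) x))\<^sup>2)) \<longlonglongrightarrow> ennreal ((cmod (F m x - f x))\<^sup>2)"
        by (intro tendsto_intros)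
      then show ?case
        by (metis lim_imp_Liminf trivial_limit_sequentially)
    qed
    also have "\<dots> \<le> liminf (\<lambda>n. \<integral>\<^sup>+x. ennreal ((cmod (F m x - F (r n) x))\<^sup>2) \<partial>M)"
      by (rule nn_integral_liminf) measurable
    also have "\<dots> \<le> ennreal (((1/2)^j)\<^sup>2)"
    proof (rule Liminf_le)
      show "\<forall>\<^sub>F n in sequentially. (\<integral>\<^sup>+x. ennreal ((cmod (F m x - F (r n) x))\<^sup>2) \<partial>M) \<le> ennreal (((1/2)^j)\<^sup>2)"
        using eventually_ge_at_top[of j]
      proof eventually_elim
        case (elim n)
        have "(\<integral>\<^sup>+x. ennreal ((cmod (F m x - F (r n) x))\<^sup>2) \<partial>M) = ennreal ((l2_norm M (\<lambda>x. F m x - F (r n) x))\<^sup>2)"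
          using L2_integrable_norm2[OF L2_diff[OF F F], of m "r n"]
          by (subst nn_integral_eq_integral) (auto simp: l2_norm_power2)
        also have "\<dots> \<le> ennreal (((1/2)^j)\<^sup>2)"
          using N[OF that r_ge[OF elim]] by (intro ennreal_leI power_mono l2_norm_nonneg) auto
        finally show ?case .
      qed
    qed simp
    finally have le: "(\<integral>\<^sup>+x. ennreal ((cmod (F m x - f x))\<^sup>2) \<partial>M) \<le> ennreal (((1/2)^j)\<^sup>2)" .
    then have int: "integrable M (\<lambda>x. (cmod (F m x - f x))\<^sup>2)"
      by (intro integrableI_bounded) (auto intro: le_less_trans)
    have "ennreal ((l2_norm M (\<lambda>x. F m x - f x))\<^sup>2) \<le> ennreal (((1/2)^j)\<^sup>2)"
      using le nn_integral_eq_integral[OF int] by (simp add: l2_norm_power2)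
    then have "(l2_norm M (\<lambda>x. F m x - f x))\<^sup>2 \<le> ((1/2)^j)\<^sup>2"
      by (subst (asm) ennreal_le_iff) auto
    then have "l2_norm M (\<lambda>x. F m x - f x) \<le> (1/2)^j"
      by (rule power2_le_imp_le) simp
    with int show ?thesis by (simp add: L2_def)
  qed
  have fL2: "f \<in> L2 M"
    using L2_diff[OF F[of "N 0"] bound[THEN conjunct1, of 0 "N 0"]] by simp
  have "(\<lambda>m. l2_norm M (\<lambda>x. F m x - f x)) \<longlonglongrightarrow> 0"
  proof (rule LIMSEQ_I)
    fix e :: real assume "e > 0"
    then obtain j where j: "(1/2)^j < e"
      using real_arch_pow_inv[of e "1/2"] by auto
    show "\<exists>n0. \<forall>n\<ge>n0. norm (l2_norm M (\<lambda>x. F n x - f x) - 0) < e"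
      using bound[of j] j by (intro exI[of _ "N j"]) (auto simp: l2_norm_nonneg intro: le_less_trans)
  qed
  with F fL2 show ?thesis by (auto simp: l2_tendsto_def)
qed

section \<open>Orthogonal series\<close>

lemma l2_norm_sum_orthogonal:
  assumes "finite I" "\<And>i. i \<in> I \<Longrightarrow> F i \<in> L2 M"
    and "\<And>i j. i \<in> I \<Longrightarrow> j \<in> I \<Longrightarrow> i \<noteq> j \<Longrightarrow> l2_inner M (F i) (F j) = 0"
  shows "(l2_norm M (\<lambda>x. \<Sum>i\<in>I. F i x))\<^sup>2 = (\<Sum>i\<in>I. (l2_norm M (F i))\<^sup>2)"
  using assms
proof (induction I rule: finite_induct)
  case empty
  then show ?case by (simp add: l2_norm_def)
next
  case (insert i I)
  have "l2_inner M (\<lambda>x. \<Sum>j\<in>I. F j x) (F i) = 0"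
    using insert by (subst l2_inner_sum_left) (auto intro!: sum.neutral)
  then have "l2_inner M (F i) (\<lambda>x. \<Sum>j\<in>I. F j x) = 0"
    by (simp add: l2_inner_commute[of M "F i"])
  then show ?case
    using insert by (simp add: l2_norm_add_power2 L2_sum)
qed

text \<open>
  By Pythagoras' theorem the partial sums are a Cauchy sequence.
\<close>

lemma l2_sums_orthogonal:
  assumes F: "\<And>k. F k \<in> L2 M" and orth: "\<And>i j. i \<noteq> j \<Longrightarrow> l2_inner M (F i) (F j) = 0"
    and summ: "summable (\<lambda>k. (l2_norm M (F k))\<^sup>2)"
  shows "\<exists>s. l2_sums M F s"
  unfolding l2_sums_def
proof (rule L2_Cauchy_convergent)
  show "(\<lambda>x. \<Sum>k<N. F k x) \<in> L2 M" for N
    by (intro L2_sum F)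
  fix e :: real assume "e > 0"
  then have "e\<^sup>2 > 0" by simp
  with summ obtain N where N: "\<And>m n. m \<ge> N \<Longrightarrow> norm (\<Sum>k=m..<n. (l2_norm M (F k))\<^sup>2) < e\<^sup>2"
    unfolding summable_Cauchy by metis
  have *: "l2_norm M (\<lambda>x. (\<Sum>k<n. F k x) - (\<Sum>k<m. F k x)) < e" if "m \<ge> N" "m \<le> n" for m n
  proof -
    have "(\<lambda>x. (\<Sum>k<n. F k x) - (\<Sum>k<m. F k x)) = (\<lambda>x. \<Sum>k=m..<n. F k x)"
      using that(2) by (auto simp: fun_eq_iff sum_diff_nat_ivl lessThan_atLeast0)
    then have "(l2_norm M (\<lambda>x. (\<Sum>k<n. F k x) - (\<Sum>k<m. F k x)))\<^sup>2 = (\<Sum>k=m..<n. (l2_norm M (F k))\<^sup>2)"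
      using l2_norm_sum_orthogonal[of "{m..<n}" F M] F orth by simp
    also have "\<dots> < e\<^sup>2"
      using N[OF that(1), of n] by simp
    finally show ?thesis
      using \<open>e > 0\<close> by (simp add: power_less_imp_less_base)
  qed
  show "\<exists>N. \<forall>m\<ge>N. \<forall>n\<ge>N. l2_norm M (\<lambda>x. (\<Sum>k<m. F k x) - (\<Sum>k<n. F k x)) < e"
  proof (intro exI[of _ N] allI impI)
    fix m n assume "m \<ge> N" "n \<ge> N"
    show "l2_norm M (\<lambda>x. (\<Sum>k<m. F k x) - (\<Sum>k<n. F k x)) < e"
    proof (cases "m \<le> n")
      case True
      have "l2_norm M (\<lambda>x. (\<Sum>k<m. F k x) - (\<Sum>k<n. F k x)) = l2_norm M (\<lambda>x. (\<Sum>k<n. F k x) - (\<Sum>k<m. F k x))"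
        by (rule l2_norm_diff_commute)
      then show ?thesis using *[OF \<open>m \<ge> N\<close> True] by simp
    next
      case False
      then show ?thesis using *[OF \<open>n \<ge> N\<close>, of m] by simp
    qed
  qed
qed

lemma l2_sums_inner:
  assumes "l2_sums M F s" "\<And>k. F k \<in> L2 M" "h \<in> L2 M"
  shows "(\<lambda>k. l2_inner M (F k) h) sums l2_inner M s h"
  using l2_tendsto_inner[OF assms(1)[unfolded l2_sums_def] assms(3)] assms(2,3)
  by (simp add: sums_def l2_inner_sum_left)

lemma l2_sums_norm2:
  assumes s: "l2_sums M F s" and F: "\<And>k. F k \<in> L2 M"
    and orth: "\<And>i j. i \<noteq> j \<Longrightarrow> l2_inner M (F i) (F j) = 0"
  shows "(\<lambda>k. (l2_norm M (F k))\<^sup>2) sums (l2_norm M s)\<^sup>2"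
  using tendsto_power[OF l2_tendsto_norm[OF s[unfolded l2_sums_def]], of 2]
    l2_norm_sum_orthogonal[of "{..<_}" F M] F orth
  by (simp add: sums_def)

definition orthonormal_family :: "'a measure \<Rightarrow> ('i \<Rightarrow> 'a \<Rightarrow> complex) \<Rightarrow> bool" where
  "orthonormal_family M e \<longleftrightarrow>
     (\<forall>i. e i \<in> L2 M) \<and> (\<forall>i j. l2_inner M (e i) (e j) = (if i = j then 1 else 0))"

lemma complete_orthonormal_imp_family: "complete_orthonormal M e \<Longrightarrow> orthonormal_family M e"
  by (auto simp: complete_orthonormal_def orthonormal_family_def)

lemma orthonormal_norm:
  assumes "orthonormal_family M e"
  shows "l2_norm M (e i) = 1"
proof -
  have "complex_of_real ((l2_norm M (e i))\<^sup>2) = of_real 1"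
    using assms by (simp add: l2_inner_self[symmetric] orthonormal_family_def del: of_real_power)
  then have "(l2_norm M (e i))\<^sup>2 = 1"
    unfolding of_real_eq_iff .
  then show ?thesis
    using l2_norm_nonneg[of M "e i"] by (simp add: power2_eq_1_iff)
qed

lemma Bessel_inequality:
  assumes e: "orthonormal_family M e" and f: "f \<in> L2 M" and I: "finite I"
  shows "(\<Sum>i\<in>I. (cmod (l2_inner M f (e i)))\<^sup>2) \<le> (l2_norm M f)\<^sup>2"
proof -
  define c where "c i = l2_inner M f (e i)" for i
  define p where "p x = (\<Sum>i\<in>I. c i * e i x)" for x
  have eL: "e i \<in> L2 M" for i
    using e by (auto simp: orthonormal_family_def)
  have ee: "l2_inner M (e i) (e j) = (if i = j then 1 else 0)" for i j
    using e by (auto simp: orthonormal_family_def)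
  have pL: "p \<in> L2 M"
    unfolding p_def[abs_def] by (intro L2_sum L2_cmult eL)
  note ne = orthonormal_norm[OF e]
  have np: "(l2_norm M p)\<^sup>2 = (\<Sum>i\<in>I. (cmod (c i))\<^sup>2)"
    unfolding p_def[abs_def]
    by (subst l2_norm_sum_orthogonal)
       (auto simp: I L2_cmult eL l2_inner_cmult_left l2_inner_cmult_right ee l2_norm_cmult ne)
  have "l2_inner M p f = (\<Sum>i\<in>I. c i * cnj (c i))"
    unfolding p_def[abs_def] c_def
    by (subst l2_inner_sum_left) (auto simp: L2_cmult eL f l2_inner_cmult_left l2_inner_commute[of M "e _" f])
  also have "\<dots> = of_real ((l2_norm M p)\<^sup>2)"
    unfolding np of_real_sum complex_norm_square ..
  finally have inner_pf: "l2_inner M p f = of_real ((l2_norm M p)\<^sup>2)" .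
  then have "(l2_norm M p)\<^sup>2 \<le> l2_norm M p * l2_norm M f"
    using l2_Cauchy_Schwarz[OF pL f] unfolding inner_pf norm_of_real by simp
  then have "l2_norm M p \<le> l2_norm M f"
    using l2_norm_nonneg[of M p] l2_norm_nonneg[of M f]
    by (cases "l2_norm M p = 0") (auto simp: power2_eq_square)
  then show ?thesis
    unfolding c_def[symmetric] np[symmetric] by (intro power_mono l2_norm_nonneg)
qed

text \<open>
  If \<open>p\<close> is a combination of the \<open>e\<^sub>i\<close>, then \<open>(p, f) = 0\<close>, so that
  \<open>\<parallel>f\<parallel>\<^sup>2 = (f - p, f) \<le> \<parallel>f - p\<parallel> \<parallel>f\<parallel>\<close>; and \<open>\<parallel>f - p\<parallel>\<close> can be made arbitrarily small.
\<close>

lemma complete_orthonormal_total: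
  assumes e: "complete_orthonormal M e" and f: "f \<in> L2 M"
    and orth: "\<And>i. l2_inner M f (e i) = 0"
  shows "AE x in M. f x = 0"
proof -
  have "l2_norm M f < \<epsilon>" if "\<epsilon> > 0" for \<epsilon>
  proof -
    from e f that obtain I c where "finite I" and I: "l2_norm M (\<lambda>x. f x - (\<Sum>i\<in>I. c i * e i x)) < \<epsilon>"
      unfolding complete_orthonormal_def by blast
    have eL: "e i \<in> L2 M" for i
      using e by (auto simp: complete_orthonormal_def)
    define p where "p x = (\<Sum>i\<in>I. c i * e i x)" for x
    have pL: "p \<in> L2 M"
      unfolding p_def[abs_def] by (intro L2_sum L2_cmult eL)
    have "l2_inner M p f = 0"
      unfolding p_def[abs_def]
      by (subst l2_inner_sum_left) 
         (auto simp: L2_cmult eL f l2_inner_cmult_left l2_inner_commute[of M "e _" f] orth)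
    then have "l2_inner M f f = l2_inner M (\<lambda>x. f x - p x) f"
      using l2_inner_diff_left[OF f pL f] by simp
    then have "cmod (of_real ((l2_norm M f)\<^sup>2)) \<le> l2_norm M (\<lambda>x. f x - p x) * l2_norm M f"
      using l2_Cauchy_Schwarz[OF L2_diff[OF f pL] f] unfolding l2_inner_self by (simp del: of_real_power)
    then have "(l2_norm M f)\<^sup>2 \<le> l2_norm M (\<lambda>x. f x - p x) * l2_norm M f"
      unfolding norm_of_real by simp
    then have "l2_norm M f \<le> l2_norm M (\<lambda>x. f x - p x)"
      using l2_norm_nonneg[of M f] l2_norm_nonneg[of M "\<lambda>x. f x - p x"]
      by (cases "l2_norm M f = 0") (auto simp: power2_eq_square)
    with I show ?thesis by (simp add: p_def)
  qed
  then have "l2_norm M f = 0"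
    using l2_norm_nonneg[of M f] by (metis less_irrefl less_le)
  then show ?thesis by (rule l2_norm_zero_imp_AE[OF f])
qed

section \<open>Fubini's theorem for the completed Lebesgue measure\<close>

text \<open>
  Fubini's theorem speaks of functions that are measurable for the product \<open>\<sigma>\<close>-algebra, which is
  smaller than the \<open>\<sigma>\<close>-algebra of Lebesgue measurable sets. Borel representatives bridge the gap.
\<close>

lemma borel_representative:
  fixes f :: "'a \<Rightarrow> complex"
  assumes "f \<in> borel_measurable (completion M)"
  obtains g where "g \<in> borel_measurable M" "AE x in M. f x = g x"
proof -
  have "(\<lambda>x. Re (f x)) \<in> borel_measurable (completion M)" "(\<lambda>x. Im (f x)) \<in> borel_measurable (completion M)"
    using assms by measurable
  then obtain g h where [measurable]: "g \<in> borel_measurable M" "h \<in> borel_measurable M"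
      and ae: "AE x in M. Re (f x) = g x" "AE x in M. Im (f x) = h x"
    using completion_ex_borel_measurable_real by metis
  show ?thesis
  proof
    show "(\<lambda>x. Complex (g x) (h x)) \<in> borel_measurable M"
      unfolding Complex_eq by measurable
    show "AE x in M. f x = Complex (g x) (h x)"
      using ae by eventually_elim (simp add: complex_eq_iff)
  qed
qed

lemma measurable_completion_AE_eq:
  assumes g: "g \<in> M \<rightarrow>\<^sub>M N" and ae: "AE x in M. f x = g x" and sp: "\<And>x. x \<in> space M \<Longrightarrow> f x \<in> space N"
  shows "f \<in> completion M \<rightarrow>\<^sub>M N"
proof (rule measurableI)
  fix A assume A: "A \<in> sets N"
  show "f -` A \<inter> space (completion M) \<in> sets (completion M)"
  proof (rule completion.in_sets_AE)
    show "g -` A \<inter> space M \<in> sets (completion M)"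
      using g A by (auto intro: measurable_sets)
    have "AE x in M. x \<in> space M"
      by simp
    with ae show "AE x in completion M. (x \<in> g -` A \<inter> space M) = (x \<in> f -` A \<inter> space (completion M))"
      by (intro AE_completion, eventually_elim) auto
  qed auto
qed (use sp in auto)

lemma
  fixes f :: "'a \<Rightarrow> complex"
  assumes g: "integrable M g" and ae: "AE x in M. f x = g x"
  shows integrable_completion_AE_eq: "integrable (completion M) f"
    and integral_completion_AE_eq: "integral\<^sup>L (completion M) f = integral\<^sup>L M g"
proof -
  have [measurable]: "g \<in> borel_measurable M"
    using g by auto
  have f: "f \<in> borel_measurable (completion M)"
    by (rule measurable_completion_AE_eq[OF _ ae]) auto
  have ae': "AE x in completion M. f x = g x"
    using ae by (rule AE_completion)
  have g': "g \<in> borel_measurable (completion M)"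
    by (rule measurable_completion) measurable
  show "integrable (completion M) f"
    using integrable_cong_AE[OF f g' ae'] g by (simp add: integrable_completion)
  show "integral\<^sup>L (completion M) f = integral\<^sup>L M g"
    using integral_cong_AE[OF f g' ae'] by (simp add: integral_completion)
qed

text \<open>
  The exceptional set of \<open>P\<close> need not be measurable, so the two variables are exchanged for a
  measurable null set that contains it.
\<close>

lemma
  fixes P :: "'a::euclidean_space \<times> 'b::euclidean_space \<Rightarrow> bool"
  assumes "AE p in lborel. P p"
  shows AE_lborel_pair: "AE x in lborel. AE y in lborel. P (x, y)"
    and AE_lborel_pair_swap: "AE y in lborel. AE x in lborel. P (x, y)"
proof -
  have ae: "AE p in lborel \<Otimes>\<^sub>M lborel. P p"
    using assms unfolding lborel_prod .
  then show "AE x in lborel. AE y in lborel. P (x, y)"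
    by (rule lborel_pair.AE_pair)
  from ae obtain N where N: "{p \<in> space (lborel \<Otimes>\<^sub>M lborel). \<not> P p} \<subseteq> N" "N \<in> sets (lborel \<Otimes>\<^sub>M lborel)"
      "emeasure (lborel \<Otimes>\<^sub>M lborel) N = 0"
    by (rule AE_E)
  then have "AE p in lborel \<Otimes>\<^sub>M lborel. p \<notin> N"
    by (intro AE_not_in) (auto simp: null_sets_def)
  then have "AE x in lborel. AE y in lborel. (x, y) \<notin> N"
    by (rule lborel_pair.AE_pair)
  then have "AE y in lborel. AE x in lborel. (x, y) \<notin> N"
    by (subst (asm) lborel_pair.AE_commute) (use N(2) in measurable)
  then show "AE y in lborel. AE x in lborel. P (x, y)"
    using N(1) by (auto simp: space_pair_measure elim!: eventually_mono)
qed

text \<open>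
  For almost every value of one variable, the slices of \<open>F\<close> and of a Borel representative \<open>G\<close> agree
  almost everywhere in the other variable, so the iterated integrals of \<open>F\<close> are those of \<open>G\<close>.
\<close>

lemma
  fixes F :: "'a::euclidean_space \<times> 'b::euclidean_space \<Rightarrow> complex"
  assumes F: "integrable lebesgue F"
  shows integral_lebesgue_fst: "(LINT x|lebesgue. LINT y|lebesgue. F (x, y)) = integral\<^sup>L lebesgue F"
    and AE_integrable_lebesgue_snd: "AE y in lebesgue. integrable lebesgue (\<lambda>x. F (x, y))"
    and integrable_lebesgue_snd: "integrable lebesgue (\<lambda>y. LINT x|lebesgue. F (x, y))"
    and integral_lebesgue_snd: "(LINT y|lebesgue. LINT x|lebesgue. F (x, y)) = integral\<^sup>L lebesgue F"
proof -
  obtain G where [measurable]: "G \<in> borel_measurable lborel" and ae: "AE p in lborel. F p = G p"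
    by (rule borel_representative[OF borel_measurable_integrable[OF F]])
  have aeL: "AE p in lebesgue. F p = G p"
    using ae by (rule AE_completion)
  have GL: "G \<in> borel_measurable lebesgue"
    by (rule measurable_completion) measurable
  have G: "integrable lborel G"
    using F integrable_cong_AE[OF _ GL aeL] by (simp add: integrable_completion borel_measurable_integrable)
  have intF: "integral\<^sup>L lebesgue F = integral\<^sup>L lborel G"
    using integral_completion_AE_eq[OF G ae] .
  have G': "integrable (lborel \<Otimes>\<^sub>M lborel) G"
    using G unfolding lborel_prod .
  have e1: "AE x in lborel. (LINT y|lebesgue. F (x, y)) = (LINT y|lborel. G (x, y))"
    using AE_lborel_pair[OF ae] lborel_pair.AE_integrable_fst'[OF G']
    by eventually_elim (rule integral_completion_AE_eq)
  show "(LINT x|lebesgue. LINT y|lebesgue. F (x, y)) = integral\<^sup>L lebesgue F"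
    using integral_completion_AE_eq[OF lborel_pair.integrable_fst'[OF G'] e1]
    unfolding lborel_pair.integral_fst'[OF G'] lborel_prod intF .
  have G2: "integrable (lborel \<Otimes>\<^sub>M lborel) (case_prod (\<lambda>x y. G (x, y)))"
    using G' by simp
  have ae2: "AE y in lborel. integrable lebesgue (\<lambda>x. F (x, y)) \<and>
      (LINT x|lebesgue. F (x, y)) = (LINT x|lborel. G (x, y))"
    using AE_lborel_pair_swap[OF ae] lborel_pair.AE_integrable_snd[OF G2]
    by eventually_elim (auto intro: integrable_completion_AE_eq integral_completion_AE_eq)
  then have e2: "AE y in lborel. (LINT x|lebesgue. F (x, y)) = (LINT x|lborel. G (x, y))"
    by eventually_elim simp
  show "AE y in lebesgue. integrable lebesgue (\<lambda>x. F (x, y))"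
    using ae2 by (intro AE_completion, eventually_elim) simp
  show "integrable lebesgue (\<lambda>y. LINT x|lebesgue. F (x, y))"
    by (rule integrable_completion_AE_eq[OF lborel_pair.integrable_snd[OF G2] e2])
  show "(LINT y|lebesgue. LINT x|lebesgue. F (x, y)) = integral\<^sup>L lebesgue F"
    using integral_completion_AE_eq[OF lborel_pair.integrable_snd[OF G2] e2]
    unfolding lborel_pair.integral_snd[OF G2] lborel_prod intF by simp
qed

lemma borel_Times_lebesgue:
  fixes S :: "'a::euclidean_space set" and T :: "'b::euclidean_space set"
  assumes "S \<in> sets borel" "T \<in> sets borel"
  shows "S \<times> T \<in> sets lebesgue"
  using pair_measureI[OF assms] unfolding borel_prod by simp

lemma
  fixes F :: "'a::euclidean_space \<times> 'b::euclidean_space \<Rightarrow> complex"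
  assumes S: "S \<in> sets borel" and T: "T \<in> sets borel"
    and F: "integrable (lebesgue_on (S \<times> T)) F"
  shows integral_fst_on:
      "(LINT x|lebesgue_on S. LINT y|lebesgue_on T. F (x, y)) = integral\<^sup>L (lebesgue_on (S \<times> T)) F"
    and AE_integrable_snd_on: "AE y in lebesgue_on T. integrable (lebesgue_on S) (\<lambda>x. F (x, y))"
    and integrable_snd_on: "integrable (lebesgue_on T) (\<lambda>y. LINT x|lebesgue_on S. F (x, y))"
    and integral_snd_on:
      "(LINT y|lebesgue_on T. LINT x|lebesgue_on S. F (x, y)) = integral\<^sup>L (lebesgue_on (S \<times> T)) F"
proof -
  have [simp]: "S \<in> sets lebesgue" "T \<in> sets lebesgue" "S \<times> T \<in> sets lebesgue"
    using S T by (auto intro: borel_Times_lebesgue)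
  define F' where "F' p = indicat_real (S \<times> T) p *\<^sub>R F p" for p
  have F': "integrable lebesgue F'"
    unfolding F'_def using F by (simp add: integrable_restrict_space)
  have split: "F' (x, y) = indicat_real S x *\<^sub>R (indicat_real T y *\<^sub>R F (x, y))"
     "F' (x, y) = indicat_real T y *\<^sub>R (indicat_real S x *\<^sub>R F (x, y))" for x y
    by (auto simp: F'_def indicator_def)
  have "integral\<^sup>L (lebesgue_on (S \<times> T)) F = integral\<^sup>L lebesgue F'"
    unfolding F'_def by (simp add: integral_restrict_space)
  note eq = this
  have i1: "indicat_real S x *\<^sub>R (LINT y|lebesgue_on T. F (x, y)) = (LINT y|lebesgue. F' (x, y))" for x
    by (simp add: integral_restrict_space split(1) del: scaleR_scaleR)
  have i2: "indicat_real T y *\<^sub>R (LINT x|lebesgue_on S. F (x, y)) = (LINT x|lebesgue. F' (x, y))" for y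
    by (simp add: integral_restrict_space split(2) del: scaleR_scaleR)
  show "AE y in lebesgue_on T. integrable (lebesgue_on S) (\<lambda>x. F (x, y))"
    using AE_integrable_lebesgue_snd[OF F']
    by (subst AE_restrict_space_iff, simp, elim eventually_mono) (auto simp: split(2) integrable_restrict_space)
  show "integrable (lebesgue_on T) (\<lambda>y. LINT x|lebesgue_on S. F (x, y))"
    using integrable_lebesgue_snd[OF F'] by (simp add: integrable_restrict_space i2)
  show "(LINT x|lebesgue_on S. LINT y|lebesgue_on T. F (x, y)) = integral\<^sup>L (lebesgue_on (S \<times> T)) F"
    unfolding eq integral_lebesgue_fst[OF F', symmetric]
    by (subst integral_restrict_space) (simp_all add: i1)
  show "(LINT y|lebesgue_on T. LINT x|lebesgue_on S. F (x, y)) = integral\<^sup>L (lebesgue_on (S \<times> T)) F"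
    unfolding eq integral_lebesgue_snd[OF F', symmetric]
    by (subst integral_restrict_space) (simp_all add: i2)
qed

text \<open>
  If \<open>a\<close> and \<open>b\<close> agree with Borel functions off the null sets \<open>N1\<close> and \<open>N2\<close>, then their product
  agrees with a Borel function off \<open>N1 \<times> UNIV \<union> UNIV \<times> N2\<close>, which is a null set as well.
\<close>

lemma
  fixes S :: "'a::euclidean_space set" and T :: "'b::euclidean_space set"
    and a b :: "_ \<Rightarrow> complex"
  assumes S: "S \<in> sets borel" and T: "T \<in> sets borel"
  shows borel_measurable_product_on: "a \<in> borel_measurable (lebesgue_on S) \<Longrightarrow>
      b \<in> borel_measurable (lebesgue_on T) \<Longrightarrow>
      (\<lambda>(x, y). a x * b y) \<in> borel_measurable (lebesgue_on (S \<times> T))"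
    and integrable_product_on: "integrable (lebesgue_on S) a \<Longrightarrow> integrable (lebesgue_on T) b \<Longrightarrow>
      integrable (lebesgue_on (S \<times> T)) (\<lambda>(x, y). a x * b y)"
proof -
  have [simp]: "S \<in> sets lebesgue" "T \<in> sets lebesgue" "S \<times> T \<in> sets lebesgue"
    using S T by (auto intro: borel_Times_lebesgue)
  have ind: "(\<lambda>p. indicat_real (S \<times> T) p *\<^sub>R (case p of (x, y) \<Rightarrow> a x * b y))
     = (\<lambda>p. (indicat_real S (fst p) *\<^sub>R a (fst p)) * (indicat_real T (snd p) *\<^sub>R b (snd p)))"
    by (auto simp: indicator_def)
  have repr: "\<exists>a' b'. a' \<in> borel_measurable lborel \<and> b' \<in> borel_measurable lborel \<and>
      (AE x in lborel. indicat_real S x *\<^sub>R a x = a' x) \<and> (AE y in lborel. indicat_real T y *\<^sub>R b y = b' y) \<and>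
      (AE p in lborel. (indicat_real S (fst p) *\<^sub>R a (fst p)) * (indicat_real T (snd p) *\<^sub>R b (snd p))
         = a' (fst p) * b' (snd p))"
    if a: "a \<in> borel_measurable (lebesgue_on S)" and b: "b \<in> borel_measurable (lebesgue_on T)"
  proof -
    have "(\<lambda>x. indicat_real S x *\<^sub>R a x) \<in> borel_measurable lebesgue"
      "(\<lambda>x. indicat_real T x *\<^sub>R b x) \<in> borel_measurable lebesgue"
      using a b by (simp_all add: borel_measurable_restrict_space_iff)
    then obtain a' b' where [measurable]: "a' \<in> borel_measurable lborel" "b' \<in> borel_measurable lborel"
      and ae: "AE x in lborel. indicat_real S x *\<^sub>R a x = a' x" "AE y in lborel. indicat_real T y *\<^sub>R b y = b' y"
      by (metis borel_representative)
    obtain N1 where N1: "{x \<in> space lborel. \<not> indicat_real S x *\<^sub>R a x = a' x} \<subseteq> N1"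
        "emeasure lborel N1 = 0" "N1 \<in> sets lborel"
      using ae(1) by (rule AE_E)
    obtain N2 where N2: "{x \<in> space lborel. \<not> indicat_real T x *\<^sub>R b x = b' x} \<subseteq> N2"
        "emeasure lborel N2 = 0" "N2 \<in> sets lborel"
      using ae(2) by (rule AE_E)
    have [measurable]: "N1 \<in> sets borel" "N2 \<in> sets borel"
      using N1 N2 by auto
    have n: "AE x in lborel. x \<notin> N1" "AE x in lborel. x \<notin> N2"
      using N1 N2 by (auto intro!: AE_not_in simp: null_sets_def)
    have "AE p in lborel \<Otimes>\<^sub>M lborel. fst p \<notin> N1 \<and> snd p \<notin> N2"
    proof (rule lborel_pair.AE_pair_measure)
      show "AE x in lborel. AE y in lborel. fst (x, y) \<notin> N1 \<and> snd (x, y) \<notin> N2"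
        using n by (auto elim!: eventually_mono)
    qed measurable
    then have "AE p in lborel. fst p \<notin> N1 \<and> snd p \<notin> N2"
      unfolding lborel_prod .
    then have "AE p in lborel. (indicat_real S (fst p) *\<^sub>R a (fst p)) * (indicat_real T (snd p) *\<^sub>R b (snd p))
         = a' (fst p) * b' (snd p)"
    proof eventually_elim
      case (elim p)
      have "indicat_real S (fst p) *\<^sub>R a (fst p) = a' (fst p)"
        "indicat_real T (snd p) *\<^sub>R b (snd p) = b' (snd p)"
        using N1(1) N2(1) elim by auto
      then show ?case by (simp only:)
    qed
    with ae show ?thesis by (intro exI[of _ a'] exI[of _ b']) simp
  qed
  show "(\<lambda>(x, y). a x * b y) \<in> borel_measurable (lebesgue_on (S \<times> T))"
    if a: "a \<in> borel_measurable (lebesgue_on S)" and b: "b \<in> borel_measurable (lebesgue_on T)"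
  proof -
    from repr[OF a b] obtain a' b' where [measurable]: "a' \<in> borel_measurable lborel" "b' \<in> borel_measurable lborel"
      and ae: "AE p in lborel. (indicat_real S (fst p) *\<^sub>R a (fst p)) * (indicat_real T (snd p) *\<^sub>R b (snd p))
         = a' (fst p) * b' (snd p)"
      by blast
    have "(\<lambda>p. a' (fst p) * b' (snd p)) \<in> borel_measurable lborel"
      by (simp add: borel_prod[symmetric])
    from measurable_completion_AE_eq[OF this ae] show ?thesis
      by (simp add: borel_measurable_restrict_space_iff ind)
  qed
  show "integrable (lebesgue_on (S \<times> T)) (\<lambda>(x, y). a x * b y)"
    if a: "integrable (lebesgue_on S) a" and b: "integrable (lebesgue_on T) b"
  proof -
    from repr[OF borel_measurable_integrable[OF a] borel_measurable_integrable[OF b]]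
    obtain a' b' where [measurable]: "a' \<in> borel_measurable lborel" "b' \<in> borel_measurable lborel"
      and ae: "AE x in lborel. indicat_real S x *\<^sub>R a x = a' x" "AE y in lborel. indicat_real T y *\<^sub>R b y = b' y"
      "AE p in lborel. (indicat_real S (fst p) *\<^sub>R a (fst p)) * (indicat_real T (snd p) *\<^sub>R b (snd p))
         = a' (fst p) * b' (snd p)"
      by blast
    have "integrable lebesgue (\<lambda>x. indicat_real S x *\<^sub>R a x)" "integrable lebesgue (\<lambda>x. indicat_real T x *\<^sub>R b x)"
      using a b by (simp_all add: integrable_restrict_space)
    then have "integrable lebesgue a'" "integrable lebesgue b'"
      using ae(1,2)[THEN AE_completion]
      by (auto elim!: integrable_cong_AE_imp intro!: measurable_completion elim!: eventually_mono)
    then have a': "integrable lborel a'" and b': "integrable lborel b'"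
      by (simp_all add: integrable_completion)
    have "integrable (lborel \<Otimes>\<^sub>M lborel) (\<lambda>p. a' (fst p) * b' (snd p))"
      by (rule lborel_pair.Fubini_integrable) (use a' b' in \<open>auto simp: norm_mult\<close>)
    then have "integrable lborel (\<lambda>p. a' (fst p) * b' (snd p))"
      unfolding lborel_prod .
    from integrable_completion_AE_eq[OF this ae(3)] show ?thesis
      by (simp add: integrable_restrict_space ind)
  qed
qed

lemma tensor_L2:
  fixes S :: "'a::euclidean_space set" and T :: "real set"
  assumes S: "S \<in> sets borel" and T: "T \<in> sets borel"
    and a: "a \<in> L2 (lebesgue_on S)" and b: "b \<in> L2 (lebesgue_on T)"
  shows "tensor a b \<in> L2 (lebesgue_on (S \<times> T))"
proof -
  have "integrable (lebesgue_on S) (\<lambda>x. complex_of_real ((cmod (a x))\<^sup>2))"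
    "integrable (lebesgue_on T) (\<lambda>x. complex_of_real ((cmod (b x))\<^sup>2))"
    using L2_integrable_norm2[OF a] L2_integrable_norm2[OF b]
    by (simp_all only: complex_of_real_integrable_eq)
  from integrable_norm[OF integrable_product_on[OF S T this]]
  have "integrable (lebesgue_on (S \<times> T)) (\<lambda>p. (cmod (tensor a b p))\<^sup>2)"
    by (simp add: tensor_def case_prod_unfold norm_mult norm_power power_mult_distrib)
  with borel_measurable_product_on[OF S T L2_measurable[OF a] L2_measurable[OF b]]
  show ?thesis
    by (simp add: L2_def tensor_def)
qed

lemma l2_inner_tensor:
  fixes S :: "'a::euclidean_space set" and T :: "real set"
  assumes S: "S \<in> sets borel" and T: "T \<in> sets borel"
    and F: "F \<in> L2 (lebesgue_on (S \<times> T))"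
    and a: "a \<in> L2 (lebesgue_on S)" and b: "b \<in> L2 (lebesgue_on T)"
  shows "l2_inner (lebesgue_on (S \<times> T)) F (tensor a b)
    = l2_inner (lebesgue_on T) (\<lambda>t. l2_inner (lebesgue_on S) (\<lambda>x. F (x, t)) a) b" (is ?snd)
    and "l2_inner (lebesgue_on (S \<times> T)) F (tensor a b)
    = l2_inner (lebesgue_on S) (\<lambda>x. l2_inner (lebesgue_on T) (\<lambda>t. F (x, t)) b) a" (is ?fst)
proof -
  note i = L2_integrable_mult[OF F tensor_L2[OF S T a b]]
  show ?snd
    using integral_snd_on[OF S T i]
    by (simp add: l2_inner_def tensor_def flip: mult.assoc)
  have "(LINT x|lebesgue_on S. LINT t|lebesgue_on T. F (x, t) * cnj (tensor a b (x, t))) =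
     (LINT x|lebesgue_on S. (LINT t|lebesgue_on T. F (x, t) * cnj (b t)) * cnj (a x))"
    by (intro Bochner_Integration.integral_cong refl) 
       (simp add: tensor_def mult_ac flip: integral_mult_left_zero)
  then show ?fst
    using integral_fst_on[OF S T i] by (simp add: l2_inner_def)
qed

text \<open>
  Fubini's theorem for \<open>\<bar>F\<bar>\<^sup>2\<close>. Finiteness of the measure makes \<open>F\<close> itself integrable, and this is
  where the measurability of almost all slices comes from.
\<close>

lemma L2_slices:
  fixes S :: "'a::euclidean_space set" and T :: "real set"
  assumes S: "S \<in> sets borel" and T: "T \<in> sets borel" and fin: "finite_measure (lebesgue_on (S \<times> T))"
    and F: "F \<in> L2 (lebesgue_on (S \<times> T))"
  shows "AE t in lebesgue_on T. (\<lambda>x. F (x, t)) \<in> L2 (lebesgue_on S)"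
    and "integrable (lebesgue_on T) (\<lambda>t. (l2_norm (lebesgue_on S) (\<lambda>x. F (x, t)))\<^sup>2)"
    and "(LINT t|lebesgue_on T. (l2_norm (lebesgue_on S) (\<lambda>x. F (x, t)))\<^sup>2) = (l2_norm (lebesgue_on (S \<times> T)) F)\<^sup>2"
proof -
  interpret finite_measure "lebesgue_on (S \<times> T)" by fact
  have one: "(\<lambda>x. 1) \<in> L2 (lebesgue_on (S \<times> T))"
    by (simp add: L2_def)
  have i1: "integrable (lebesgue_on (S \<times> T)) F"
    using L2_integrable_mult[OF F one] by simp
  have i2: "integrable (lebesgue_on (S \<times> T)) (\<lambda>p. complex_of_real ((cmod (F p))\<^sup>2))"
    using L2_integrable_norm2[OF F] by (simp del: of_real_power)
  have "AE t in lebesgue_on T. integrable (lebesgue_on S) (\<lambda>x. complex_of_real ((cmod (F (x, t)))\<^sup>2))"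
    by (rule AE_integrable_snd_on[OF S T i2])
  with AE_integrable_snd_on[OF S T i1] show "AE t in lebesgue_on T. (\<lambda>x. F (x, t)) \<in> L2 (lebesgue_on S)"
    by eventually_elim (simp add: L2_def complex_of_real_integrable_eq del: of_real_power)
  show "integrable (lebesgue_on T) (\<lambda>t. (l2_norm (lebesgue_on S) (\<lambda>x. F (x, t)))\<^sup>2)"
    using integrable_snd_on[OF S T i2]
    by (simp add: l2_norm_power2 complex_of_real_integrable_eq del: of_real_power)
  have "complex_of_real (LINT t|lebesgue_on T. (l2_norm (lebesgue_on S) (\<lambda>x. F (x, t)))\<^sup>2)
     = complex_of_real ((l2_norm (lebesgue_on (S \<times> T)) F)\<^sup>2)"
    using integral_snd_on[OF S T i2] by (simp add: l2_norm_power2 del: of_real_power)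
  then show "(LINT t|lebesgue_on T. (l2_norm (lebesgue_on S) (\<lambda>x. F (x, t)))\<^sup>2) = (l2_norm (lebesgue_on (S \<times> T)) F)\<^sup>2"
    unfolding of_real_eq_iff .
qed

section \<open>Reflections\<close>

lemma
  assumes T: "T \<in> M \<rightarrow>\<^sub>M M" and pres: "distr M M T = M" and C: "C \<in> sets M"
    and inv: "\<And>p. p \<in> space M \<Longrightarrow> T p \<in> C \<longleftrightarrow> p \<in> C"
  shows measurable_restrict_preserving: "T \<in> restrict_space M C \<rightarrow>\<^sub>M restrict_space M C"
    and distr_restrict_preserving: "distr (restrict_space M C) (restrict_space M C) T = restrict_space M C"
proof -
  have CM: "C \<inter> space M = C"
    using sets.sets_into_space[OF C] by auto
  show T': "T \<in> restrict_space M C \<rightarrow>\<^sub>M restrict_space M C"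
    using T inv sets.sets_into_space[OF C]
    by (intro measurable_restrict_space2 measurable_restrict_space1)
       (auto simp: space_restrict_space)
  show "distr (restrict_space M C) (restrict_space M C) T = restrict_space M C"
  proof (rule measure_eqI)
    fix A assume "A \<in> sets (distr (restrict_space M C) (restrict_space M C) T)"
    then have A: "A \<in> sets M" "A \<subseteq> C"
      using C by (auto simp: sets_restrict_space_iff CM)
    have eq: "T -` A \<inter> C = T -` A \<inter> space M"
      using A(2) inv sets.sets_into_space[OF C] by auto
    have "emeasure (distr (restrict_space M C) (restrict_space M C) T) A
        = emeasure (restrict_space M C) (T -` A \<inter> C)"
      using A C CM by (subst emeasure_distr[OF T']) (auto simp: sets_restrict_space_iff space_restrict_space)
    also have "\<dots> = emeasure M (T -` A \<inter> space M)"
      unfolding eq[symmetric] by (rule emeasure_restrict_space) (use C CM in auto)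
    also have "\<dots> = emeasure (distr M M T) A"
      using A by (subst emeasure_distr[OF T]) auto
    also have "\<dots> = emeasure (restrict_space M C) A"
      using A C CM by (simp add: pres emeasure_restrict_space)
    finally show "emeasure (distr (restrict_space M C) (restrict_space M C) T) A = emeasure (restrict_space M C) A" .
  qed simp
qed

text \<open>
  \<open>R\<close> is the reflection in the hyperplane \<open>p \<bullet> j = 1/2\<close>, which replaces the coordinate \<open>s = p \<bullet> j\<close>
  by \<open>1 - s\<close>. It covers both the reflection of the unit interval and that of time on the cylinder.
\<close>

lemma
  fixes j :: "'a::euclidean_space"
  assumes j: "j \<in> Basis"
  defines "R \<equiv> (\<lambda>p. p + (1 - 2 * (p \<bullet> j)) *\<^sub>R j)"
  shows measurable_lebesgue_reflection: "R \<in> lebesgue \<rightarrow>\<^sub>M lebesgue"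
    and distr_lebesgue_reflection: "distr lebesgue lebesgue R = lebesgue"
proof -
  define c where "c i = (if i = j then -1 else 1 :: real)" for i
  have c: "c i \<noteq> 0" for i by (simp add: c_def)
  have R: "R = (\<lambda>p. j + (\<Sum>i\<in>Basis. (c i * (p \<bullet> i)) *\<^sub>R i))"
  proof
    fix p
    have "(\<Sum>i\<in>Basis. (c i * (p \<bullet> i)) *\<^sub>R i)
        = (\<Sum>i\<in>Basis. (p \<bullet> i) *\<^sub>R i - (if i = j then 2 * (p \<bullet> j) else 0) *\<^sub>R i)"
      by (intro sum.cong) (auto simp: c_def algebra_simps simp flip: scaleR_left_distrib)
    also have "\<dots> = p - (\<Sum>i\<in>Basis. (if i = j then 2 * (p \<bullet> j) else 0) *\<^sub>R i)"
      by (simp add: sum_subtractf euclidean_representation)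
    also have "(\<Sum>i\<in>Basis. (if i = j then 2 * (p \<bullet> j) else 0) *\<^sub>R i) = (2 * (p \<bullet> j)) *\<^sub>R j"
      using j by (simp add: if_distrib[of "\<lambda>a. a *\<^sub>R _"] cong: if_cong)
    finally show "R p = j + (\<Sum>i\<in>Basis. (c i * (p \<bullet> i)) *\<^sub>R i)"
      by (simp add: R_def algebra_simps)
  qed
  show "R \<in> lebesgue \<rightarrow>\<^sub>M lebesgue"
    unfolding R using lebesgue_affine_measurable[of c j] c by simp
  have "(\<Prod>i\<in>Basis. \<bar>c i\<bar>) = 1"
    by (intro prod.neutral) (auto simp: c_def)
  then show "distr lebesgue lebesgue R = lebesgue"
    unfolding R using lebesgue_affine_euclidean[of c j] c by (simp add: density_1)
qed

lemma
  fixes f :: "'a \<Rightarrow> complex"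
  assumes R: "R \<in> M \<rightarrow>\<^sub>M M" and pres: "distr M M R = M"
  shows L2_preserving: "f \<in> L2 M \<Longrightarrow> (\<lambda>x. f (R x)) \<in> L2 M"
    and l2_inner_preserving: "f \<in> L2 M \<Longrightarrow> g \<in> L2 M \<Longrightarrow> l2_inner M (\<lambda>x. f (R x)) (\<lambda>x. g (R x)) = l2_inner M f g"
    and l2_norm_preserving: "f \<in> L2 M \<Longrightarrow> l2_norm M (\<lambda>x. f (R x)) = l2_norm M f"
proof -
  show "(\<lambda>x. f (R x)) \<in> L2 M" if "f \<in> L2 M"
  proof -
    have [measurable]: "f \<in> borel_measurable M" using that by (rule L2_measurable)
    have "integrable (distr M M R) (\<lambda>x. (cmod (f x))\<^sup>2)"
      using L2_integrable_norm2[OF that] by (simp add: pres)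
    then have "integrable M (\<lambda>x. (cmod (f (R x)))\<^sup>2)"
      by (subst (asm) integrable_distr_eq[OF R]) measurable
    moreover have "(\<lambda>x. f (R x)) \<in> borel_measurable M"
      by (rule measurable_compose[OF R L2_measurable[OF that]])
    ultimately show ?thesis by (simp add: L2_def)
  qed
  show "l2_inner M (\<lambda>x. f (R x)) (\<lambda>x. g (R x)) = l2_inner M f g" if f: "f \<in> L2 M" and g: "g \<in> L2 M"
  proof -
    note [measurable] = L2_measurable[OF f] L2_measurable[OF g]
    have "(LINT x|distr M M R. f x * cnj (g x)) = (LINT x|M. f (R x) * cnj (g (R x)))"
      by (rule integral_distr[OF R]) measurable
    then show ?thesis by (simp add: pres l2_inner_def)
  qed
  show "l2_norm M (\<lambda>x. f (R x)) = l2_norm M f" if f: "f \<in> L2 M"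
  proof -
    note [measurable] = L2_measurable[OF f]
    have "(LINT x|distr M M R. (cmod (f x))\<^sup>2) = (LINT x|M. (cmod (f (R x)))\<^sup>2)"
      by (rule integral_distr[OF R]) measurable
    then show ?thesis by (simp add: pres l2_norm_def)
  qed
qed

abbreviation I01 :: "real measure" where
  "I01 \<equiv> lebesgue_on {0<..<1}"

lemma
  shows measurable_reflect_I01: "(\<lambda>t. 1 - t) \<in> I01 \<rightarrow>\<^sub>M I01"
    and distr_reflect_I01: "distr I01 I01 (\<lambda>t. 1 - t) = I01"
proof -
  have eq: "(\<lambda>p. p + (1 - 2 * (p \<bullet> 1)) *\<^sub>R 1) = (\<lambda>t::real. 1 - t)"
    by auto
  have *: "(\<lambda>t::real. 1 - t) \<in> lebesgue \<rightarrow>\<^sub>M lebesgue" "distr lebesgue lebesgue (\<lambda>t::real. 1 - t) = lebesgue"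
    using measurable_lebesgue_reflection[of "1::real"] distr_lebesgue_reflection[of "1::real"]
    unfolding eq by auto
  show "(\<lambda>t. 1 - t) \<in> I01 \<rightarrow>\<^sub>M I01" "distr I01 I01 (\<lambda>t. 1 - t) = I01"
    by (rule measurable_restrict_preserving[OF *] distr_restrict_preserving[OF *]; auto)+
qed

lemmas L2_reflect_I01 = L2_preserving[OF measurable_reflect_I01 distr_reflect_I01]
lemmas l2_inner_reflect_I01 = l2_inner_preserving[OF measurable_reflect_I01 distr_reflect_I01]
lemmas l2_norm_reflect_I01 = l2_norm_preserving[OF measurable_reflect_I01 distr_reflect_I01]

definition time_reflection :: "'a \<times> real \<Rightarrow> 'a \<times> real" where
  "time_reflection = (\<lambda>(x, t). (x, 1 - t))"

lemma
  fixes S :: "'a::euclidean_space set"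
  assumes S: "S \<in> sets borel"
  shows measurable_time_reflection:
      "time_reflection \<in> lebesgue_on (cylinder S) \<rightarrow>\<^sub>M lebesgue_on (cylinder S)"
    and distr_time_reflection:
      "distr (lebesgue_on (cylinder S)) (lebesgue_on (cylinder S)) time_reflection = lebesgue_on (cylinder S)"
proof -
  have eq: "(\<lambda>p. p + (1 - 2 * (p \<bullet> (0, 1))) *\<^sub>R (0, 1)) = (time_reflection :: 'a \<times> real \<Rightarrow> _)"
    by (auto simp: time_reflection_def)
  have b: "(0, 1) \<in> (Basis :: ('a \<times> real) set)"
    by (simp add: Basis_prod_def)
  have *: "(time_reflection :: 'a \<times> real \<Rightarrow> _) \<in> lebesgue \<rightarrow>\<^sub>M lebesgue"
      "distr lebesgue lebesgue (time_reflection :: 'a \<times> real \<Rightarrow> _) = lebesgue"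
    using measurable_lebesgue_reflection[OF b] distr_lebesgue_reflection[OF b] unfolding eq by auto
  have "cylinder S \<in> sets lebesgue"
    using S by (auto intro: borel_Times_lebesgue)
  then show "time_reflection \<in> lebesgue_on (cylinder S) \<rightarrow>\<^sub>M lebesgue_on (cylinder S)"
    "distr (lebesgue_on (cylinder S)) (lebesgue_on (cylinder S)) time_reflection = lebesgue_on (cylinder S)"
    by (rule measurable_restrict_preserving[OF *] distr_restrict_preserving[OF *]; auto simp: time_reflection_def)+
qed

section \<open>Functions continuous up to the boundary\<close>

lemma finite_measure_lebesgue_on_open:
  fixes C :: "'a::euclidean_space set"
  assumes "open C" "bounded C"
  shows "finite_measure (lebesgue_on C)"
  using assms by (intro finite_measure_lebesgue_on) (auto intro: lmeasurable_open)

lemma L2_integrable: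
  assumes "finite_measure M" "f \<in> L2 M"
  shows "integrable M f"
proof -
  interpret finite_measure M by fact
  have "(\<lambda>x. 1) \<in> L2 M" by (simp add: L2_def)
  from L2_integrable_mult[OF assms(2) this] show ?thesis by simp
qed

lemma continuous_L2:
  fixes f :: "'a::euclidean_space \<Rightarrow> complex"
  assumes C: "open C" "bounded C" and f: "continuous_on (closure C) f"
  shows "f \<in> L2 (lebesgue_on C)"
proof -
  interpret finite_measure "lebesgue_on C"
    using C by (rule finite_measure_lebesgue_on_open)
  have "continuous_on C f"
    using f closure_subset by (rule continuous_on_subset)
  then have m[measurable]: "f \<in> borel_measurable (lebesgue_on C)"
    using C by (intro continuous_imp_measurable_on_sets_lebesgue) auto
  have "compact (f ` closure C)"
    using f C by (intro compact_continuous_image) auto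
  then obtain B where B: "\<And>x. x \<in> closure C \<Longrightarrow> cmod (f x) \<le> B"
    using bounded_iff compact_imp_bounded by (metis image_eqI)
  have "AE x in lebesgue_on C. norm ((cmod (f x))\<^sup>2) \<le> B\<^sup>2"
    using B closure_subset[of C] by (intro AE_I2) (auto intro!: power_mono)
  then have "integrable (lebesgue_on C) (\<lambda>x. (cmod (f x))\<^sup>2)"
    by (rule integrable_const_bound) measurable
  with m show ?thesis by (simp add: L2_def)
qed

lemma continuous_L2_I01:
  "continuous_on {0..1} f \<Longrightarrow> f \<in> L2 I01"
  by (rule continuous_L2) auto

lemma finite_measure_I01: "finite_measure I01"
  by (intro finite_measure_lebesgue_on_open) auto

lemma integral_I01:
  fixes f :: "real \<Rightarrow> complex"
  assumes "continuous_on {0..1} f"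
  shows "integral\<^sup>L I01 f = integral {0..1} f"
proof -
  have "integrable I01 f"
    using L2_integrable[OF finite_measure_I01 continuous_L2_I01[OF assms]] .
  then have "integral\<^sup>L I01 f = integral {0<..<1} f"
    by (rule lebesgue_integral_eq_integral) simp
  also have "\<dots> = integral {0..1} f"
    by (rule integral_open_interval_real[symmetric])
  finally show ?thesis .
qed

section \<open>Twice differentiable functions on the unit interval\<close>

text \<open>
  Differentiability at the end points follows from the fundamental theorem of calculus, as \<open>f\<close> is
  an antiderivative of the continuous function \<open>g\<close> on the whole closed interval. It is used where
  only the interior derivatives and their continuous extensions are given.
\<close>

lemma has_vector_derivative_closed_interval:
  fixes f g :: "real \<Rightarrow> 'b::banach"
  assumes f: "continuous_on {0..1} f" and g: "continuous_on {0..1} g"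
    and d: "\<And>t. t \<in> {0<..<1} \<Longrightarrow> (f has_vector_derivative g t) (at t)"
    and t: "t \<in> {0..1}"
  shows "(f has_vector_derivative g t) (at t within {0..1})"
proof (rule has_vector_derivative_transform[OF t])
  show "((\<lambda>s. f 0 + integral {0..s} g) has_vector_derivative g t) (at t within {0..1})"
    using integral_has_vector_derivative[OF g t] by (auto intro!: derivative_eq_intros)
  fix s :: real assume s: "s \<in> {0..1}"
  have "(g has_integral (f s - f 0)) {0..s}"
    using s by (intro fundamental_theorem_of_calculus_interior)
               (auto intro: d continuous_on_subset[OF f])
  then show "f s = f 0 + integral {0..s} g"
    by (simp add: integral_unique)
qed

text \<open>
  The two derivatives, one-sided at the end points, are explicit arguments: they are then available
  as functions that are known to be continuous.
\<close>

definition C2_01 :: "(real \<Rightarrow> complex) \<Rightarrow> (real \<Rightarrow> complex) \<Rightarrow> (real \<Rightarrow> complex) \<Rightarrow> bool" where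
  "C2_01 v v' v'' \<longleftrightarrow>
     (\<forall>t\<in>{0..1}. (v has_vector_derivative v' t) (at t within {0..1}) \<and>
        (v' has_vector_derivative v'' t) (at t within {0..1})) \<and> continuous_on {0..1} v''"

lemma C2_01D:
  assumes "C2_01 v v' v''"
  shows "continuous_on {0..1} v" "continuous_on {0..1} v'" "continuous_on {0..1} v''"
    and "t \<in> {0..1} \<Longrightarrow> (v has_vector_derivative v' t) (at t within {0..1})"
    and "t \<in> {0..1} \<Longrightarrow> (v' has_vector_derivative v'' t) (at t within {0..1})"
  using assms unfolding C2_01_def
  by (auto intro!: continuous_on_vector_derivative)

lemma C2_01_lincomb:
  assumes "C2_01 v v' v''" "C2_01 w w' w''"
  shows "C2_01 (\<lambda>t. a * v t + b * w t) (\<lambda>t. a * v' t + b * w' t) (\<lambda>t. a * v'' t + b * w'' t)"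
  using C2_01D[OF assms(1)] C2_01D[OF assms(2)] unfolding C2_01_def
  by (auto intro!: continuous_intros derivative_intros)

lemma C2_01_cnj:
  assumes "C2_01 v v' v''"
  shows "C2_01 (\<lambda>t. cnj (v t)) (\<lambda>t. cnj (v' t)) (\<lambda>t. cnj (v'' t))"
  using C2_01D[OF assms] unfolding C2_01_def
  by (auto intro!: continuous_intros bounded_linear.has_vector_derivative[OF bounded_linear_cnj])

lemma C2_01_reflect:
  assumes "C2_01 v v' v''"
  shows "C2_01 (\<lambda>t. v (1 - t)) (\<lambda>t. - v' (1 - t)) (\<lambda>t. v'' (1 - t))"
proof -
  have im: "(\<lambda>t::real. 1 - t) ` {0..1} = {0..1}"
    by (auto simp: image_iff intro!: bexI[of _ "1 - _"])
  have refl: "((\<lambda>t. f (1 - t)) has_vector_derivative - f' (1 - t)) (at t within {0..1})"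
    if "\<And>t. t \<in> {0..1} \<Longrightarrow> (f has_vector_derivative f' t) (at t within {0..1})" "t \<in> {0..1}"
    for f f' :: "real \<Rightarrow> complex" and t
  proof -
    have "((\<lambda>t. 1 - t) has_vector_derivative -1) (at t within {0..1})"
      by (auto intro!: derivative_eq_intros)
    then have "(f \<circ> (\<lambda>t. 1 - t) has_vector_derivative (-1) *\<^sub>R f' (1 - t)) (at t within {0..1})"
      using that by (intro vector_diff_chain_within) (auto simp: im)
    then show ?thesis by (simp add: o_def)
  qed
  note D = C2_01D[OF assms]
  have "continuous_on {0..1} (\<lambda>t. v'' (1 - t))"
    by (rule continuous_on_compose2[OF D(3)]) (auto intro!: continuous_intros)
  moreover have "((\<lambda>t. - v' (1 - t)) has_vector_derivative v'' (1 - t)) (at t within {0..1})" if "t \<in> {0..1}" for t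
    using has_vector_derivative_minus[OF refl[of v' v'', OF D(5) that]] by simp
  ultimately show ?thesis
    using refl[of v v', OF D(4)] by (simp add: C2_01_def)
qed

lemma deriv01_eq:
  "(v has_vector_derivative d) (at t within {0..1}) \<Longrightarrow> t \<in> {0..1} \<Longrightarrow> deriv01 v t = d"
  unfolding deriv01_def by (rule vector_derivative_within_closed_interval) auto

lemma C2_01_deriv01:
  assumes "C2_01 v v' v''" "t \<in> {0..1}"
  shows "deriv01 v t = v' t" "deriv01 (deriv01 v) t = v'' t"
proof -
  note D = C2_01D[OF assms(1)]
  have 1: "deriv01 v s = v' s" if "s \<in> {0..1}" for s
    using D(4)[OF that] that by (rule deriv01_eq)
  show "deriv01 v t = v' t"
    using 1 assms(2) .
  have "(deriv01 v has_vector_derivative v'' t) (at t within {0..1})"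
    by (rule has_vector_derivative_transform[OF assms(2) _ D(5)[OF assms(2)]]) (simp add: 1)
  then show "deriv01 (deriv01 v) t = v'' t"
    using assms(2) by (rule deriv01_eq)
qed

text \<open>
  Integrate \<open>(v' w - v w')' = v'' w - v w''\<close>. The boundary terms vanish because \<open>v\<close> has zero Cauchy
  data at \<open>0\<close> and \<open>w\<close> has zero Cauchy data at \<open>1\<close>.
\<close>

lemma Green_01:
  assumes v: "C2_01 v v' v''" and w: "C2_01 w w' w''"
    and "v 0 = 0" "v' 0 = 0" "w 1 = 0" "w' 1 = 0"
  shows "(LINT t|I01. v'' t * w t) = (LINT t|I01. v t * w'' t)"
proof -
  note V = C2_01D[OF v] and W = C2_01D[OF w]
  have c: "continuous_on {0..1} (\<lambda>t. v'' t * w t)" "continuous_on {0..1} (\<lambda>t. v t * w'' t)"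
    using V W by (auto intro!: continuous_intros)
  have "((\<lambda>t. v'' t * w t - v t * w'' t) has_integral
      (v' 1 * w 1 - v 1 * w' 1) - (v' 0 * w 0 - v 0 * w' 0)) {0..1}"
    by (rule fundamental_theorem_of_calculus)
       (use V W in \<open>auto intro!: derivative_eq_intros simp: algebra_simps\<close>)
  then have "integral {0..1} (\<lambda>t. v'' t * w t - v t * w'' t) = 0"
    using assms(3-) by (simp add: integral_unique)
  then show ?thesis
    unfolding integral_I01[OF c(1)] integral_I01[OF c(2)]
    using c by (simp add: integral_diff integrable_continuous_real)
qed

section \<open>The spectral problem on the interval\<close>

text \<open>
  With \<open>h = w'' - r\<^sup>2 w\<close> and \<open>p = w' + r w\<close> one has \<open>p' = r p + h\<close> and \<open>w' = - r w + p\<close>. Since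
  \<open>p(1) = 0\<close>, the first equation is solved backwards from \<open>1\<close>, and since \<open>w(0) = 0\<close>, the second one
  forwards from \<open>0\<close>. In both cases the exponential weights are at most \<open>1\<close>, so \<open>p\<close>, and then \<open>w\<close>,
  is bounded pointwise by the integral of \<open>\<bar>h\<bar>\<close>.
\<close>

lemma l2_norm_le_reduced:
  fixes r :: real
  assumes w: "C2_01 w w' w''" and w0: "w 0 = 0" and r: "r \<ge> 0"
    and end1: "w' 1 + of_real r * w 1 = 0"
  shows "l2_norm I01 w \<le> l2_norm I01 (\<lambda>t. w'' t - of_real (r\<^sup>2) * w t)"
proof -
  note W = C2_01D[OF w]
  define h where "h t = w'' t - of_real (r\<^sup>2) * w t" for t
  define p where "p t = w' t + of_real r * w t" for t
  have ch: "continuous_on {0..1} h"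
    unfolding h_def[abs_def] using W by (intro continuous_intros)
  have chn: "continuous_on {0..1} (\<lambda>t. cmod (h t))"
    using ch by (intro continuous_intros)
  define H where "H = integral {0..1} (\<lambda>t. cmod (h t))"
  have H0: "H \<ge> 0"
    unfolding H_def by (intro integral_nonneg integrable_continuous_real chn) auto
  have hL: "h \<in> L2 I01"
    using ch by (rule continuous_L2_I01)
  have one: "(\<lambda>t. 1) \<in> L2 I01"
    by (intro continuous_L2_I01 continuous_intros)
  have n1: "l2_norm I01 (\<lambda>t. 1) = 1"
    by (simp add: l2_norm_def measure_restrict_space)
  have "H = (LINT t|I01. cmod (h t))"
  proof -
    have "integrable I01 (\<lambda>t. cmod (h t))"
      using L2_integrable[OF finite_measure_I01 hL] by (rule integrable_norm)
    then have "(LINT t|I01. cmod (h t)) = integral {0<..<1} (\<lambda>t. cmod (h t))"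
      by (rule lebesgue_integral_eq_integral) simp
    then show ?thesis
      by (simp add: H_def integral_open_interval_real)
  qed
  also have "\<dots> \<le> l2_norm I01 h"
    using l2_Cauchy_Schwarz_norm[OF hL one] by (simp add: n1)
  finally have H_le: "H \<le> l2_norm I01 h" .
  \<comment> \<open>integrating factors for the two equations of first order\<close>
  have dp: "((\<lambda>t. exp (- r * t) *\<^sub>R p t) has_vector_derivative exp (- r * t) *\<^sub>R h t) (at t within {0..1})"
    if "t \<in> {0..1}" for t
    unfolding p_def h_def
    by (auto intro!: derivative_eq_intros W(4,5) that has_vector_derivative_scaleR
          simp: has_real_derivative_iff_has_vector_derivative[symmetric] algebra_simps power2_eq_square scaleR_conv_of_real)
  have dw: "((\<lambda>t. exp (r * t) *\<^sub>R w t) has_vector_derivative exp (r * t) *\<^sub>R p t) (at t within {0..1})"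
    if "t \<in> {0..1}" for t
    unfolding p_def h_def
    by (auto intro!: derivative_eq_intros W(4,5) that has_vector_derivative_scaleR
          simp: has_real_derivative_iff_has_vector_derivative[symmetric] algebra_simps power2_eq_square scaleR_conv_of_real)
  \<comment> \<open>\<open>exp (- r s) \<le> exp (- r t)\<close> for \<open>s \<ge> t\<close>\<close>
  have p_le: "cmod (p t) \<le> H" if t: "t \<in> {0..1}" for t
  proof -
    have "((\<lambda>s. exp (- r * s) *\<^sub>R h s) has_integral (exp (- r * 1) *\<^sub>R p 1 - exp (- r * t) *\<^sub>R p t)) {t..1}"
    proof (rule fundamental_theorem_of_calculus)
      fix s assume "s \<in> {t..1}"
      with t show "((\<lambda>s. exp (- r * s) *\<^sub>R p s) has_vector_derivative exp (- r * s) *\<^sub>R h s) (at s within {t..1})"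
        by (intro has_vector_derivative_within_subset[OF dp]) auto
    qed (use t in simp)
    then have hi: "((\<lambda>s. exp (- r * s) *\<^sub>R h s) has_integral (- (exp (- r * t) *\<^sub>R p t))) {t..1}"
      using end1 by (simp add: p_def)
    have int: "(\<lambda>s. cmod (h s)) integrable_on {t..1}"
      using t by (intro integrable_continuous_real continuous_on_subset[OF chn]) auto
    have "exp (- r * t) * cmod (p t) = cmod (integral {t..1} (\<lambda>s. exp (- r * s) *\<^sub>R h s))"
      using integral_unique[OF hi] by simp
    also have "\<dots> \<le> integral {t..1} (\<lambda>s. exp (- r * t) * cmod (h s))"
    proof (rule integral_norm_bound_integral)
      show "(\<lambda>s. exp (- r * s) *\<^sub>R h s) integrable_on {t..1}"
        using hi by blast
      show "(\<lambda>s. exp (- r * t) * cmod (h s)) integrable_on {t..1}"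
        using int by (rule integrable_on_mult_right)
      show "norm (exp (- r * s) *\<^sub>R h s) \<le> exp (- r * t) * cmod (h s)" if "s \<in> {t..1}" for s
        using r that by (auto intro!: mult_right_mono mult_left_mono)
    qed
    also have "\<dots> = exp (- r * t) * integral {t..1} (\<lambda>s. cmod (h s))"
      by simp
    also have "\<dots> \<le> exp (- r * t) * H"
      unfolding H_def using t int integrable_continuous_real[OF chn]
      by (intro mult_left_mono integral_subset_le) auto
    finally show ?thesis by simp
  qed
  \<comment> \<open>\<open>exp (r s) \<le> exp (r t)\<close> for \<open>s \<le> t\<close>\<close>
  have w_le: "cmod (w t) \<le> H" if t: "t \<in> {0..1}" for t
  proof -
    have hi: "((\<lambda>s. exp (r * s) *\<^sub>R p s) has_integral (exp (r * t) *\<^sub>R w t - exp (r * 0) *\<^sub>R w 0)) {0..t}"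
      using t by (intro fundamental_theorem_of_calculus)
                 (auto intro!: has_vector_derivative_within_subset[OF dw])
    have "exp (r * t) * cmod (w t) = cmod (integral {0..t} (\<lambda>s. exp (r * s) *\<^sub>R p s))"
      using integral_unique[OF hi] w0 by simp
    also have "\<dots> \<le> integral {0..t} (\<lambda>s. exp (r * t) * H)"
    proof (rule integral_norm_bound_integral)
      show "(\<lambda>s. exp (r * s) *\<^sub>R p s) integrable_on {0..t}"
        using hi by blast
      show "norm (exp (r * s) *\<^sub>R p s) \<le> exp (r * t) * H" if "s \<in> {0..t}" for s
        using r t that p_le[of s] by (auto intro!: mult_mono mult_left_mono)
    qed (simp add: integrable_const_ivl)
    also have "\<dots> = t * (exp (r * t) * H)"
      using t by simp
    also have "\<dots> \<le> 1 * (exp (r * t) * H)"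
      using t H0 by (intro mult_right_mono) auto
    finally show ?thesis by simp
  qed
  have "(l2_norm I01 w)\<^sup>2 \<le> (LINT t|I01. H\<^sup>2)"
    unfolding l2_norm_power2
  proof (rule integral_mono)
    show "integrable I01 (\<lambda>t. (cmod (w t))\<^sup>2)"
      by (rule L2_integrable_norm2[OF continuous_L2_I01[OF W(1)]])
    show "integrable I01 (\<lambda>t. H\<^sup>2)"
      using finite_measure_I01 by (simp add: finite_measure.integrable_const)
  qed (use w_le in \<open>auto intro!: power_mono\<close>)
  also have "\<dots> = H\<^sup>2"
    by (simp add: measure_restrict_space)
  finally have "l2_norm I01 w \<le> H"
    using H0 by (rule power2_le_imp_le)
  with H_le show ?thesis
    unfolding h_def[abs_def] by simp
qed

lemma C_ext_2_interval:
  fixes v :: "real \<Rightarrow> complex"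
  assumes "C_ext 2 {0<..<1} {0..1} v"
  obtains v' v'' where "C2_01 v v' v''"
proof -
  have "C_ext (Suc (Suc 0)) {0<..<1} {0..1} v"
    using assms by (simp only: numeral_2_eq_2)
  then obtain G where cv: "continuous_on {0..1} v"
    and G: "\<forall>x\<in>{0<..<1}. (v has_derivative (\<lambda>h. h *\<^sub>R G (1::real) x)) (at x)"
    and C1: "C_ext (Suc 0) {0<..<1} {0..1} (G 1)"
    unfolding C_ext.simps(2)[of "Suc 0"] Basis_real_def by (simp del: C_ext.simps) blast
  from C1 obtain G2 where cv': "continuous_on {0..1} (G 1)"
    and G2: "\<forall>x\<in>{0<..<1}. (G 1 has_derivative (\<lambda>h. h *\<^sub>R G2 (1::real) x)) (at x)"
    and cv'': "continuous_on {0..1} (G2 (1::real))"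
    unfolding C_ext.simps Basis_real_def by (simp del: C_ext.simps) blast
  have "C2_01 v (G 1) (G2 1)"
    unfolding C2_01_def
    using has_vector_derivative_closed_interval[OF cv cv'] has_vector_derivative_closed_interval[OF cv' cv'']
      G G2 cv'' by (simp add: has_vector_derivative_def)
  then show ?thesis by (rule that)
qed

text \<open>
  The differential equation holds in the open interval and extends to the end points by continuity.
\<close>

lemma interval_eigenfunction_C2:
  assumes "interval_eigenfunction \<mu> l v"
  obtains v' v'' where "C2_01 v v' v''" "v 0 = 0" "v' 0 = 0"
    "\<And>t. t \<in> {0..1} \<Longrightarrow> v'' t = of_real \<mu> * v t + l * v (1 - t)"
proof -
  from assms obtain v' v'' where C: "C2_01 v v' v''"
    unfolding interval_eigenfunction_def by (metis C_ext_2_interval)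
  note D = C2_01D[OF C]
  have "v'' t = of_real \<mu> * v t + l * v (1 - t)" if "t \<in> {0..1}" for t
  proof -
    have "continuous_on {0..1} (\<lambda>t. v'' t - (of_real \<mu> * v t + l * v (1 - t)))"
      using D C2_01D(1)[OF C2_01_reflect[OF C]] by (intro continuous_intros)
    then have "continuous_on (closure {0<..<1}) (\<lambda>t. v'' t - (of_real \<mu> * v t + l * v (1 - t)))"
      by simp
    moreover have "v'' t - (of_real \<mu> * v t + l * v (1 - t)) = 0" if "t \<in> {0<..<1}" for t
      using assms that C2_01_deriv01(2)[OF C, of t]
      by (auto simp: interval_eigenfunction_def algebra_simps)
    ultimately have "v'' t - (of_real \<mu> * v t + l * v (1 - t)) = 0"
      by (rule continuous_constant_on_closure) (use that in auto)
    then show ?thesis by simp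
  qed
  moreover have "v' 0 = 0"
    using assms C2_01_deriv01(1)[OF C, of 0] by (simp add: interval_eigenfunction_def)
  ultimately show ?thesis
    using that[OF C] assms by (auto simp: interval_eigenfunction_def)
qed

text \<open>
  The symmetry of \<open>R (d\<^sup>2/dt\<^sup>2 - \<mu>)\<close>, tested against an eigenfunction \<open>e\<close>: the function
  \<open>cnj (e (1 - t))\<close> has zero Cauchy data at \<open>1\<close>, as Green's formula demands.
\<close>

lemma Green_eigenfunction:
  assumes e: "interval_eigenfunction \<mu> l e" and w: "C2_01 w w' w''" "w 0 = 0" "w' 0 = 0"
  shows "(LINT t|I01. (w'' t - of_real \<mu> * w t) * cnj (e (1 - t))) = cnj l * (LINT t|I01. w t * cnj (e t))"
proof -
  obtain e' e'' where E: "C2_01 e e' e''" "e 0 = 0" "e' 0 = 0"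
    and eq: "\<And>t. t \<in> {0..1} \<Longrightarrow> e'' t = of_real \<mu> * e t + l * e (1 - t)"
    using e by (rule interval_eigenfunction_C2) blast
  note Z = C2_01_cnj[OF C2_01_reflect[OF E(1)]]
  note W = C2_01D[OF w(1)] and ZZ = C2_01D[OF Z]
  have int: "integrable I01 f" if "continuous_on {0..1} f" for f :: "real \<Rightarrow> complex"
    using L2_integrable[OF finite_measure_I01 continuous_L2_I01[OF that]] .
  have i: "integrable I01 (\<lambda>t. w'' t * cnj (e (1 - t)))" "integrable I01 (\<lambda>t. w t * cnj (e'' (1 - t)))"
     "integrable I01 (\<lambda>t. of_real \<mu> * w t * cnj (e (1 - t)))"
    using W ZZ by (auto intro!: int continuous_intros)
  have "(LINT t|I01. (w'' t - of_real \<mu> * w t) * cnj (e (1 - t)))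
      = (LINT t|I01. w'' t * cnj (e (1 - t))) - (LINT t|I01. of_real \<mu> * w t * cnj (e (1 - t)))"
    unfolding left_diff_distrib using i by (intro Bochner_Integration.integral_diff)
  also have "(LINT t|I01. w'' t * cnj (e (1 - t))) = (LINT t|I01. w t * cnj (e'' (1 - t)))"
    by (rule Green_01[OF w(1) Z]) (use w E in auto)
  also have "\<dots> - (LINT t|I01. of_real \<mu> * w t * cnj (e (1 - t)))
      = (LINT t|I01. w t * cnj (e'' (1 - t)) - of_real \<mu> * w t * cnj (e (1 - t)))"
    using i by (intro Bochner_Integration.integral_diff[symmetric])
  also have "\<dots> = (LINT t|I01. cnj l * (w t * cnj (e t)))"
    by (intro Bochner_Integration.integral_cong refl) (auto simp: eq algebra_simps)
  finally show ?thesis by simp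
qed

text \<open>
  The usual argument for symmetric operators: for \<open>w = e\<close>, the preceding identity reads
  \<open>l \<parallel>e\<parallel>\<^sup>2 = cnj l \<parallel>e\<parallel>\<^sup>2\<close>.
\<close>

lemma interval_eigenvalue_real:
  assumes "interval_eigenfunction \<mu> l e"
  shows "cnj l = l"
proof -
  obtain e' e'' where E: "C2_01 e e' e''" "e 0 = 0" "e' 0 = 0"
    and eq: "\<And>t. t \<in> {0..1} \<Longrightarrow> e'' t = of_real \<mu> * e t + l * e (1 - t)"
    using assms by (rule interval_eigenfunction_C2) blast
  have eL: "e \<in> L2 I01"
    using C2_01D(1)[OF E(1)] by (rule continuous_L2_I01)
  have "(LINT t|I01. (e'' t - of_real \<mu> * e t) * cnj (e (1 - t))) = (LINT t|I01. l * (e (1 - t) * cnj (e (1 - t))))"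
    by (intro Bochner_Integration.integral_cong refl) (auto simp: eq)
  also have "\<dots> = l * l2_inner I01 e e"
    using l2_inner_reflect_I01[OF eL eL] by (simp add: l2_inner_def)
  finally have "l * l2_inner I01 e e = cnj l * l2_inner I01 e e"
    using Green_eigenfunction[OF assms E] by (metis l2_inner_def)
  moreover have "l2_inner I01 e e \<noteq> 0"
    using assms by (simp add: l2_inner_self interval_eigenfunction_def)
  ultimately show ?thesis by simp
qed

text \<open>
  If \<open>l = 0\<close>, then \<open>exp (- r t) (e' + r e)\<close> is constant, hence zero because of the Cauchy data. So the
  end condition of \<open>l2_norm_le_reduced\<close> holds, and the estimate says \<open>\<parallel>e\<parallel> \<le> 0\<close>.
\<close>

lemma interval_eigenvalue_nonzero:
  assumes e: "interval_eigenfunction \<mu> l e" and mu: "\<mu> \<ge> 0"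
  shows "l \<noteq> 0"
proof
  assume l: "l = 0"
  obtain e' e'' where E: "C2_01 e e' e''" "e 0 = 0" "e' 0 = 0"
    and eq: "\<And>t. t \<in> {0..1} \<Longrightarrow> e'' t = of_real \<mu> * e t + l * e (1 - t)"
    using e by (rule interval_eigenfunction_C2) blast
  note D = C2_01D[OF E(1)]
  define r where "r = sqrt \<mu>"
  have r: "r \<ge> 0" "r\<^sup>2 = \<mu>" using mu by (auto simp: r_def)
  have "((\<lambda>t. exp (- r * t) *\<^sub>R (e' t + of_real r * e t)) has_vector_derivative 0) (at t within {0..1})"
    if "t \<in> {0..1}" for t
    by (auto intro!: derivative_eq_intros D(4,5) that has_vector_derivative_scaleR
          simp: has_real_derivative_iff_has_vector_derivative[symmetric] algebra_simps power2_eq_square 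
                scaleR_conv_of_real eq[OF that] l r(2)[symmetric])
  then have "((\<lambda>t::real. 0 :: complex) has_integral
      exp (- r * 1) *\<^sub>R (e' 1 + of_real r * e 1) - exp (- r * 0) *\<^sub>R (e' 0 + of_real r * e 0)) {0..1}"
    by (intro fundamental_theorem_of_calculus) auto
  then have "e' 1 + of_real r * e 1 = 0"
    using E by (simp add: has_integral_0_eq)
  from l2_norm_le_reduced[OF E(1,2) r(1) this]
  have "l2_norm I01 e \<le> l2_norm I01 (\<lambda>t. e'' t - of_real \<mu> * e t)"
    by (simp add: r)
  also have "\<dots> = 0"
  proof -
    have "(LINT t|I01. (cmod (e'' t - of_real \<mu> * e t))\<^sup>2) = (LINT t|I01. 0)"
      by (intro Bochner_Integration.integral_cong refl) (auto simp: eq l)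
    then show ?thesis by (simp add: l2_norm_def)
  qed
  finally have "l2_norm I01 e = 0"
    using l2_norm_nonneg[of I01 e] by simp
  then show False
    using e by (simp add: interval_eigenfunction_def)
qed

lemma l2_norm_orthonormal_combination:
  assumes e: "orthonormal_family M e" and "i \<noteq> j"
  shows "(l2_norm M (\<lambda>x. a * e i x + b * e j x))\<^sup>2 = (cmod a)\<^sup>2 + (cmod b)\<^sup>2"
proof -
  have L: "e i \<in> L2 M" "e j \<in> L2 M" and o: "l2_inner M (e i) (e j) = 0"
    using e \<open>i \<noteq> j\<close> by (auto simp: orthonormal_family_def)
  show ?thesis
    using L by (simp add: l2_norm_add_power2 L2_cmult l2_norm_cmult orthonormal_norm[OF e]
        l2_inner_cmult_left l2_inner_cmult_right o)
qed

text \<open>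
  The estimate \<open>l2_norm_le_reduced\<close> is available on a subspace of codimension one, and this subspace
  meets the span of two eigenfunctions. For \<open>w = a v\<^sub>i + b v\<^sub>j\<close> in it, \<open>w'' - \<mu> w\<close> is the reflection of
  \<open>a l\<^sub>i v\<^sub>i + b l\<^sub>j v\<^sub>j\<close>, whose norm is at most \<open>\<bar>l\<^sub>j\<bar> \<parallel>w\<parallel>\<close>.
\<close>

lemma second_eigenvalue_ge_1:
  assumes v: "orthonormal_family I01 v" and "i \<noteq> j"
    and ei: "interval_eigenfunction \<mu> li (v i)" and ej: "interval_eigenfunction \<mu> lj (v j)"
    and le: "cmod li \<le> cmod lj" and mu: "\<mu> \<ge> 0"
  shows "1 \<le> cmod lj"
proof -
  obtain e' e'' where E: "C2_01 (v i) e' e''" "v i 0 = 0" "e' 0 = 0"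
    and eq: "\<And>t. t \<in> {0..1} \<Longrightarrow> e'' t = of_real \<mu> * v i t + li * v i (1 - t)"
    using ei by (rule interval_eigenfunction_C2) blast
  obtain d' d'' where D: "C2_01 (v j) d' d''" "v j 0 = 0" "d' 0 = 0"
    and dq: "\<And>t. t \<in> {0..1} \<Longrightarrow> d'' t = of_real \<mu> * v j t + lj * v j (1 - t)"
    using ej by (rule interval_eigenfunction_C2) blast
  define r where "r = sqrt \<mu>"
  have r: "r \<ge> 0" "r\<^sup>2 = \<mu>" using mu by (auto simp: r_def)
  \<comment> \<open>the values of the functional \<open>w \<mapsto> w'(1) + r w(1)\<close>, exchanged crosswise, are the coefficients\<close>
  obtain a b where ab: "a \<noteq> 0 \<or> b \<noteq> 0"
    and l0: "a * (e' 1 + of_real r * v i 1) + b * (d' 1 + of_real r * v j 1) = 0"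
  proof (cases "d' 1 + of_real r * v j 1 = 0")
    case True
    then show ?thesis using that[of 0 1] by simp
  next
    case False
    then show ?thesis
      using that[of "d' 1 + of_real r * v j 1" "- (e' 1 + of_real r * v i 1)"] by (simp add: algebra_simps)
  qed
  define w where "w t = a * v i t + b * v j t" for t
  define w2 where "w2 t = a * e'' t + b * d'' t" for t
  define g where "g t = (a * li) * v i t + (b * lj) * v j t" for t
  have "C2_01 w (\<lambda>t. a * e' t + b * d' t) w2"
    unfolding w_def[abs_def] w2_def[abs_def] by (rule C2_01_lincomb[OF E(1) D(1)])
  then have "l2_norm I01 w \<le> l2_norm I01 (\<lambda>t. w2 t - of_real (r\<^sup>2) * w t)"
    by (rule l2_norm_le_reduced) (use E D r l0 in \<open>auto simp: w_def algebra_simps\<close>)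
  also have "\<dots> = l2_norm I01 (\<lambda>t. g (1 - t))"
    unfolding l2_norm_def
    by (intro arg_cong[where f=sqrt] Bochner_Integration.integral_cong refl)
       (auto simp: w2_def w_def g_def eq dq r algebra_simps)
  also have "\<dots> = l2_norm I01 g"
  proof (rule l2_norm_reflect_I01)
    show "g \<in> L2 I01"
      unfolding g_def[abs_def] using v by (auto simp: orthonormal_family_def intro!: L2_add L2_cmult)
  qed
  finally have "(l2_norm I01 w)\<^sup>2 \<le> (l2_norm I01 g)\<^sup>2"
    by (intro power_mono l2_norm_nonneg)
  then have "(cmod a)\<^sup>2 + (cmod b)\<^sup>2 \<le> (cmod (a * li))\<^sup>2 + (cmod (b * lj))\<^sup>2"
    unfolding w_def[abs_def] g_def[abs_def] l2_norm_orthonormal_combination[OF v \<open>i \<noteq> j\<close>] .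
  also have "\<dots> \<le> (cmod a * cmod lj)\<^sup>2 + (cmod b * cmod lj)\<^sup>2"
    using le by (auto simp: norm_mult intro!: power_mono mult_left_mono)
  also have "\<dots> = ((cmod a)\<^sup>2 + (cmod b)\<^sup>2) * (cmod lj)\<^sup>2"
    by (simp add: power_mult_distrib algebra_simps)
  finally have "1 * ((cmod a)\<^sup>2 + (cmod b)\<^sup>2) \<le> (cmod lj)\<^sup>2 * ((cmod a)\<^sup>2 + (cmod b)\<^sup>2)"
    by (simp add: mult.commute)
  moreover have "(cmod a)\<^sup>2 + (cmod b)\<^sup>2 > 0"
    using ab by (auto simp: sum_power2_gt_zero_iff)
  ultimately have "1 \<le> (cmod lj)\<^sup>2"
    by (rule mult_right_le_imp_le)
  then have "1\<^sup>2 \<le> (cmod lj)\<^sup>2"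
    by simp
  then show ?thesis
    by (rule power2_le_imp_le) simp
qed

section \<open>Twice differentiable functions on the cylinder\<close>

lemma C_ext_lincomb:
  fixes f g :: "'a::euclidean_space \<Rightarrow> complex"
  assumes "C_ext k U K f" "C_ext k U K g"
  shows "C_ext k U K (\<lambda>x. a * f x + b * g x)"
  using assms
proof (induction k arbitrary: f g)
  case 0
  then show ?case by (auto intro!: continuous_intros)
next
  case (Suc k)
  from Suc.prems(1) obtain F where F: "continuous_on K f"
      "\<And>x. x \<in> U \<Longrightarrow> (f has_derivative (\<lambda>h. \<Sum>b\<in>Basis. (h \<bullet> b) *\<^sub>R F b x)) (at x)"
      "\<And>b. b \<in> Basis \<Longrightarrow> C_ext k U K (F b)"
    by auto
  from Suc.prems(2) obtain G where G: "continuous_on K g"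
      "\<And>x. x \<in> U \<Longrightarrow> (g has_derivative (\<lambda>h. \<Sum>b\<in>Basis. (h \<bullet> b) *\<^sub>R G b x)) (at x)"
      "\<And>b. b \<in> Basis \<Longrightarrow> C_ext k U K (G b)"
    by auto
  have "((\<lambda>x. a * f x + b * g x) has_derivative (\<lambda>h. \<Sum>c\<in>Basis. (h \<bullet> c) *\<^sub>R (a * F c x + b * G c x))) (at x)"
    if "x \<in> U" for x
  proof -
    have "((\<lambda>x. a * f x + b * g x) has_derivative
       (\<lambda>h. a * (\<Sum>c\<in>Basis. (h \<bullet> c) *\<^sub>R F c x) + b * (\<Sum>c\<in>Basis. (h \<bullet> c) *\<^sub>R G c x))) (at x)"
      by (intro has_derivative_add has_derivative_mult_right F(2) G(2) that)
    then show ?thesis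
      by (simp add: sum_distrib_left scaleR_right_distrib sum.distrib)
  qed
  moreover have "C_ext k U K (\<lambda>x. a * F c x + b * G c x)" if "c \<in> Basis" for c
    by (rule Suc.IH[OF F(3)[OF that] G(3)[OF that]])
  ultimately show ?case
    using F(1) G(1) by (auto intro!: continuous_intros exI[of _ "\<lambda>c x. a * F c x + b * G c x"])
qed

lemma has_vector_derivative_slice:
  fixes w :: "'a::euclidean_space \<times> real \<Rightarrow> complex"
  assumes "(w has_derivative (\<lambda>h. \<Sum>b\<in>Basis. (h \<bullet> b) *\<^sub>R G b)) (at (x, t))"
  shows "((\<lambda>s. w (x, s)) has_vector_derivative G (0, 1)) (at t)"
proof -
  have "((\<lambda>s. (x, s)) has_derivative (\<lambda>s. (0, s))) (at t)"
    by (auto intro!: derivative_eq_intros)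
  from diff_chain_at[OF this assms]
  have "((\<lambda>s. w (x, s)) has_derivative (\<lambda>h. \<Sum>b\<in>Basis. (((0::'a), h) \<bullet> b) *\<^sub>R G b)) (at t)"
    by (simp add: o_def)
  moreover have "(\<Sum>b\<in>Basis. (((0::'a), h) \<bullet> b) *\<^sub>R G b) = h *\<^sub>R G (0, 1)" for h
  proof -
    have e: "((0::'a), 1::real) \<in> Basis"
      by (simp add: Basis_prod_def)
    have "(\<Sum>b\<in>Basis. (((0::'a), h) \<bullet> b) *\<^sub>R G b) = (\<Sum>b\<in>Basis. if b = (0, 1) then h *\<^sub>R G b else 0)"
    proof (rule sum.cong)
      fix b :: "'a \<times> real" assume b: "b \<in> Basis"
      have "((0::'a), h) = h *\<^sub>R (0, 1)" by simp
      then have "(((0::'a), h) \<bullet> b) = h * ((0, 1) \<bullet> b)"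
        by (metis inner_scaleR_left)
      then show "(((0::'a), h) \<bullet> b) *\<^sub>R G b = (if b = (0, 1) then h *\<^sub>R G b else 0)"
        using inner_Basis[OF e b] by auto
    qed simp
    also have "\<dots> = h *\<^sub>R G (0, 1)"
      using e by simp
    finally show ?thesis .
  qed
  ultimately show ?thesis
    by (simp add: has_vector_derivative_def)
qed

lemma closure_cylinder:
  fixes \<Omega> :: "'a::euclidean_space set"
  shows "closure (cylinder \<Omega>) = closure \<Omega> \<times> {0..1}"
  by (simp add: closure_Times)

text \<open>
  Derivatives enter the problem only through time, so the partial derivatives in the
  direction \<open>(0, 1)\<close> are all that is extracted.
\<close>

lemma C_ext_2_slices:
  fixes w :: "'a::euclidean_space \<times> real \<Rightarrow> complex"
  assumes "C_ext 2 (cylinder \<Omega>) (closure (cylinder \<Omega>)) w"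
  obtains W1 W2 where "continuous_on (closure (cylinder \<Omega>)) w" "continuous_on (closure (cylinder \<Omega>)) W2"
    "\<And>x. x \<in> \<Omega> \<Longrightarrow> C2_01 (\<lambda>t. w (x, t)) (\<lambda>t. W1 (x, t)) (\<lambda>t. W2 (x, t))"
proof -
  let ?K = "closure (cylinder \<Omega>)"
  have e: "((0::'a), 1::real) \<in> Basis"
    by (simp add: Basis_prod_def)
  have "C_ext (Suc (Suc 0)) (cylinder \<Omega>) ?K w"
    using assms by (simp only: numeral_2_eq_2)
  then obtain G where cw: "continuous_on ?K w"
    and G: "\<forall>p\<in>cylinder \<Omega>. (w has_derivative (\<lambda>h. \<Sum>b\<in>Basis. (h \<bullet> b) *\<^sub>R G b p)) (at p)"
    and C1: "C_ext (Suc 0) (cylinder \<Omega>) ?K (G (0, 1))"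
    unfolding C_ext.simps(2)[of "Suc 0"] using e by blast
  from C1 obtain G2 where cW1: "continuous_on ?K (G (0, 1))"
    and G2: "\<forall>p\<in>cylinder \<Omega>. (G (0, 1) has_derivative (\<lambda>h. \<Sum>b\<in>Basis. (h \<bullet> b) *\<^sub>R G2 b p)) (at p)"
    and cW2: "continuous_on ?K (G2 (0, 1))"
    unfolding C_ext.simps using e by blast
  have "C2_01 (\<lambda>t. w (x, t)) (\<lambda>t. G (0, 1) (x, t)) (\<lambda>t. G2 (0, 1) (x, t))" if x: "x \<in> \<Omega>" for x
  proof -
    have slice: "continuous_on {0..1} (\<lambda>t. f (x, t))" if "continuous_on ?K f" for f :: "'a \<times> real \<Rightarrow> complex"
      using x closure_subset[of \<Omega>]
      by (intro continuous_on_compose2[OF that]) (auto simp: closure_cylinder intro!: continuous_intros)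
    have d1: "((\<lambda>s. w (x, s)) has_vector_derivative G (0, 1) (x, t)) (at t)" if "t \<in> {0<..<1}" for t
      using G x that by (intro has_vector_derivative_slice[of w "\<lambda>b. G b (x, t)"]) auto
    have d2: "((\<lambda>s. G (0, 1) (x, s)) has_vector_derivative G2 (0, 1) (x, t)) (at t)" if "t \<in> {0<..<1}" for t
      using G2 x that by (intro has_vector_derivative_slice[of "G (0, 1)" "\<lambda>b. G2 b (x, t)"]) auto
    show ?thesis
      unfolding C2_01_def
      using has_vector_derivative_closed_interval[OF slice[OF cw] slice[OF cW1] d1]
        has_vector_derivative_closed_interval[OF slice[OF cW1] slice[OF cW2] d2] slice[OF cW2]
      by auto
  qed
  with cw cW2 show ?thesis by (rule that)
qed

lemma dt_C2:
  assumes "C2_01 (\<lambda>t. w (x, t)) w1 w2" "t \<in> {0..1}"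
  shows "dt w (x, t) = w1 t" "dt (dt w) (x, t) = w2 t"
  using C2_01_deriv01[OF assms] by (simp_all add: dt_def)

section \<open>Strong solutions form a closed linear relation\<close>

lemma l2_operatorD:
  assumes "l2_operator M Dom A" "u \<in> Dom"
  shows "u \<in> L2 M" "A u \<in> L2 M" "(\<lambda>x. c * u x) \<in> Dom" "AE x in M. A (\<lambda>y. c * u y) x = c * A u x"
    and "v \<in> Dom \<Longrightarrow> (\<lambda>x. u x + v x) \<in> Dom"
    and "v \<in> Dom \<Longrightarrow> AE x in M. A (\<lambda>y. u y + v y) x = A u x + A v x"
  using assms unfolding l2_operator_def by auto

lemma admissible_lincomb:
  assumes op: "l2_operator M Dom A"
    and w: "admissible \<Omega> Dom w" and z: "admissible \<Omega> Dom z"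
  shows "admissible \<Omega> Dom (\<lambda>p. a * w p + b * z p)"
proof -
  from w obtain W1 W2 where W: "\<And>x. x \<in> \<Omega> \<Longrightarrow> C2_01 (\<lambda>t. w (x, t)) (\<lambda>t. W1 (x, t)) (\<lambda>t. W2 (x, t))"
    unfolding admissible_def by (metis C_ext_2_slices)
  from z obtain Z1 Z2 where Z: "\<And>x. x \<in> \<Omega> \<Longrightarrow> C2_01 (\<lambda>t. z (x, t)) (\<lambda>t. Z1 (x, t)) (\<lambda>t. Z2 (x, t))"
    unfolding admissible_def by (metis C_ext_2_slices)
  have "dt (\<lambda>p. a * w p + b * z p) (x, 0) = 0" if "x \<in> \<Omega>" for x
    using w z that dt_C2(1)[OF W[OF that], of 0] dt_C2(1)[OF Z[OF that], of 0]
      dt_C2(1)[of "\<lambda>p. a * w p + b * z p", OF C2_01_lincomb[OF W[OF that] Z[OF that]], of 0]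
    by (auto simp: admissible_def)
  moreover have "(\<lambda>x. a * w (x, t) + b * z (x, t)) \<in> Dom" if "t \<in> {0<..<1}" for t
    using w z that by (intro l2_operatorD(5)[OF op] l2_operatorD(3)[OF op]) (auto simp: admissible_def)
  ultimately show ?thesis
    using w z by (auto simp: admissible_def intro!: C_ext_lincomb)
qed

lemma represents_LL_lincomb:
  assumes op: "l2_operator (lebesgue_on \<Omega>) Dom A"
    and w: "admissible \<Omega> Dom w" "represents_LL \<Omega> A w g"
    and z: "admissible \<Omega> Dom z" "represents_LL \<Omega> A z h"
  shows "represents_LL \<Omega> A (\<lambda>p. a * w p + b * z p) (\<lambda>p. a * g p + b * h p)"
proof -
  from w obtain W1 W2 where W: "\<And>x. x \<in> \<Omega> \<Longrightarrow> C2_01 (\<lambda>t. w (x, t)) (\<lambda>t. W1 (x, t)) (\<lambda>t. W2 (x, t))"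
    unfolding admissible_def by (metis C_ext_2_slices)
  from z obtain Z1 Z2 where Z: "\<And>x. x \<in> \<Omega> \<Longrightarrow> C2_01 (\<lambda>t. z (x, t)) (\<lambda>t. Z1 (x, t)) (\<lambda>t. Z2 (x, t))"
    unfolding admissible_def by (metis C_ext_2_slices)
  have dd: "dt (dt (\<lambda>p. a * w p + b * z p)) (x, t) = a * dt (dt w) (x, t) + b * dt (dt z) (x, t)"
    if "x \<in> \<Omega>" "t \<in> {0<..<1}" for x t
    using that dt_C2(2)[OF W[OF that(1)], of t] dt_C2(2)[OF Z[OF that(1)], of t]
      dt_C2(2)[of "\<lambda>p. a * w p + b * z p", OF C2_01_lincomb[OF W[OF that(1)] Z[OF that(1)]], of t]
    by simp
  have "AE t in lebesgue_on {0<..<1::real}. t \<in> {0<..<1}"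
    using AE_space[of "lebesgue_on {0<..<1::real}"] by simp
  with w(2) z(2) show ?thesis
    unfolding represents_LL_def
  proof eventually_elim
    case (elim t)
    note t = elim(3)
    let ?w = "\<lambda>y. w (y, t)" and ?z = "\<lambda>y. z (y, t)"
    have D: "?w \<in> Dom" "?z \<in> Dom"
      using w(1) z(1) elim(3) by (auto simp: admissible_def)
    then have D': "(\<lambda>y. a * ?w y) \<in> Dom" "(\<lambda>y. b * ?z y) \<in> Dom"
      by (auto intro: l2_operatorD(3)[OF op])
    have "AE x in lebesgue_on \<Omega>. A (\<lambda>y. a * ?w y) x = a * A ?w x"
      "AE x in lebesgue_on \<Omega>. A (\<lambda>y. b * ?z y) x = b * A ?z x"
      "AE x in lebesgue_on \<Omega>. A (\<lambda>y. a * ?w y + b * ?z y) x = A (\<lambda>y. a * ?w y) x + A (\<lambda>y. b * ?z y) x"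
      by (rule l2_operatorD(4)[OF op D(1)] l2_operatorD(4)[OF op D(2)] l2_operatorD(6)[OF op D'])+
    moreover have "AE x in lebesgue_on \<Omega>. x \<in> \<Omega>"
      using AE_space[of "lebesgue_on \<Omega>"] by simp
    ultimately show ?case
      using elim(1,2)
    proof eventually_elim
      case (elim x)
      show ?case
        unfolding elim(3,5,6) dd[OF elim(4) t] elim(1,2) by (simp add: algebra_simps)
    qed
  qed
qed

lemma strong_solution_L2:
  assumes "strong_solution \<Omega> Dom A f u"
  shows "f \<in> L2 (lebesgue_on (cylinder \<Omega>))" "u \<in> L2 (lebesgue_on (cylinder \<Omega>))"
  using assms by (auto simp: strong_solution_def l2_tendsto_def)

lemma strong_solution_lincomb:
  assumes op: "l2_operator (lebesgue_on \<Omega>) Dom A"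
    and u: "strong_solution \<Omega> Dom A f u" and u': "strong_solution \<Omega> Dom A f' u'"
  shows "strong_solution \<Omega> Dom A (\<lambda>p. a * f p + b * f' p) (\<lambda>p. a * u p + b * u' p)"
proof -
  from u obtain w g where w: "\<And>n. admissible \<Omega> Dom (w n)" "\<And>n. represents_LL \<Omega> A (w n) (g n)"
     "l2_tendsto (lebesgue_on (cylinder \<Omega>)) w u" "l2_tendsto (lebesgue_on (cylinder \<Omega>)) g f"
    unfolding strong_solution_def by blast
  from u' obtain w' g' where w': "\<And>n. admissible \<Omega> Dom (w' n)" "\<And>n. represents_LL \<Omega> A (w' n) (g' n)"
     "l2_tendsto (lebesgue_on (cylinder \<Omega>)) w' u'" "l2_tendsto (lebesgue_on (cylinder \<Omega>)) g' f'"
    unfolding strong_solution_def by blast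
  show ?thesis
    unfolding strong_solution_def
    by (intro exI[of _ "\<lambda>n p. a * w n p + b * w' n p"] exI[of _ "\<lambda>n p. a * g n p + b * g' n p"] conjI allI
        admissible_lincomb[OF op] represents_LL_lincomb[OF op] l2_tendsto_add l2_tendsto_cmult w w')
qed

text \<open>
  A diagonal argument: the pair \<open>(u\<^sub>j, f\<^sub>j)\<close> is replaced by an admissible function and its image,
  each at distance less than \<open>1 / (j + 1)\<close>.
\<close>

lemma strong_solution_closed:
  assumes s: "\<And>j. strong_solution \<Omega> Dom A (f j) (u j)"
    and u: "l2_tendsto (lebesgue_on (cylinder \<Omega>)) u u0" and f: "l2_tendsto (lebesgue_on (cylinder \<Omega>)) f f0"
  shows "strong_solution \<Omega> Dom A f0 u0"
proof -
  let ?N = "lebesgue_on (cylinder \<Omega>)"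
  define close where "close j w g \<longleftrightarrow> admissible \<Omega> Dom w \<and> represents_LL \<Omega> A w g \<and> w \<in> L2 ?N \<and> g \<in> L2 ?N \<and>
      l2_norm ?N (\<lambda>p. w p - u j p) < inverse (real (Suc j)) \<and> l2_norm ?N (\<lambda>p. g p - f j p) < inverse (real (Suc j))"
    for j w g
  have "\<exists>w g. close j w g" for j
  proof -
    from s[of j] obtain w g where w: "\<And>n. admissible \<Omega> Dom (w n)" "\<And>n. represents_LL \<Omega> A (w n) (g n)"
       "l2_tendsto ?N w (u j)" "l2_tendsto ?N g (f j)"
      unfolding strong_solution_def by blast
    have "\<forall>\<^sub>F n in sequentially. l2_norm ?N (\<lambda>p. w n p - u j p) < inverse (real (Suc j))"
      "\<forall>\<^sub>F n in sequentially. l2_norm ?N (\<lambda>p. g n p - f j p) < inverse (real (Suc j))"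
      using l2_tendstoD(3)[OF w(3)] l2_tendstoD(3)[OF w(4)] by (auto intro: order_tendstoD)
    then have "\<forall>\<^sub>F n in sequentially. l2_norm ?N (\<lambda>p. w n p - u j p) < inverse (real (Suc j)) \<and>
        l2_norm ?N (\<lambda>p. g n p - f j p) < inverse (real (Suc j))"
      by eventually_elim simp
    then obtain n where n: "l2_norm ?N (\<lambda>p. w n p - u j p) < inverse (real (Suc j))"
      "l2_norm ?N (\<lambda>p. g n p - f j p) < inverse (real (Suc j))"
      by (auto dest: eventually_happens)
    have "close j (w n) (g n)"
      unfolding close_def
      by (intro conjI w(1,2) l2_tendstoD(1)[OF w(3)] l2_tendstoD(1)[OF w(4)] n)
    then show ?thesis by blast
  qed
  then obtain w g where "\<And>j. close j (w j) (g j)"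
    by metis
  then have w: "\<And>j. admissible \<Omega> Dom (w j)" "\<And>j. represents_LL \<Omega> A (w j) (g j)"
    "\<And>j. w j \<in> L2 ?N" "\<And>j. g j \<in> L2 ?N"
    and lt: "\<And>j. l2_norm ?N (\<lambda>p. w j p - u j p) < inverse (real (Suc j))"
      "\<And>j. l2_norm ?N (\<lambda>p. g j p - f j p) < inverse (real (Suc j))"
    unfolding close_def by auto
  have conv: "l2_tendsto ?N y z0" if y: "\<And>j. y j \<in> L2 ?N" and z: "l2_tendsto ?N z z0"
      and le: "\<And>j. l2_norm ?N (\<lambda>p. y j p - z j p) < inverse (real (Suc j))" for y z z0
  proof (rule l2_tendstoI_bound)
    show "l2_norm ?N (\<lambda>p. y j p - z0 p) \<le> inverse (real (Suc j)) + l2_norm ?N (\<lambda>p. z j p - z0 p)" for j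
      using l2_norm_triangle_diff[OF y l2_tendstoD(1)[OF z] l2_tendstoD(2)[OF z], of j j] le[of j] by simp
    show "(\<lambda>j. inverse (real (Suc j)) + l2_norm ?N (\<lambda>p. z j p - z0 p)) \<longlonglongrightarrow> 0"
      using tendsto_add[OF LIMSEQ_inverse_real_of_nat l2_tendstoD(3)[OF z]] by simp
  qed (use y l2_tendstoD[OF z] in auto)
  show ?thesis
    unfolding strong_solution_def
    by (intro exI[of _ w] exI[of _ g] conjI allI w(1,2) conv[OF w(3) u lt(1)] conv[OF w(4) f lt(2)])
qed

lemma strong_solution_sum:
  assumes op: "l2_operator (lebesgue_on \<Omega>) Dom A"
    and s: "\<And>k. strong_solution \<Omega> Dom A (f k) (u k)"
  shows "strong_solution \<Omega> Dom A (\<lambda>p. \<Sum>k<n. f k p) (\<lambda>p. \<Sum>k<(n::nat). u k p)"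
proof (induction n)
  case 0
  show ?case using strong_solution_lincomb[OF op s[of 0] s[of 0], of 0 0] by simp
next
  case (Suc n)
  show ?case using strong_solution_lincomb[OF op Suc s[of n], of 1 1] by simp
qed

lemma strong_solution_sums:
  assumes op: "l2_operator (lebesgue_on \<Omega>) Dom A"
    and s: "\<And>k. strong_solution \<Omega> Dom A (f k) (u k)"
    and "l2_sums (lebesgue_on (cylinder \<Omega>)) u u0" "l2_sums (lebesgue_on (cylinder \<Omega>)) f f0"
  shows "strong_solution \<Omega> Dom A f0 u0"
  using strong_solution_closed[OF strong_solution_sum[OF op s] assms(3)[unfolded l2_sums_def]
      assms(4)[unfolded l2_sums_def]] .

lemma strong_solution_cong_AE:
  assumes s: "strong_solution \<Omega> Dom A f u"
    and "AE p in lebesgue_on (cylinder \<Omega>). f p = f' p" "f' \<in> L2 (lebesgue_on (cylinder \<Omega>))"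
  shows "strong_solution \<Omega> Dom A f' u"
proof -
  from s obtain w g where w: "\<And>n. admissible \<Omega> Dom (w n)" "\<And>n. represents_LL \<Omega> A (w n) (g n)"
     "l2_tendsto (lebesgue_on (cylinder \<Omega>)) w u" "l2_tendsto (lebesgue_on (cylinder \<Omega>)) g f"
    unfolding strong_solution_def by blast
  show ?thesis
    unfolding strong_solution_def
    by (intro exI[of _ w] exI[of _ g] conjI allI w(1-3) l2_tendsto_cong_AE[OF w(4) assms(2,3)])
qed

section \<open>Double orthogonal expansions\<close>

text \<open>
  An orthogonal series over part of an orthonormal family. The map \<open>idx\<close> selects a row or a column of
  a doubly indexed family.
\<close>

lemma orthonormal_subseries:
  fixes e :: "'i \<Rightarrow> 'a \<Rightarrow> complex"
  assumes e: "orthonormal_family M e" and idx: "inj (idx :: nat \<Rightarrow> 'i)" and c: "summable (\<lambda>n. (cmod (c n))\<^sup>2)"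
  shows "\<exists>s. l2_sums M (\<lambda>n x. c n * e (idx n) x) s \<and>
    (\<forall>n. l2_inner M s (e (idx n)) = c n) \<and> (\<forall>j. j \<notin> range idx \<longrightarrow> l2_inner M s (e j) = 0) \<and>
    (\<lambda>n. (cmod (c n))\<^sup>2) sums (l2_norm M s)\<^sup>2"
proof -
  have eL: "e i \<in> L2 M" and ee: "l2_inner M (e i) (e j) = (if i = j then 1 else 0)" for i j
    using e by (auto simp: orthonormal_family_def)
  let ?F = "\<lambda>n x. c n * e (idx n) x"
  have F: "?F n \<in> L2 M" for n
    by (intro L2_cmult eL)
  have norm: "l2_norm M (?F n) = cmod (c n)" for n
    by (simp add: l2_norm_cmult orthonormal_norm[OF e])
  have inner: "l2_inner M (?F n) (e j) = (if idx n = j then c n else 0)" for n j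
    by (simp add: l2_inner_cmult_left ee)
  have orth: "l2_inner M (?F i) (?F j) = 0" if "i \<noteq> j" for i j
    using inj_eq[OF idx, of i j] that by (simp add: l2_inner_cmult_left l2_inner_cmult_right ee)
  obtain s where s: "l2_sums M ?F s"
    using l2_sums_orthogonal[of ?F M, OF F orth] c by (auto simp: norm)
  have si: "(\<lambda>n. if idx n = j then c n else 0) sums l2_inner M s (e j)" for j
    using l2_sums_inner[OF s F eL[of j]] by (simp add: inner)
  show ?thesis
  proof (intro exI[of _ s] conjI allI impI s)
    fix n
    have "(\<lambda>k. if idx k = idx n then c k else 0) = (\<lambda>k. if k = n then c n else 0)"
      using injD[OF idx] by auto
    with si[of "idx n"] have "(\<lambda>k. if k = n then c n else 0) sums l2_inner M s (e (idx n))"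
      by simp
    then show "l2_inner M s (e (idx n)) = c n"
      using sums_single[of n "\<lambda>_. c n"] sums_unique2 by blast
  next
    fix j assume "j \<notin> range idx"
    then have "(\<lambda>n. if idx n = j then c n else 0) = (\<lambda>n. 0)"
      by (auto simp: fun_eq_iff)
    with si[of j] have "(\<lambda>n. 0) sums l2_inner M s (e j)" by simp
    then show "l2_inner M s (e j) = 0"
      using sums_zero sums_unique2 by blast
  next
    show "(\<lambda>n. (cmod (c n))\<^sup>2) sums (l2_norm M s)\<^sup>2"
      using l2_sums_norm2[OF s F orth] by (simp add: norm)
  qed
qed

text \<open>
  The column \<open>m = 0\<close> is summed by itself and the rest row by row. Different rows \<open>r\<^sub>k\<close> are orthogonal
  and \<open>\<parallel>r\<^sub>k\<parallel>\<^sup>2\<close> is the sum of the \<open>\<bar>c\<^sub>k\<^sub>m\<bar>\<^sup>2\<close> in the row, so the bound on finite rectangles carries over to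
  the series of the rows.
\<close>

lemma double_orthonormal_expansion:
  fixes u :: "nat \<Rightarrow> nat \<Rightarrow> 'a \<Rightarrow> complex"
  assumes u: "orthonormal_family M (\<lambda>(k, m). u k m)"
    and B: "\<And>K L. (\<Sum>k<K. \<Sum>m<L. (cmod (c k m))\<^sup>2) \<le> B"
  shows "\<exists>s1 r s2. l2_sums M (\<lambda>k x. c k 0 * u k 0 x) s1 \<and>
    (\<forall>k. l2_sums M (\<lambda>m x. c k (Suc m) * u k (Suc m) x) (r k)) \<and> l2_sums M r s2 \<and>
    (\<forall>k m. l2_inner M (\<lambda>x. s1 x + s2 x) (u k m) = c k m)"
proof -
  define e where "e = (\<lambda>(k, m). u k m)"
  have e: "orthonormal_family M e"
    using u by (simp add: e_def)
  have u_eq: "u k m = e (k, m)" for k m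
    by (simp add: e_def)
  have eL: "e i \<in> L2 M" for i
    using e unfolding orthonormal_family_def by blast
  have rect: "(\<Sum>k<K. (cmod (c k 0))\<^sup>2 + (\<Sum>m<L. (cmod (c k (Suc m)))\<^sup>2)) \<le> B" for K L
  proof -
    have "(\<Sum>m<Suc L. (cmod (c k m))\<^sup>2) = (cmod (c k 0))\<^sup>2 + (\<Sum>m<L. (cmod (c k (Suc m)))\<^sup>2)" for k
      by (rule sum.lessThan_Suc_shift)
    then show ?thesis using B[where K=K and L="Suc L"] by simp
  qed
  have summ0: "summable (\<lambda>k. (cmod (c k 0))\<^sup>2)"
    using rect[where L=0] by (intro summableI_nonneg_bounded[of _ B]) auto
  have inj: "inj (\<lambda>k::nat. (k, 0::nat))" "inj (\<lambda>m. (k::nat, Suc m))" for k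
    by (auto intro: injI)
  obtain s1 where s1: "l2_sums M (\<lambda>k x. c k 0 * e (k, 0) x) s1"
    and s1_inner: "\<And>k. l2_inner M s1 (e (k, 0)) = c k 0"
      "\<And>j. j \<notin> range (\<lambda>k. (k, 0)) \<Longrightarrow> l2_inner M s1 (e j) = 0"
    using orthonormal_subseries[OF e inj(1) summ0] by blast
  have summ: "summable (\<lambda>m. (cmod (c k (Suc m)))\<^sup>2)" for k
  proof (rule summableI_nonneg_bounded[of _ B])
    fix L
    have "(\<Sum>m<L. (cmod (c k (Suc m)))\<^sup>2) \<le> (\<Sum>k<Suc k. (cmod (c k 0))\<^sup>2 + (\<Sum>m<L. (cmod (c k (Suc m)))\<^sup>2))"
      by (auto intro!: add_nonneg_nonneg sum_nonneg simp: add_increasing)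
    then show "(\<Sum>m<L. (cmod (c k (Suc m)))\<^sup>2) \<le> B"
      using rect[where K="Suc k" and L=L] by linarith
  qed simp
  define tail where "tail k s \<longleftrightarrow> l2_sums M (\<lambda>m x. c k (Suc m) * e (k, Suc m) x) s \<and>
      (\<forall>m. l2_inner M s (e (k, Suc m)) = c k (Suc m)) \<and>
      (\<forall>j. j \<notin> range (\<lambda>m. (k, Suc m)) \<longrightarrow> l2_inner M s (e j) = 0) \<and>
      (\<lambda>m. (cmod (c k (Suc m)))\<^sup>2) sums (l2_norm M s)\<^sup>2" for k s
  have "\<exists>s. tail k s" for k
    unfolding tail_def by (rule orthonormal_subseries[OF e inj(2) summ])
  then obtain r where "\<And>k. tail k (r k)"
    by metis
  then have r: "\<And>k. l2_sums M (\<lambda>m x. c k (Suc m) * e (k, Suc m) x) (r k)"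
    and r_inner: "\<And>k m. l2_inner M (r k) (e (k, Suc m)) = c k (Suc m)"
      "\<And>k j. j \<notin> range (\<lambda>m. (k, Suc m)) \<Longrightarrow> l2_inner M (r k) (e j) = 0"
    and r_norm: "\<And>k. (\<lambda>m. (cmod (c k (Suc m)))\<^sup>2) sums (l2_norm M (r k))\<^sup>2"
    unfolding tail_def by blast+
  have rL: "r k \<in> L2 M" for k
    using r[of k] by (simp add: l2_sums_def l2_tendsto_def)
  have r_orth: "l2_inner M (r k) (r j) = 0" if "k \<noteq> j" for k j
  proof -
    have "l2_inner M (e (k, Suc m)) (r j) = 0" for m
      using r_inner(2)[of "(k, Suc m)" j] that by (subst l2_inner_commute) auto
    then have "(\<lambda>m. 0) sums l2_inner M (r k) (r j)"
      using l2_sums_inner[OF r[of k] L2_cmult[OF eL] rL[of j]] by (simp add: l2_inner_cmult_left)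
    then show ?thesis using sums_zero sums_unique2 by blast
  qed
  have "summable (\<lambda>k. (l2_norm M (r k))\<^sup>2)"
  proof (rule summableI_nonneg_bounded[of _ B])
    fix K
    have "(\<lambda>L. \<Sum>k<K. \<Sum>m<L. (cmod (c k (Suc m)))\<^sup>2) \<longlonglongrightarrow> (\<Sum>k<K. (l2_norm M (r k))\<^sup>2)"
      using r_norm by (intro tendsto_sum) (simp add: sums_def)
    moreover have "(\<Sum>k<K. \<Sum>m<L. (cmod (c k (Suc m)))\<^sup>2) \<le> B" for L
      by (rule order_trans[OF sum_mono rect[where K=K and L=L]]) simp
    ultimately show "(\<Sum>k<K. (l2_norm M (r k))\<^sup>2) \<le> B"
      by (intro LIMSEQ_le_const2) auto
  qed simp
  then obtain s2 where s2: "l2_sums M r s2"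
    using l2_sums_orthogonal[of r M, OF rL r_orth] by blast
  have sL: "s1 \<in> L2 M" "s2 \<in> L2 M"
    using s1 s2 by (simp_all add: l2_sums_def l2_tendsto_def)
  have s2i: "(\<lambda>k. l2_inner M (r k) (e j)) sums l2_inner M s2 (e j)" for j
    using l2_sums_inner[OF s2 rL eL] .
  have "l2_inner M (\<lambda>x. s1 x + s2 x) (e (k, m)) = c k m" for k m
  proof (cases m)
    case 0
    have "l2_inner M (r k') (e (k, 0)) = 0" for k'
      using r_inner(2)[of "(k, 0)" k'] by auto
    then have "l2_inner M s2 (e (k, 0)) = 0"
      using s2i[of "(k, 0)"] sums_zero sums_unique2 by (metis (no_types, lifting) sums_cong)
    then show ?thesis
      using 0 by (simp add: l2_inner_add_left sL eL s1_inner)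
  next
    case (Suc m')
    have "l2_inner M (r k') (e (k, Suc m')) = (if k' = k then c k (Suc m') else 0)" for k'
      using r_inner(1)[of k m'] r_inner(2)[of "(k, Suc m')" k'] by auto
    then have "(\<lambda>k'. if k' = k then c k (Suc m') else 0) sums l2_inner M s2 (e (k, Suc m'))"
      using s2i[of "(k, Suc m')"] by simp
    then have "l2_inner M s2 (e (k, Suc m')) = c k (Suc m')"
      using sums_single[of k "\<lambda>_. c k (Suc m')"] sums_unique2 by blast
    moreover have "l2_inner M s1 (e (k, Suc m')) = 0"
      by (rule s1_inner(2)) auto
    ultimately show ?thesis
      using Suc by (simp add: l2_inner_add_left sL eL)
  qed
  then show ?thesis
    unfolding u_eq using s1 r s2 by (intro exI[of _ s1] exI[of _ r] exI[of _ s2] conjI allI)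
qed

lemma Bessel_double:
  fixes u :: "nat \<Rightarrow> nat \<Rightarrow> 'a \<Rightarrow> complex"
  assumes "orthonormal_family M (\<lambda>(k, m). u k m)" "f \<in> L2 M"
  shows "(\<Sum>k<K. \<Sum>m<L. (cmod (l2_inner M f (u k m)))\<^sup>2) \<le> (l2_norm M f)\<^sup>2"
  using Bessel_inequality[OF assms, of "{..<K} \<times> {..<L}"]
  by (simp add: sum.cartesian_product case_prod_unfold)

section \<open>Product systems on the cylinder\<close>

text \<open>
  By the inequality of Cauchy and Schwarz in each slice, \<open>\<bar>(F(\<cdot>, t), a)\<bar>\<^sup>2 \<le> \<parallel>F(\<cdot>, t)\<parallel>\<^sup>2 \<parallel>a\<parallel>\<^sup>2\<close>, and the
  right-hand side is integrable in \<open>t\<close>.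
\<close>

lemma slice_inner_L2:
  fixes S :: "'a::euclidean_space set"
  assumes S: "open S" "bounded S" and F: "F \<in> L2 (lebesgue_on (cylinder S))" and a: "a \<in> L2 (lebesgue_on S)"
  shows "(\<lambda>t. l2_inner (lebesgue_on S) (\<lambda>x. F (x, t)) a) \<in> L2 I01"
proof -
  let ?M = "lebesgue_on S"
  have b: "S \<in> sets borel" "{0<..<1::real} \<in> sets borel" using S by auto
  have fin: "finite_measure (lebesgue_on (cylinder S))"
    using S by (intro finite_measure_lebesgue_on_open open_Times bounded_Times) auto
  have one: "(\<lambda>t. 1) \<in> L2 I01"
    by (intro continuous_L2_I01 continuous_intros)
  have "integrable I01 (\<lambda>t. LINT x|?M. F (x, t) * cnj (tensor a (\<lambda>t. 1) (x, t)))"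
    by (rule integrable_snd_on[OF b L2_integrable_mult[OF F tensor_L2[OF b a one]]])
  then have m: "(\<lambda>t. l2_inner ?M (\<lambda>x. F (x, t)) a) \<in> borel_measurable I01"
    by (simp add: l2_inner_def tensor_def borel_measurable_integrable)
  have "integrable I01 (\<lambda>t. (l2_norm ?M (\<lambda>x. F (x, t)))\<^sup>2 * (l2_norm ?M a)\<^sup>2)"
    using L2_slices(2)[OF b fin F] by simp
  then have "integrable I01 (\<lambda>t. (cmod (l2_inner ?M (\<lambda>x. F (x, t)) a))\<^sup>2)"
  proof (rule Bochner_Integration.integrable_bound)
    show "(\<lambda>t. (cmod (l2_inner ?M (\<lambda>x. F (x, t)) a))\<^sup>2) \<in> borel_measurable I01"
      using m by measurable
    show "AE t in I01. norm ((cmod (l2_inner ?M (\<lambda>x. F (x, t)) a))\<^sup>2)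
        \<le> norm ((l2_norm ?M (\<lambda>x. F (x, t)))\<^sup>2 * (l2_norm ?M a)\<^sup>2)"
      using L2_slices(1)[OF b fin F]
    proof eventually_elim
      case (elim t)
      have "(cmod (l2_inner ?M (\<lambda>x. F (x, t)) a))\<^sup>2 \<le> (l2_norm ?M (\<lambda>x. F (x, t)) * l2_norm ?M a)\<^sup>2"
        by (intro power_mono l2_Cauchy_Schwarz elim a) simp
      then show ?case by (simp add: power_mult_distrib)
    qed
  qed
  with m show ?thesis by (simp add: L2_def)
qed

lemma tensor_orthonormal:
  fixes S :: "'a::euclidean_space set" and \<phi> :: "'i \<Rightarrow> 'a \<Rightarrow> complex" and v :: "'i \<Rightarrow> 'j \<Rightarrow> real \<Rightarrow> complex"
  assumes S: "S \<in> sets borel" and \<phi>: "orthonormal_family (lebesgue_on S) \<phi>" and v: "\<And>k. orthonormal_family I01 (v k)"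
  shows "orthonormal_family (lebesgue_on (cylinder S)) (\<lambda>(k, m). tensor (\<phi> k) (v k m))"
proof -
  have b: "{0<..<1::real} \<in> sets borel" by auto
  have L: "\<phi> k \<in> L2 (lebesgue_on S)" "v k m \<in> L2 I01" for k m
    using \<phi> v by (auto simp: orthonormal_family_def)
  have "l2_inner (lebesgue_on (cylinder S)) (tensor (\<phi> k) (v k m)) (tensor (\<phi> k') (v k' m'))
     = (if k = k' \<and> m = m' then 1 else 0)" for k m k' m'
  proof -
    have "l2_inner (lebesgue_on S) (\<lambda>x. tensor (\<phi> k) (v k m) (x, t)) (\<phi> k') = (if k = k' then 1 else 0) * v k m t" for t
      using \<phi> l2_inner_cmult_left[of "lebesgue_on S" "v k m t" "\<phi> k" "\<phi> k'"]
      by (simp add: tensor_def orthonormal_family_def mult.commute)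
    then have "l2_inner (lebesgue_on (cylinder S)) (tensor (\<phi> k) (v k m)) (tensor (\<phi> k') (v k' m'))
       = (if k = k' then 1 else 0) * l2_inner I01 (v k m) (v k' m')"
      by (simp only: l2_inner_tensor(1)[OF S b tensor_L2[OF S b L] L] l2_inner_cmult_left)
    then show ?thesis
      using v[of k] by (cases "k = k'") (simp_all add: orthonormal_family_def)
  qed
  then show ?thesis
    using tensor_L2[OF S b L] by (auto simp: orthonormal_family_def)
qed

text \<open>
  For fixed \<open>k\<close>, the function \<open>t \<mapsto> (F(\<cdot>, t), \<phi>\<^sub>k)\<close> is orthogonal to the complete system \<open>v\<^sub>k\<close>, hence
  vanishes almost everywhere. As there are countably many \<open>k\<close>, almost every slice \<open>F(\<cdot>, t)\<close> is
  orthogonal to all \<open>\<phi>\<^sub>k\<close>, hence zero. The system \<open>v\<^sub>k\<close> may change with \<open>k\<close>.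
\<close>

lemma tensor_total:
  fixes S :: "'a::euclidean_space set" and \<phi> :: "nat \<Rightarrow> 'a \<Rightarrow> complex"
  assumes S: "open S" "bounded S"
    and \<phi>: "complete_orthonormal (lebesgue_on S) \<phi>" and v: "\<And>k. complete_orthonormal I01 (v k)"
    and F: "F \<in> L2 (lebesgue_on (cylinder S))"
    and orth: "\<And>k m. l2_inner (lebesgue_on (cylinder S)) F (tensor (\<phi> k) (v k m)) = 0"
  shows "AE p in lebesgue_on (cylinder S). F p = 0"
proof -
  let ?M = "lebesgue_on S"
  have b: "S \<in> sets borel" "{0<..<1::real} \<in> sets borel" using S by auto
  have fin: "finite_measure (lebesgue_on (cylinder S))"
    using S by (intro finite_measure_lebesgue_on_open open_Times bounded_Times) auto
  have L: "\<phi> k \<in> L2 ?M" "v k m \<in> L2 I01" for k m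
    using \<phi> v by (auto simp: complete_orthonormal_def)
  have "AE t in I01. l2_inner ?M (\<lambda>x. F (x, t)) (\<phi> k) = 0" for k
    using orth unfolding l2_inner_tensor(1)[OF b F L]
    by (rule complete_orthonormal_total[OF v slice_inner_L2[OF S F L(1)]])
  then have "AE t in I01. \<forall>k. l2_inner ?M (\<lambda>x. F (x, t)) (\<phi> k) = 0"
    by (simp add: AE_all_countable)
  with L2_slices(1)[OF b fin F] have "AE t in I01. (l2_norm ?M (\<lambda>x. F (x, t)))\<^sup>2 = 0"
  proof eventually_elim
    case (elim t)
    then have "AE x in ?M. F (x, t) = 0"
      by (intro complete_orthonormal_total[OF \<phi>]) auto
    then have "l2_norm ?M (\<lambda>x. F (x, t)) = l2_norm ?M (\<lambda>x. 0)"
      using elim(1) by (intro l2_norm_cong_AE L2_zero)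
    then show ?case by (simp add: l2_norm_def)
  qed
  then have "(LINT t|I01. (l2_norm ?M (\<lambda>x. F (x, t)))\<^sup>2) = 0"
    by (rule integral_eq_zero_AE)
  then have "l2_norm (lebesgue_on (cylinder S)) F = 0"
    unfolding L2_slices(3)[OF b fin F] by simp
  then show ?thesis
    by (rule l2_norm_zero_imp_AE[OF F])
qed

section \<open>The mixed Cauchy problem\<close>

locale mixed_cauchy_problem =
  fixes \<Omega> :: "'a::euclidean_space set"
    and Dom :: "('a \<Rightarrow> complex) set"
    and A :: "('a \<Rightarrow> complex) \<Rightarrow> 'a \<Rightarrow> complex"
    and \<mu> :: "nat \<Rightarrow> real" and \<phi> :: "nat \<Rightarrow> 'a \<Rightarrow> complex"
    and lam :: "nat \<Rightarrow> nat \<Rightarrow> complex" and v :: "nat \<Rightarrow> nat \<Rightarrow> real \<Rightarrow> complex"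
  assumes domain: "open \<Omega>" "bounded \<Omega>"
    and operator: "l2_operator (lebesgue_on \<Omega>) Dom A"
    and selfadj: "self_adjoint (lebesgue_on \<Omega>) Dom A"
    and coercive: "\<And>u. u \<in> Dom \<Longrightarrow> Re (l2_inner (lebesgue_on \<Omega>) (A u) u) \<ge> (l2_norm (lebesgue_on \<Omega>) u)\<^sup>2"
    and basis_x: "eigenbasis (lebesgue_on \<Omega>) Dom A \<mu> \<phi>"
    and basis_t: "\<And>k. complete_orthonormal I01 (v k)"
    and eigen_t: "\<And>k m. interval_eigenfunction (\<mu> k) (lam k m) (v k m)"
    and eigen_xt: "\<And>k m. cylinder_eigenfunction \<Omega> Dom A (lam k m) (tensor (\<phi> k) (v k m))"
    and lam_min: "\<And>k m. cmod (lam k 0) \<le> cmod (lam k m)"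
begin

abbreviation "M \<equiv> lebesgue_on \<Omega>"
abbreviation "N \<equiv> lebesgue_on (cylinder \<Omega>)"
abbreviation "u_km k m \<equiv> tensor (\<phi> k) (v k m)"

lemma borel: "\<Omega> \<in> sets borel" "{0<..<1::real} \<in> sets borel"
  using domain by auto

lemma open_cyl: "open (cylinder \<Omega>)" "bounded (cylinder \<Omega>)"
  using domain by (auto intro: open_Times bounded_Times)

lemma fin_N: "finite_measure N"
  by (rule finite_measure_lebesgue_on_open[OF open_cyl])

lemmas L2_reflect = L2_preserving[OF measurable_time_reflection[OF borel(1)] distr_time_reflection[OF borel(1)]]
lemmas inner_reflect = l2_inner_preserving[OF measurable_time_reflection[OF borel(1)] distr_time_reflection[OF borel(1)]]
lemmas norm_reflect = l2_norm_preserving[OF measurable_time_reflection[OF borel(1)] distr_time_reflection[OF borel(1)]]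

lemma reflect_twice: "time_reflection (time_reflection p) = p"
  by (simp add: time_reflection_def case_prod_unfold)

lemma phi: "complete_orthonormal M \<phi>" "\<phi> k \<in> Dom" "AE x in M. A (\<phi> k) x = of_real (\<mu> k) * \<phi> k x"
  using basis_x by (auto simp: eigenbasis_def)

lemma phi_L2: "\<phi> k \<in> L2 M"
  using phi(1) by (simp add: complete_orthonormal_def)

lemma v_L2: "v k m \<in> L2 I01"
  using basis_t by (simp add: complete_orthonormal_def)

lemma ukm_L2: "u_km k m \<in> L2 N"
  by (rule tensor_L2[OF borel phi_L2 v_L2])

lemma mu_ge_1: "1 \<le> \<mu> k"
proof -
  note D = l2_operatorD[OF operator phi(2)]
  have o: "orthonormal_family M \<phi>"
    using phi(1) by (rule complete_orthonormal_imp_family)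
  have "l2_inner M (A (\<phi> k)) (\<phi> k) = l2_inner M (\<lambda>x. of_real (\<mu> k) * \<phi> k x) (\<phi> k)"
    using phi(3) D(2) by (intro l2_inner_cong_AE) (auto intro: phi_L2 L2_cmult)
  also have "\<dots> = of_real (\<mu> k)"
    using o by (simp add: l2_inner_cmult_left orthonormal_family_def)
  finally show ?thesis
    using coercive[OF phi(2), of k] orthonormal_norm[OF o, of k] by simp
qed

lemma lam_real: "cnj (lam k m) = lam k m"
  using eigen_t by (rule interval_eigenvalue_real)

lemma lam_nonzero: "lam k m \<noteq> 0"
  using eigen_t mu_ge_1[of k] by (intro interval_eigenvalue_nonzero) auto

lemma lam_ge_1: "1 \<le> cmod (lam k (Suc m))"
  using mu_ge_1[of k]
  by (intro second_eigenvalue_ge_1[OF complete_orthonormal_imp_family[OF basis_t[of k]]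
        _ eigen_t[of k 0] eigen_t[of k "Suc m"] lam_min]) auto

lemma ukm_orthonormal: "orthonormal_family N (\<lambda>(k, m). u_km k m)"
  by (intro tensor_orthonormal complete_orthonormal_imp_family borel phi(1) basis_t)

lemma inner_A_phi:
  assumes "u \<in> Dom"
  shows "l2_inner M (A u) (\<phi> k) = of_real (\<mu> k) * l2_inner M u (\<phi> k)"
proof -
  have "(\<phi> k, A (\<phi> k)) \<in> adjoint_graph M Dom A"
    using selfadj phi(2) l2_operatorD(2)[OF operator phi(2)] by (auto simp: self_adjoint_def)
  then have "l2_inner M (A u) (\<phi> k) = l2_inner M u (A (\<phi> k))"
    using assms by (auto simp: adjoint_graph_def)
  also have "\<dots> = l2_inner M u (\<lambda>x. of_real (\<mu> k) * \<phi> k x)"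
    using phi(3) l2_operatorD(1,2)[OF operator] assms phi(2)
    by (intro l2_inner_cong_AE) (auto intro: phi_L2 L2_cmult)
  finally show ?thesis by (simp add: l2_inner_cmult_right)
qed

text \<open>
  Moving the reflection to the eigenfunction leaves the right-hand side \<open>f\<close> unreflected.
\<close>

lemma reflected_coeff_eq:
  assumes "f \<in> L2 N"
  shows "reflected_coeff \<Omega> f (u_km k m) = l2_inner N f (tensor (\<phi> k) (\<lambda>t. v k m (1 - t)))"
proof -
  have "reflected_coeff \<Omega> f (u_km k m) = l2_inner N (\<lambda>p. f (time_reflection p)) (u_km k m)"
    by (simp add: reflected_coeff_def time_reflection_def case_prod_unfold)
  also have "\<dots> = l2_inner N (\<lambda>p. f (time_reflection (time_reflection p))) (\<lambda>p. u_km k m (time_reflection p))"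
    by (rule inner_reflect[symmetric, OF L2_reflect[OF assms] ukm_L2])
  also have "(\<lambda>p. u_km k m (time_reflection p)) = tensor (\<phi> k) (\<lambda>t. v k m (1 - t))"
    by (auto simp: tensor_def time_reflection_def)
  finally show ?thesis by (simp add: reflect_twice)
qed

text \<open>
  The equation for \<open>g\<close> is given time by time, where self-adjointness turns \<open>A\<close> into multiplication by
  \<open>\<mu>\<^sub>k\<close>. Fubini's theorem then allows the integration by parts in \<open>t\<close> to be carried out for each fixed
  \<open>x\<close>, on the classical function \<open>w\<close>, without differentiating \<open>(w(\<cdot>, t), \<phi>\<^sub>k)\<close> under the integral sign.
\<close>

lemma reflected_coeff_admissible:
  assumes w: "admissible \<Omega> Dom w" and wg: "represents_LL \<Omega> A w g" and g: "g \<in> L2 N"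
  shows "l2_inner N g (tensor (\<phi> k) (\<lambda>t. v k m (1 - t))) = lam k m * l2_inner N w (u_km k m)"
proof -
  have "C_ext 2 (cylinder \<Omega>) (closure (cylinder \<Omega>)) w"
    using w by (simp add: admissible_def)
  then obtain W1 W2 where cw: "continuous_on (closure (cylinder \<Omega>)) w"
    and cW2: "continuous_on (closure (cylinder \<Omega>)) W2"
    and C2: "\<And>x. x \<in> \<Omega> \<Longrightarrow> C2_01 (\<lambda>t. w (x, t)) (\<lambda>t. W1 (x, t)) (\<lambda>t. W2 (x, t))"
    by (rule C_ext_2_slices) (rule that)
  define h where "h p = W2 p - of_real (\<mu> k) * w p" for p
  have hc: "continuous_on (closure (cylinder \<Omega>)) h"
    unfolding h_def[abs_def] using cw cW2 by (intro continuous_intros)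
  have hL: "h \<in> L2 N" and wL: "w \<in> L2 N"
    using continuous_L2[OF open_cyl] hc cw by auto
  have vr: "(\<lambda>t. v k m (1 - t)) \<in> L2 I01"
    by (rule L2_reflect_I01[OF v_L2])
  have slice_L2: "(\<lambda>x. f (x, t)) \<in> L2 M" if "continuous_on (closure (cylinder \<Omega>)) f" "t \<in> {0<..<1}" for f t
    using that(2) by (intro continuous_L2 domain continuous_on_compose2[OF that(1)])
      (auto simp: closure_cylinder intro!: continuous_intros)
  have "AE t in I01. t \<in> {0<..<1}"
    using AE_space[of I01] by simp
  then have slices: "AE t in I01. l2_inner M (\<lambda>x. g (x, t)) (\<phi> k) = l2_inner M (\<lambda>x. h (x, t)) (\<phi> k)"
    using wg[unfolded represents_LL_def] L2_slices(1)[OF borel fin_N g]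
  proof eventually_elim
    case (elim t)
    let ?w = "\<lambda>x. w (x, t)"
    have D: "?w \<in> Dom"
      using w elim(1) by (auto simp: admissible_def)
    note L = slice_L2[OF cW2 elim(1)] slice_L2[OF cw elim(1)] l2_operatorD(2)[OF operator D]
    have "AE x in M. x \<in> \<Omega>"
      using AE_space[of M] by simp
    with elim(2) have "AE x in M. g (x, t) = W2 (x, t) - A ?w x"
    proof eventually_elim
      case (elim x)
      then show ?case
        using dt_C2(2)[OF C2, of x t] \<open>t \<in> {0<..<1}\<close> by simp
    qed
    then have "l2_inner M (\<lambda>x. g (x, t)) (\<phi> k) = l2_inner M (\<lambda>x. W2 (x, t) - A ?w x) (\<phi> k)"
      using elim(3) L phi_L2 by (intro l2_inner_cong_AE) (auto intro: L2_diff)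
    also have "\<dots> = l2_inner M (\<lambda>x. W2 (x, t)) (\<phi> k) - of_real (\<mu> k) * l2_inner M ?w (\<phi> k)"
      using L phi_L2 by (simp add: l2_inner_diff_left inner_A_phi[OF D])
    also have "\<dots> = l2_inner M (\<lambda>x. h (x, t)) (\<phi> k)"
      unfolding h_def using L phi_L2 by (simp add: l2_inner_diff_left L2_cmult l2_inner_cmult_left)
    finally show ?case .
  qed
  have "l2_inner N g (tensor (\<phi> k) (\<lambda>t. v k m (1 - t)))
      = l2_inner I01 (\<lambda>t. l2_inner M (\<lambda>x. g (x, t)) (\<phi> k)) (\<lambda>t. v k m (1 - t))"
    by (rule l2_inner_tensor(1)[OF borel g phi_L2 vr])
  also have "\<dots> = l2_inner I01 (\<lambda>t. l2_inner M (\<lambda>x. h (x, t)) (\<phi> k)) (\<lambda>t. v k m (1 - t))"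
    using slices by (intro l2_inner_cong_AE slice_inner_L2 domain g hL phi_L2 vr) auto
  also have "\<dots> = l2_inner N h (tensor (\<phi> k) (\<lambda>t. v k m (1 - t)))"
    by (rule l2_inner_tensor(1)[symmetric, OF borel hL phi_L2 vr])
  also have "\<dots> = l2_inner M (\<lambda>x. l2_inner I01 (\<lambda>t. h (x, t)) (\<lambda>t. v k m (1 - t))) (\<phi> k)"
    by (rule l2_inner_tensor(2)[OF borel hL phi_L2 vr])
  also have "\<dots> = l2_inner M (\<lambda>x. lam k m * l2_inner I01 (\<lambda>t. w (x, t)) (v k m)) (\<phi> k)"
  proof -
    have "l2_inner I01 (\<lambda>t. h (x, t)) (\<lambda>t. v k m (1 - t)) = lam k m * l2_inner I01 (\<lambda>t. w (x, t)) (v k m)"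
      if x: "x \<in> \<Omega>" for x
    proof -
      have "w (x, 0) = 0" "W1 (x, 0) = 0"
        using w x dt_C2(1)[OF C2[OF x], of 0] by (auto simp: admissible_def)
      from Green_eigenfunction[OF eigen_t C2[OF x] this, of k m]
      show ?thesis by (simp add: l2_inner_def h_def lam_real)
    qed
    then show ?thesis
      unfolding l2_inner_def[of M] by (intro Bochner_Integration.integral_cong) auto
  qed
  also have "\<dots> = lam k m * l2_inner N w (u_km k m)"
    by (simp add: l2_inner_cmult_left l2_inner_tensor(2)[OF borel wL phi_L2 v_L2])
  finally show ?thesis .
qed

lemma reflected_coeff_strong_solution:
  assumes "strong_solution \<Omega> Dom A f u"
  shows "reflected_coeff \<Omega> f (u_km k m) = lam k m * l2_inner N u (u_km k m)"
proof -
  obtain w g where w: "\<And>n. admissible \<Omega> Dom (w n)" "\<And>n. represents_LL \<Omega> A (w n) (g n)"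
      "l2_tendsto N w u" "l2_tendsto N g f"
    using assms unfolding strong_solution_def by blast
  let ?e = "tensor (\<phi> k) (\<lambda>t. v k m (1 - t))"
  have "(\<lambda>n. l2_inner N (g n) ?e) \<longlonglongrightarrow> l2_inner N f ?e"
    by (intro l2_tendsto_inner w tensor_L2 borel phi_L2 L2_reflect_I01 v_L2)
  moreover have "(\<lambda>n. lam k m * l2_inner N (w n) (u_km k m)) \<longlonglongrightarrow> lam k m * l2_inner N u (u_km k m)"
    by (intro tendsto_mult tendsto_const l2_tendsto_inner w ukm_L2)
  moreover have "l2_inner N (g n) ?e = lam k m * l2_inner N (w n) (u_km k m)" for n
    by (rule reflected_coeff_admissible[OF w(1,2) l2_tendstoD(1)[OF w(4)]])
  ultimately have "l2_inner N f ?e = lam k m * l2_inner N u (u_km k m)"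
    using LIMSEQ_unique by auto
  then show ?thesis
    using reflected_coeff_eq[OF strong_solution_L2(1)[OF assms]] by simp
qed

lemma ukm_total:
  assumes "F \<in> L2 N" "G \<in> L2 N" "\<And>k m. l2_inner N F (u_km k m) = l2_inner N G (u_km k m)"
  shows "AE p in N. F p = G p"
proof -
  have "AE p in N. F p - G p = 0"
    by (rule tensor_total[where v=v, OF domain phi(1) basis_t L2_diff[OF assms(1,2)]])
       (simp add: l2_inner_diff_left assms ukm_L2)
  then show ?thesis by simp
qed

lemma sums_reflect:
  assumes F: "l2_sums N F s" and FL: "\<And>k. F k \<in> L2 N"
  shows "l2_sums N (\<lambda>k p. F k (time_reflection p)) (\<lambda>p. s (time_reflection p))"
proof -
  note D = l2_tendstoD[OF F[unfolded l2_sums_def]]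
  have "l2_norm N (\<lambda>p. (\<Sum>k<n. F k (time_reflection p)) - s (time_reflection p))
      = l2_norm N (\<lambda>p. (\<Sum>k<n. F k p) - s p)" for n
    using norm_reflect[OF L2_diff[OF D(1,2)], of n] .
  with D(3) show ?thesis
    unfolding l2_sums_def l2_tendsto_def
    using L2_reflect[OF D(1)] L2_reflect[OF D(2)] by simp
qed

lemma strong_solution_term:
  assumes "c * lam k m = d"
  shows "strong_solution \<Omega> Dom A (\<lambda>p. d * u_km k m (time_reflection p)) (\<lambda>p. c * u_km k m p)"
proof -
  have s: "strong_solution \<Omega> Dom A (\<lambda>(x, t). lam k m * u_km k m (x, 1 - t)) (u_km k m)"
    using eigen_xt by (simp add: cylinder_eigenfunction_def)
  have eq: "(\<lambda>p. c * (case p of (x, t) \<Rightarrow> lam k m * u_km k m (x, 1 - t)) + 0 * (case p of (x, t) \<Rightarrow> lam k m * u_km k m (x, 1 - t)))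
      = (\<lambda>p. d * u_km k m (time_reflection p))"
    by (auto simp: time_reflection_def assms[symmetric])
  from strong_solution_lincomb[OF operator s s, of c 0] show ?thesis
    unfolding eq by simp
qed

text \<open>
  The coefficients \<open>d\<close> of the reflected right-hand side and the coefficients \<open>c = d / \<lambda>\<close> of the solution
  are expanded in the same order of summation, so that closedness of the relation applies to each of
  the nested series. The expansion of \<open>d\<close> reproduces the reflected right-hand side by completeness.
\<close>

lemma ex_strong_solution:
  assumes f: "f \<in> L2 N"
    and summ: "summable (\<lambda>k. (cmod (reflected_coeff \<Omega> f (u_km k 0) / lam k 0))\<^sup>2)"
  shows "\<exists>u. strong_solution \<Omega> Dom A f u"
proof -
  define d where "d k m = reflected_coeff \<Omega> f (u_km k m)" for k m
  define c where "c k m = d k m / lam k m" for k m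
  let ?R = "\<lambda>p. f (time_reflection p)"
  have R: "?R \<in> L2 N" by (rule L2_reflect[OF f])
  have d: "d k m = l2_inner N ?R (u_km k m)" for k m
    by (simp add: d_def reflected_coeff_def time_reflection_def case_prod_unfold)
  have cd: "c k m * lam k m = d k m" for k m
    by (simp add: c_def lam_nonzero)
  have dB: "(\<Sum>k<K. \<Sum>m<L. (cmod (d k m))\<^sup>2) \<le> (l2_norm N ?R)\<^sup>2" for K L
    using Bessel_double[OF ukm_orthonormal R, where K=K and L=L] by (simp add: d)
  have summ': "summable (\<lambda>k. (cmod (c k 0))\<^sup>2)"
    using summ by (simp add: c_def d_def)
  have cB: "(\<Sum>k<K. \<Sum>m<L. (cmod (c k m))\<^sup>2) \<le> (\<Sum>k. (cmod (c k 0))\<^sup>2) + (l2_norm N ?R)\<^sup>2" for K L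
  proof -
    \<comment> \<open>for \<open>m = 0\<close> the hypothesis is used, for \<open>m > 0\<close> the bound \<open>\<bar>\<lambda>\<^sub>k\<^sub>m\<bar> \<ge> 1\<close>\<close>
    have "(cmod (c k m))\<^sup>2 \<le> (if m = 0 then (cmod (c k 0))\<^sup>2 else 0) + (cmod (d k m))\<^sup>2" for k m
    proof (cases m)
      case (Suc m')
      have "cmod (c k m) \<le> cmod (d k m) / 1"
        unfolding c_def norm_divide Suc using lam_ge_1[of k m'] by (intro divide_left_mono) auto
      then show ?thesis using Suc by (simp add: power_mono)
    qed simp
    then have "(\<Sum>k<K. \<Sum>m<L. (cmod (c k m))\<^sup>2)
        \<le> (\<Sum>k<K. \<Sum>m<L. (if m = 0 then (cmod (c k 0))\<^sup>2 else 0) + (cmod (d k m))\<^sup>2)"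
      by (intro sum_mono)
    also have "\<dots> = (\<Sum>k<K. \<Sum>m<L. (if m = 0 then (cmod (c k 0))\<^sup>2 else 0)) + (\<Sum>k<K. \<Sum>m<L. (cmod (d k m))\<^sup>2)"
      by (simp add: sum.distrib)
    also have "(\<Sum>k<K. \<Sum>m<L. (if m = 0 then (cmod (c k 0))\<^sup>2 else 0)) \<le> (\<Sum>k<K. (cmod (c k 0))\<^sup>2)"
      by (intro sum_mono) simp
    also have "\<dots> \<le> (\<Sum>k. (cmod (c k 0))\<^sup>2)"
      using summ' by (intro sum_le_suminf) auto
    finally show ?thesis using dB[where K=K and L=L] by simp
  qed
  obtain s1 r s2 where s: "l2_sums N (\<lambda>k x. c k 0 * u_km k 0 x) s1"
    "\<And>k. l2_sums N (\<lambda>m x. c k (Suc m) * u_km k (Suc m) x) (r k)" "l2_sums N r s2"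
    using double_orthonormal_expansion[OF ukm_orthonormal cB] by blast
  obtain t1 q t2 where t: "l2_sums N (\<lambda>k x. d k 0 * u_km k 0 x) t1"
    "\<And>k. l2_sums N (\<lambda>m x. d k (Suc m) * u_km k (Suc m) x) (q k)" "l2_sums N q t2"
    and t_inner: "\<And>k m. l2_inner N (\<lambda>x. t1 x + t2 x) (u_km k m) = d k m"
    using double_orthonormal_expansion[OF ukm_orthonormal dB] by blast
  have tL: "t1 \<in> L2 N" "t2 \<in> L2 N" "q k \<in> L2 N" for k
    using t by (simp_all add: l2_sums_def l2_tendsto_def)
  have S1: "strong_solution \<Omega> Dom A (\<lambda>p. t1 (time_reflection p)) s1"
    by (rule strong_solution_sums[OF operator strong_solution_term[OF cd] s(1) sums_reflect[OF t(1) L2_cmult[OF ukm_L2]]])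
  have S2: "strong_solution \<Omega> Dom A (\<lambda>p. q k (time_reflection p)) (r k)" for k
    by (rule strong_solution_sums[OF operator strong_solution_term[OF cd] s(2) sums_reflect[OF t(2) L2_cmult[OF ukm_L2]]])
  have S3: "strong_solution \<Omega> Dom A (\<lambda>p. t2 (time_reflection p)) s2"
    by (rule strong_solution_sums[OF operator S2 s(3) sums_reflect[OF t(3) tL(3)]])
  let ?t = "\<lambda>p. t1 p + t2 p"
  have S: "strong_solution \<Omega> Dom A (\<lambda>p. ?t (time_reflection p)) (\<lambda>p. s1 p + s2 p)"
    using strong_solution_lincomb[OF operator S1 S3, of 1 1] by simp
  have tL2: "?t \<in> L2 N" by (intro L2_add tL)
  have "AE p in N. ?t p = ?R p"
    by (rule ukm_total[OF tL2 R]) (simp add: t_inner d)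
  then have "l2_norm N (\<lambda>p. ?t p - ?R p) = l2_norm N (\<lambda>p. 0)"
    by (intro l2_norm_cong_AE L2_diff tL2 R L2_zero) auto
  then have "l2_norm N (\<lambda>p. ?t (time_reflection p) - f p) = 0"
    using norm_reflect[OF L2_diff[OF tL2 R]] by (simp add: reflect_twice l2_norm_def)
  from l2_norm_zero_imp_AE[OF L2_diff[OF L2_reflect[OF tL2] f] this]
  have "AE p in N. ?t (time_reflection p) = f p" by simp
  from strong_solution_cong_AE[OF S this f] show ?thesis by blast
qed

lemma strong_solution_coefficients:
  assumes u: "strong_solution \<Omega> Dom A f u"
  shows "reflected_coeff \<Omega> f (u_km k m) / lam k m = l2_inner N u (u_km k m)"
  by (simp add: reflected_coeff_strong_solution[OF u] lam_nonzero)

lemma summable_strong_solution: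
  assumes u: "strong_solution \<Omega> Dom A f u"
  shows "summable (\<lambda>k. (cmod (reflected_coeff \<Omega> f (u_km k 0) / lam k 0))\<^sup>2)"
  unfolding strong_solution_coefficients[OF u]
proof (rule summableI_nonneg_bounded)
  show "(\<Sum>k<K. (cmod (l2_inner N u (u_km k 0)))\<^sup>2) \<le> (l2_norm N u)\<^sup>2" for K
    using Bessel_double[OF ukm_orthonormal strong_solution_L2(2)[OF u], where K=K and L=1] by simp
qed simp

lemma strong_solution_expansion:
  assumes u: "strong_solution \<Omega> Dom A f u"
  shows "\<exists>s1 s2 r.
     l2_sums N (\<lambda>k p. reflected_coeff \<Omega> f (u_km k 0) / lam k 0 * u_km k 0 p) s1 \<and>
     (\<forall>k. l2_sums N (\<lambda>m p. reflected_coeff \<Omega> f (u_km k (Suc m)) / lam k (Suc m) * u_km k (Suc m) p) (r k)) \<and>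
     l2_sums N r s2 \<and> (AE p in N. u p = s1 p + s2 p)"
proof -
  note uL = strong_solution_L2(2)[OF u]
  let ?c = "\<lambda>k m. l2_inner N u (u_km k m)"
  have "(\<Sum>k<K. \<Sum>m<L. (cmod (?c k m))\<^sup>2) \<le> (l2_norm N u)\<^sup>2" for K L
    using Bessel_double[OF ukm_orthonormal uL, where K=K and L=L] by simp
  from double_orthonormal_expansion[OF ukm_orthonormal this]
  obtain s1 r s2 where s: "l2_sums N (\<lambda>k x. ?c k 0 * u_km k 0 x) s1"
    "\<And>k. l2_sums N (\<lambda>m x. ?c k (Suc m) * u_km k (Suc m) x) (r k)" "l2_sums N r s2"
    and i: "\<And>k m. l2_inner N (\<lambda>x. s1 x + s2 x) (u_km k m) = ?c k m"
    by blast
  have "(\<lambda>p. s1 p + s2 p) \<in> L2 N"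
    using s by (intro L2_add) (simp_all add: l2_sums_def l2_tendsto_def)
  then have "AE p in N. u p = s1 p + s2 p"
    by (rule ukm_total[OF uL]) (simp add: i)
  with s show ?thesis
    unfolding strong_solution_coefficients[OF u] by blast
qed

end

(* Sequences are indexed from 0: the index pair (k, m) here is (k + 1, m + 1) in 1-based numbering. *)
theorem theorem2:
  fixes \<Omega> :: "'a::euclidean_space set"
    and Dom :: "('a \<Rightarrow> complex) set"
    and A :: "('a \<Rightarrow> complex) \<Rightarrow> 'a \<Rightarrow> complex"
    and \<mu> :: "nat \<Rightarrow> real" and \<phi> :: "nat \<Rightarrow> 'a \<Rightarrow> complex"
    and lam :: "nat \<Rightarrow> nat \<Rightarrow> complex" and v :: "nat \<Rightarrow> nat \<Rightarrow> real \<Rightarrow> complex"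
    and f :: "'a \<times> real \<Rightarrow> complex"
  assumes "bounded_smooth_domain \<Omega>"
    and "l2_operator (lebesgue_on \<Omega>) Dom A"
    and "self_adjoint (lebesgue_on \<Omega>) Dom A"
    and "compact_resolvent (lebesgue_on \<Omega>) Dom A"
    and "\<And>u. u \<in> Dom \<Longrightarrow> Re (l2_inner (lebesgue_on \<Omega>) (A u) u) \<ge> (l2_norm (lebesgue_on \<Omega>) u)\<^sup>2"
    and "eigenbasis (lebesgue_on \<Omega>) Dom A \<mu> \<phi>"
    and "\<And>k. complete_orthonormal (lebesgue_on {0<..<1}) (v k)"
    and "\<And>k m. interval_eigenfunction (\<mu> k) (lam k m) (v k m)"
    and "\<And>k m. cylinder_eigenfunction \<Omega> Dom A (lam k m) (tensor (\<phi> k) (v k m))"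
    and "\<And>k m. cmod (lam k 0) \<le> cmod (lam k m)"
    and "f \<in> L2 (lebesgue_on (cylinder \<Omega>))"
  shows "((\<exists>u. strong_solution \<Omega> Dom A f u) \<longleftrightarrow>
          summable (\<lambda>k. (cmod (reflected_coeff \<Omega> f (tensor (\<phi> k) (v k 0)) / lam k 0))\<^sup>2)) \<and>
         (summable (\<lambda>k. (cmod (reflected_coeff \<Omega> f (tensor (\<phi> k) (v k 0)) / lam k 0))\<^sup>2) \<longrightarrow>
          (\<forall>u. strong_solution \<Omega> Dom A f u \<longrightarrow>
            (\<exists>s\<^sub>1 s\<^sub>2 r.
               l2_sums (lebesgue_on (cylinder \<Omega>))
                 (\<lambda>k p. reflected_coeff \<Omega> f (tensor (\<phi> k) (v k 0)) / lam k 0 * tensor (\<phi> k) (v k 0) p) s\<^sub>1 \<and>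
               (\<forall>k. l2_sums (lebesgue_on (cylinder \<Omega>))
                 (\<lambda>m p. reflected_coeff \<Omega> f (tensor (\<phi> k) (v k (Suc m))) / lam k (Suc m)
                          * tensor (\<phi> k) (v k (Suc m)) p) (r k)) \<and>
               l2_sums (lebesgue_on (cylinder \<Omega>)) r s\<^sub>2 \<and>
               (AE p in lebesgue_on (cylinder \<Omega>). u p = s\<^sub>1 p + s\<^sub>2 p))))"
proof -
  interpret mixed_cauchy_problem \<Omega> Dom A \<mu> \<phi> lam v
    by unfold_locales (use assms in \<open>auto simp: bounded_smooth_domain_def\<close>)
  show ?thesis
  proof (intro conjI iffI impI allI)
    assume "\<exists>u. strong_solution \<Omega> Dom A f u"
    then show "summable (\<lambda>k. (cmod (reflected_coeff \<Omega> f (tensor (\<phi> k) (v k 0)) / lam k 0))\<^sup>2)"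
      using summable_strong_solution by blast
  next
    assume "summable (\<lambda>k. (cmod (reflected_coeff \<Omega> f (tensor (\<phi> k) (v k 0)) / lam k 0))\<^sup>2)"
    then show "\<exists>u. strong_solution \<Omega> Dom A f u"
      by (rule ex_strong_solution[OF assms(11)])
  next
    fix u
    assume "strong_solution \<Omega> Dom A f u"
    then show "\<exists>s\<^sub>1 s\<^sub>2 r.
        l2_sums N (\<lambda>k p. reflected_coeff \<Omega> f (u_km k 0) / lam k 0 * u_km k 0 p) s\<^sub>1 \<and>
        (\<forall>k. l2_sums N (\<lambda>m p. reflected_coeff \<Omega> f (u_km k (Suc m)) / lam k (Suc m) * u_km k (Suc m) p) (r k)) \<and>
        l2_sums N r s\<^sub>2 \<and> (AE p in N. u p = s\<^sub>1 p + s\<^sub>2 p)"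
      by (rule strong_solution_expansion)
  qed
qed

end
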